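(* Let $K$ be an algebraically closed field of arbitrary characteristic. If $0\neq f\in\langle x,y\rangle\subset K[[x,y]]$ is weakly Newton non-degenerate (WNND), then $$\mu_N(f)=2\cdot\delta(f)-r(f)+1.$$
   Context: Write $f=\sum_\alpha a_\alpha x^{\alpha_1}y^{\alpha_2}$, $\operatorname{supp}(f)=\{\alpha\mid a_\alpha\neq 0\}$. The Newton diagram $\Gamma(f)$ is the union of the compact faces (vertices and edges) of the convex hull of $\bigcup_{\alpha\in\operatorname{supp}(f)}(\alpha+\mathbb{R}_{\geq0}^2)$; $\Gamma_-(f)$ is the union of all segments joining the origin to points of $\Gamma(f)$; $f$ is convenient if $\Gamma(f)$ meets both coordinate axes. The facets of $\Gamma(f)$ are its edges. For a face $\Delta$ put $\operatorname{in}_\Delta(f)=\sum_{\alpha\in\Delta}a_\alpha x^{\alpha_1}y^{\alpha_2}$. $f$ is WNND if for every facet $\Delta$ of $\Gamma(f)$ the polynomial $g=\operatorname{in}_\Delta(f)$ and its partial derivatives $g_x,g_y$ have no common zero in $(K^* )^2$. Newton number: if $f$ is convenient, $\mu_N(f)=2V_2(\Gamma_-(f))-V_1(\Gamma_-(f))+1$, where $V_2$ is the area and $V_1$ the sum of the lengths of the intersections with the two coordinate axes. Otherwise $\mu_N(f)=\sup\{\mu_N(f_m)\mid m\geq1\}\in\mathbb{Z}\cup\{\infty\}$, where $f_m=f+x^m+y^m$ and no cancellation is allowed, i.e. the Newton diagram of $f_m$ is formed from the support $\operatorname{supp}(f)\cup\{(m,0),(0,m)\}$. Delta invariant: $\delta(f)=\sum_{Q\to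 0}\frac{m_Q(m_Q-1)}{2}\in\mathbb{Z}_{\geq0}\cup\{\infty\}$, where the sum runs over the infinitely near points $Q$ of the origin (including the origin) in a minimal resolution obtained by successively blowing up points, and $m_Q$ is the multiplicity of the strict transform of $f$ at $Q$ (so $\delta(f)=\infty$ if $f$ is not reduced). $r(f)$ is the number of branches (irreducible factors in $K[[x,y]]$) of $f$ counted with multiplicity. The equation is understood in $\mathbb{Z}\cup\{\infty\}$. *)

theory Defs
  imports
    "HOL-Analysis.Analysis"
    "HOL-Computational_Algebra.Computational_Algebra"
    "HOL-Library.Multiset"
begin

section \<open>Power series in two variables\<close>

text \<open>
  \<open>K[[x, y]]\<close> is taken to be \<open>K[[x]][[y]]\<close>: the outer series variable is \<open>y\<close>, the inner one \<open>x\<close>.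
\<close>

type_synonym 'a series2 = "'a fps fps"

definition coeff2 :: "'a series2 \<Rightarrow> nat \<Rightarrow> nat \<Rightarrow> 'a" where
  "coeff2 f i j = fps_nth (fps_nth f j) i"

definition series2 :: "(nat \<Rightarrow> nat \<Rightarrow> 'a) \<Rightarrow> 'a series2" where
  "series2 a = Abs_fps (\<lambda>j. Abs_fps (\<lambda>i. a i j))"

definition var_x :: "'a::comm_ring_1 series2" where
  "var_x = fps_const fps_X"

definition var_y :: "'a::comm_ring_1 series2" where
  "var_y = fps_X"

definition max_ideal :: "'a::comm_ring_1 series2 set" where
  "max_ideal = {var_x * g + var_y * h | g h. True}"

definition supp :: "'a::zero series2 \<Rightarrow> (nat \<times> nat) set" where
  "supp f = {(i, j). coeff2 f i j \<noteq> 0}"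


section \<open>Newton diagram and Newton number\<close>

text \<open>Everything that depends only on the support is defined for an arbitrary set of exponents.\<close>

definition newton_polyhedron :: "(nat \<times> nat) set \<Rightarrow> (real \<times> real) set" where
  "newton_polyhedron S =
     convex hull (\<Union>(i, j)\<in>S. (\<lambda>v. (real i, real j) + v) ` ({0..} \<times> {0..}))"

definition newton_diagram :: "(nat \<times> nat) set \<Rightarrow> (real \<times> real) set" where
  "newton_diagram S = \<Union>{F. F face_of newton_polyhedron S \<and> compact F}"

definition newton_facets :: "(nat \<times> nat) set \<Rightarrow> (real \<times> real) set set" where
  "newton_facets S = {F. F edge_of newton_polyhedron S \<and> compact F}"

definition below_diagram :: "(nat \<times> nat) set \<Rightarrow> (real \<times> real) set" where
  "below_diagram S = (\<Union>p\<in>newton_diagram S. closed_segment 0 p)"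

definition convenient :: "(nat \<times> nat) set \<Rightarrow> bool" where
  "convenient S \<longleftrightarrow>
     (\<exists>t. (t, 0) \<in> newton_diagram S) \<and> (\<exists>t. (0, t) \<in> newton_diagram S)"

definition newton_area :: "(nat \<times> nat) set \<Rightarrow> real" where
  "newton_area S = measure lborel (below_diagram S)"

definition newton_axes_length :: "(nat \<times> nat) set \<Rightarrow> real" where
  "newton_axes_length S =
     measure lborel {t. (t, 0) \<in> below_diagram S} + measure lborel {t. (0, t) \<in> below_diagram S}"

definition newton_number_convenient :: "(nat \<times> nat) set \<Rightarrow> real" where
  "newton_number_convenient S = 2 * newton_area S - newton_axes_length S + 1"

definition newton_number :: "'a::zero series2 \<Rightarrow> ereal" where
  "newton_number f =
     (if convenient (supp f) then ereal (newton_number_convenient (supp f))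
      else (SUP m\<in>{1..}. ereal (newton_number_convenient (supp f \<union> {(m, 0), (0, m)}))))"


section \<open>Weak Newton non-degeneracy\<close>

text \<open>
  Polynomials in \<open>x\<close>, \<open>y\<close> are polynomials in \<open>y\<close> over \<open>K[x]\<close>. For compact \<open>\<Delta>\<close> the sum is finite.
\<close>

definition in_face :: "(real \<times> real) set \<Rightarrow> 'a::comm_ring_1 series2 \<Rightarrow> 'a poly poly" where
  "in_face \<Delta> f =
     (\<Sum>(i, j)\<in>{(i, j)\<in>supp f. (real i, real j) \<in> \<Delta>}. monom (monom (coeff2 f i j) i) j)"

definition poly2 :: "'a::comm_ring_1 poly poly \<Rightarrow> 'a \<Rightarrow> 'a \<Rightarrow> 'a" where
  "poly2 g a b = poly (poly g [:b:]) a"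

definition pderiv_x :: "'a::idom poly poly \<Rightarrow> 'a poly poly" where
  "pderiv_x g = map_poly pderiv g"

definition pderiv_y :: "'a::idom poly poly \<Rightarrow> 'a poly poly" where
  "pderiv_y g = pderiv g"

definition WNND :: "'a::field series2 \<Rightarrow> bool" where
  "WNND f \<longleftrightarrow>
     (\<forall>\<Delta>\<in>newton_facets (supp f).
        let g = in_face \<Delta> f in
        \<not> (\<exists>a b. a \<noteq> 0 \<and> b \<noteq> 0 \<and>
               poly2 g a b = 0 \<and> poly2 (pderiv_x g) a b = 0 \<and> poly2 (pderiv_y g) a b = 0))"


section \<open>Infinitely near points and the delta invariant\<close>

definition mult_origin :: "'a::zero series2 \<Rightarrow> nat" where
  "mult_origin f = (LEAST n. \<exists>i j. i + j = n \<and> coeff2 f i j \<noteq> 0)"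

text \<open>
  A point of the exceptional line \<open>P\<^sup>1(K)\<close> of the blowing up of the origin is \<open>Some c\<close> or \<open>None\<close>.
  At \<open>Some c\<close> the local coordinates \<open>x'\<close>, \<open>y'\<close> satisfy \<open>x = x'\<close>, \<open>y = x' (y' + c)\<close>, so that
  \<open>x\<^sup>i y\<^sup>j\<close> becomes the sum over \<open>k \<le> j\<close> of \<open>(j choose k) c\<^bsup>j-k\<^esup> x'\<^bsup>i+j\<^esup> y'\<^bsup>k\<^esup>\<close>; at \<open>None\<close> they satisfy
  \<open>x = x' y'\<close>, \<open>y = y'\<close>.
\<close>

fun total_transform :: "'a option \<Rightarrow> 'a::comm_ring_1 series2 \<Rightarrow> 'a series2" where
  "total_transform (Some c) f =
     series2 (\<lambda>n k. \<Sum>j\<le>n. coeff2 f (n - j) j * of_nat (j choose k) * c ^ (j - k))"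
| "total_transform None f =
     series2 (\<lambda>i n. if i \<le> n then coeff2 f i (n - i) else 0)"

text \<open>
  The exceptional line has the equation \<open>x' = 0\<close> or \<open>y' = 0\<close>; its \<open>mult_origin f\<close>-th power divides the
  total transform of \<open>f\<close>, and the quotient is the strict transform.
\<close>

fun strict_transform1 :: "'a option \<Rightarrow> 'a::comm_ring_1 series2 \<Rightarrow> 'a series2" where
  "strict_transform1 (Some c) f =
     series2 (\<lambda>i j. coeff2 (total_transform (Some c) f) (i + mult_origin f) j)"
| "strict_transform1 None f =
     series2 (\<lambda>i j. coeff2 (total_transform None f) i (j + mult_origin f))"

text \<open>
  An infinitely near point of the origin is the list of the points of the successive exceptional
  lines leading to it; the origin itself is \<open>[]\<close>.
\<close>

definition strict_transform :: "'a option list \<Rightarrow> 'a::comm_ring_1 series2 \<Rightarrow> 'a series2" where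
  "strict_transform Q f = fold strict_transform1 Q f"

text \<open>
  The points of the strict transforms of \<open>f\<close> occurring in the minimal resolution: precisely the
  points at which the strict transform is singular get blown up. For non-reduced \<open>f\<close> the process
  does not terminate.
\<close>

inductive_set resolution_points :: "'a::comm_ring_1 series2 \<Rightarrow> 'a option list set"
  for f :: "'a series2" where
  origin: "[] \<in> resolution_points f"
| blowup: "Q \<in> resolution_points f \<Longrightarrow> mult_origin (strict_transform Q f) \<ge> 2 \<Longrightarrow>
     mult_origin (strict_transform (Q @ [c]) f) \<ge> 1 \<Longrightarrow> Q @ [c] \<in> resolution_points f"

definition delta :: "'a::comm_ring_1 series2 \<Rightarrow> enat" where
  "delta f =
     (\<Sum>\<^sub>\<infinity>Q\<in>resolution_points f.
        let m = mult_origin (strict_transform Q f) in enat (m * (m - 1) div 2))"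


section \<open>Branches\<close>

text \<open>
  Since \<open>K[[x, y]]\<close> is factorial, the number of irreducible factors of \<open>f \<noteq> 0\<close> is well defined.
\<close>

definition num_branches :: "'a::field series2 \<Rightarrow> nat" where
  "num_branches f =
     (THE n. \<exists>A u. (\<forall>p\<in>#A. irreducible p) \<and> u dvd 1 \<and> f = u * prod_mset A \<and> size A = n)"

end

theory Submission
  imports
    Defs
    "HOL-Number_Theory.Cong"
begin

text \<open>
  Induction along the blow-ups. Writing \<open>m\<close> for the multiplicity of \<open>f\<close> and \<open>f\<^sub>1\<close>, \<open>f\<^sub>2\<close> for
  the strict transforms at the two torus-fixed points of the exceptional line, the three invariants
  satisfy compatible recursions: the region below the Newton diagram of \<open>f\<close> is the triangle
  \<open>x + y < m\<close> together with sheared copies of the regions of \<open>f\<^sub>1\<close> and \<open>f\<^sub>2\<close>, so that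
  \<open>\<mu>(f) = m\<^sup>2 - m + \<mu>(f\<^sub>1) + \<mu>(f\<^sub>2) - s - 1\<close>, where \<open>s\<close> is the length of the edge of slope \<open>-1\<close>;
  at the other points of the exceptional line non-degeneracy makes the strict transform smooth, so that
  \<open>\<delta>(f) = m (m - 1) / 2 + \<delta>(f\<^sub>1) + \<delta>(f\<^sub>2)\<close>; and \<open>r(f) = r(f\<^sub>1) + r(f\<^sub>2) + s\<close>.
  For the last equation a quasi-homogeneous Hensel lemma shows that each irreducible factor of \<open>f\<close> is
  \<open>x\<close>, \<open>y\<close>, or has one edge without inner lattice points as its Newton diagram; such factors
  correspond to each other under blowing up. Since any factorization yields
  \<open>\<mu> = 2\<delta> - r + 1\<close>, its length is unique. If \<open>x\<^sup>2\<close> or \<open>y\<^sup>2\<close> divides \<open>f\<close>, both sides are infinite.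
\<close>


section \<open>Coefficients and units\<close>

text \<open>Weak non-degeneracy is given on facets and by partial derivatives, a form that neither
  factors nor strict transforms inherit directly. It is therefore tested for every positive weight,
  which adds only monomial initial forms without zeros in the torus, and by Euler derivations, which
  preserve weights and differ from the partial derivatives by factors that are non-zero on the
  torus. The Leibniz rule then handles factors, a monomial substitution the two charts. No step
  divides by an integer in K, so the characteristic is arbitrary.

  The multiplicity need not drop under blowing up. The induction is on two exponents close to the
  axes, which exist exactly if neither x^2 nor y^2 divides the series.

  The supremum in the Newton number is reached exactly: a blow-up of multiplicity m turns added axis
  exponents k into k - m without changing the resulting polyhedra, so the induction proves an
  equality for all large k. Monotonicity in k then identifies this value with the supremum.\<close>

lemma series2_eqI: "(\<And>i j. coeff2 f i j = coeff2 g i j) \<Longrightarrow> f = g"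
  by (simp add: coeff2_def fps_eq_iff)

lemma coeff2_series2 [simp]: "coeff2 (series2 a) i j = a i j"
  by (simp add: coeff2_def series2_def)

lemma coeff2_0 [simp]: "coeff2 0 i j = 0"
  by (simp add: coeff2_def)

lemma coeff2_1: "coeff2 1 i j = (if i = 0 \<and> j = 0 then 1 else 0)"
  by (simp add: coeff2_def)

lemma coeff2_add [simp]:
  fixes f :: "'a::comm_ring_1 series2"
  shows "coeff2 (f + g) i j = coeff2 f i j + coeff2 g i j"
  by (simp add: coeff2_def)

lemma coeff2_diff [simp]:
  fixes f :: "'a::comm_ring_1 series2"
  shows "coeff2 (f - g) i j = coeff2 f i j - coeff2 g i j"
  by (simp add: coeff2_def)

lemma coeff2_of_nat_mult [simp]:
  fixes f :: "'a::comm_ring_1 series2"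
  shows "coeff2 (of_nat n * f) i j = of_nat n * coeff2 f i j"
  by (induction n) (auto simp: distrib_right)

lemma coeff2_mult_of_nat [simp]:
  fixes f :: "'a::comm_ring_1 series2"
  shows "coeff2 (f * of_nat n) i j = of_nat n * coeff2 f i j"
  by (subst mult.commute) simp

lemma coeff2_sum: "coeff2 (\<Sum>x\<in>A. f x) i j = (\<Sum>x\<in>A. coeff2 (f x) i j)"
  by (simp add: coeff2_def fps_sum_nth)

lemma coeff2_mult:
  fixes f g :: "'a::comm_ring_1 series2"
  shows "coeff2 (f * g) i j =
    (\<Sum>(s, t)\<in>{(s, t). fst s + fst t = i \<and> snd s + snd t = j}.
      coeff2 f (fst s) (snd s) * coeff2 g (fst t) (snd t))"
proof -
  have "coeff2 (f * g) i j =
      (\<Sum>l\<in>{0..j}. \<Sum>k\<in>{0..i}. coeff2 f k l * coeff2 g (i - k) (j - l))"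
    by (simp add: coeff2_def fps_mult_nth fps_sum_nth)
  also have "\<dots> = (\<Sum>(l, k)\<in>{0..j} \<times> {0..i}. coeff2 f k l * coeff2 g (i - k) (j - l))"
    by (simp add: sum.cartesian_product)
  also have "\<dots> = (\<Sum>(s, t)\<in>{(s, t). fst s + fst t = i \<and> snd s + snd t = j}.
      coeff2 f (fst s) (snd s) * coeff2 g (fst t) (snd t))"
    by (rule sum.reindex_bij_witness
        [where i = "\<lambda>(s, t). (snd s, fst s)" and j = "\<lambda>(l, k). ((k, l), (i - k, j - l))"]) auto
  finally show ?thesis .
qed

lemma finite_add_pairs [simp]:
  "finite {(s, t). fst s + fst t = (i::nat) \<and> snd s + snd t = (j::nat)}"
proof (rule finite_subset)
  show "{(s, t). fst s + fst t = i \<and> snd s + snd t = j} \<subseteq>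
      ({0..i} \<times> {0..j}) \<times> ({0..i} \<times> {0..j})"
    by auto
qed auto

lemma mem_supp [simp]: "(i, j) \<in> supp f \<longleftrightarrow> coeff2 f i j \<noteq> 0"
  by (simp add: supp_def)

lemma supp_eq_empty_iff: "supp f = {} \<longleftrightarrow> f = 0"
  by (auto simp: supp_def intro!: series2_eqI)

lemma coeff2_mult_nonzeroD:
  fixes f g :: "'a::comm_ring_1 series2"
  assumes "coeff2 (f * g) i j \<noteq> 0"
  obtains k l k' l' where "coeff2 f k l \<noteq> 0" "coeff2 g k' l' \<noteq> 0" "k + k' = i" "l + l' = j"
proof -
  have "\<exists>x\<in>{(s, t). fst s + fst t = i \<and> snd s + snd t = j}.
      (\<lambda>(s, t). coeff2 f (fst s) (snd s) * coeff2 g (fst t) (snd t)) x \<noteq> 0"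
    using assms unfolding coeff2_mult by (meson sum.not_neutral_contains_not_neutral)
  then obtain s t where st: "fst s + fst t = i" "snd s + snd t = j"
    "coeff2 f (fst s) (snd s) * coeff2 g (fst t) (snd t) \<noteq> 0"
    by auto
  from st(3) have "coeff2 f (fst s) (snd s) \<noteq> 0" "coeff2 g (fst t) (snd t) \<noteq> 0"
    by auto
  with st(1,2) show thesis by (intro that)
qed

lemma coeff2_mult_00:
  fixes f g :: "'a::comm_ring_1 series2"
  shows "coeff2 (f * g) 0 0 = coeff2 f 0 0 * coeff2 g 0 0"
  by (simp add: coeff2_def)

text \<open>The constant term in y has to be a unit of K[[x]], hence itself has a non-zero constant
  term; \<open>inverse\<close> handles the inner series and \<open>fps_right_inverse\<close> the
  outer one.\<close>

lemma unit_series2_iff: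
  fixes f :: "'a::field series2"
  shows "f dvd 1 \<longleftrightarrow> coeff2 f 0 0 \<noteq> 0"
proof
  assume "f dvd 1"
  then obtain g where "1 = f * g" by (elim dvdE)
  then have "coeff2 f 0 0 * coeff2 g 0 0 = 1"
    by (metis coeff2_1 coeff2_mult_00)
  then show "coeff2 f 0 0 \<noteq> 0" by auto
next
  assume "coeff2 f 0 0 \<noteq> 0"
  then have "fps_nth (fps_nth f 0) 0 \<noteq> 0" by (simp add: coeff2_def)
  then have "fps_nth f 0 * inverse (fps_nth f 0) = 1"
    by (rule inverse_mult_eq_1')
  then have "f * fps_right_inverse f (inverse (fps_nth f 0)) = 1"
    by (rule fps_right_inverse)
  then show "f dvd 1" by (metis dvdI)
qed


section \<open>Weighted orders\<close>

text \<open>Order at least n for the weights p and q, either of which may be 0: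
  \<open>fil 1 1 n\<close> is the n-th power of the maximal ideal, and \<open>fil 1 0 n\<close>
  consists of the multiples of x^n.\<close>

definition fil :: "nat \<Rightarrow> nat \<Rightarrow> nat \<Rightarrow> 'a::zero series2 set" where
  "fil p q n = {f. \<forall>i j. coeff2 f i j \<noteq> 0 \<longrightarrow> n \<le> p * i + q * j}"

lemma filD: "f \<in> fil p q n \<Longrightarrow> p * i + q * j < n \<Longrightarrow> coeff2 f i j = 0"
  unfolding fil_def by force

lemma fil_add:
  fixes f :: "'a::comm_ring_1 series2"
  shows "f \<in> fil p q n \<Longrightarrow> g \<in> fil p q n \<Longrightarrow> f + g \<in> fil p q n"
  unfolding fil_def by force

lemma fil_diff:
  fixes f :: "'a::comm_ring_1 series2"
  shows "f \<in> fil p q n \<Longrightarrow> g \<in> fil p q n \<Longrightarrow> f - g \<in> fil p q n"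
  unfolding fil_def by force

lemma fil_mono: "f \<in> fil p q n \<Longrightarrow> k \<le> n \<Longrightarrow> f \<in> fil p q k"
  unfolding fil_def by force

lemma fil_0 [simp]: "0 \<in> fil p q n"
  by (simp add: fil_def)

lemma fil_sum:
  fixes f :: "'b \<Rightarrow> 'a::comm_ring_1 series2"
  assumes "\<And>x. x \<in> A \<Longrightarrow> f x \<in> fil p q n"
  shows "sum f A \<in> fil p q n"
  using assms by (induction A rule: infinite_finite_induct) (auto intro: fil_add)

lemma fil_mult:
  fixes f g :: "'a::comm_ring_1 series2"
  assumes "f \<in> fil p q n" "g \<in> fil p q k"
  shows "f * g \<in> fil p q (n + k)"
proof -
  have "n + k \<le> p * i + q * j" if "coeff2 (f * g) i j \<noteq> 0" for i j
  proof -
    from that obtain a b a' b' where *: "coeff2 f a b \<noteq> 0" "coeff2 g a' b' \<noteq> 0"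
      "a + a' = i" "b + b' = j" by (rule coeff2_mult_nonzeroD)
    then have "n \<le> p * a + q * b" "k \<le> p * a' + q * b'"
      using assms by (auto simp: fil_def)
    then show ?thesis using * by (auto simp: algebra_simps)
  qed
  then show ?thesis by (simp add: fil_def)
qed

section \<open>Monomials\<close>

definition mono2 :: "'a::zero \<Rightarrow> nat \<Rightarrow> nat \<Rightarrow> 'a series2" where
  "mono2 c i j = series2 (\<lambda>k l. if k = i \<and> l = j then c else 0)"

lemma coeff2_mono2 [simp]: "coeff2 (mono2 c i j) k l = (if k = i \<and> l = j then c else 0)"
  by (simp add: mono2_def)

lemma fil_mono2: "n \<le> p * i + q * j \<Longrightarrow> mono2 c i j \<in> fil p q n"
  by (auto simp: fil_def)

lemma mono2_mult:
  "mono2 (c::'a::comm_ring_1) i j * mono2 d k l = mono2 (c * d) (i + k) (j + l)"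
proof (rule series2_eqI)
  fix a b
  have "coeff2 (mono2 c i j * mono2 d k l) a b =
    (\<Sum>x\<in>{(s, t). fst s + fst t = a \<and> snd s + snd t = b}.
       if x = ((i, j), (k, l)) then c * d else 0)"
    unfolding coeff2_mult by (rule sum.cong) (auto split: if_splits)
  also have "\<dots> = coeff2 (mono2 (c * d) (i + k) (j + l)) a b"
    by (subst sum.delta) auto
  finally show "coeff2 (mono2 c i j * mono2 d k l) a b = coeff2 (mono2 (c * d) (i + k) (j + l)) a b" .
qed

section \<open>Exponents of one weight and quasi-homogeneous parts\<close>

definition line :: "nat \<Rightarrow> nat \<Rightarrow> nat \<Rightarrow> (nat \<times> nat) set" where
  "line p q n = {(i, j). p * i + q * j = n}"

text \<open>The quasi-homogeneous part of weight n, evaluated at (a, b). On series of order n this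
  is the value of the initial form, so products of initial forms become products of scalars.\<close>

definition part_val :: "nat \<Rightarrow> nat \<Rightarrow> nat \<Rightarrow> 'a::comm_ring_1 \<Rightarrow> 'a \<Rightarrow> 'a series2 \<Rightarrow> 'a" where
  "part_val p q n a b f = (\<Sum>(i, j)\<in>line p q n. coeff2 f i j * a ^ i * b ^ j)"

lemma finite_line [simp]: "p > 0 \<Longrightarrow> q > 0 \<Longrightarrow> finite (line p q n)"
proof (rule finite_subset)
  assume "p > 0" "q > 0"
  have "i \<le> n" "j \<le> n" if "p * i + q * j = n" for i j
  proof -
    have "i \<le> p * i" "j \<le> q * j" using \<open>p > 0\<close> \<open>q > 0\<close> by auto
    with that show "i \<le> n" "j \<le> n" by linarith+
  qed
  then show "line p q n \<subseteq> {..n} \<times> {..n}" by (auto simp: line_def)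
qed auto

lemma part_val_add: "part_val p q n a b (f + g) = part_val p q n a b f + part_val p q n a b g"
  by (simp add: part_val_def sum.distrib[symmetric] case_prod_unfold algebra_simps)

lemma part_val_diff: "part_val p q n a b (f - g) = part_val p q n a b f - part_val p q n a b g"
  by (simp add: part_val_def sum_subtractf[symmetric] case_prod_unfold algebra_simps)

lemma part_val_mono2:
  assumes "p > 0" "q > 0" "(i, j) \<in> line p q n"
  shows "part_val p q n a b (mono2 d i j) = d * a ^ i * b ^ j"
proof -
  have "part_val p q n a b (mono2 d i j) =
      (\<Sum>x\<in>line p q n. if x = (i, j) then d * a ^ i * b ^ j else 0)"
    unfolding part_val_def by (intro sum.cong) (auto split: if_splits)
  then show ?thesis using assms by simp
qed

lemma part_val_fil:
  assumes "f \<in> fil p q n" "k < n"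
  shows "part_val p q k a b f = 0"
  unfolding part_val_def using assms by (intro sum.neutral) (auto simp: line_def dest: filD)

text \<open>Below the minimal weights there is nothing, so weight n + k in the product arises from
  the weights n and k only.\<close>

lemma part_val_mult:
  fixes f g :: "'a::comm_ring_1 series2"
  assumes "p > 0" "q > 0"
  assumes "f \<in> fil p q n" "g \<in> fil p q k"
  shows "part_val p q (n + k) a b (f * g) = part_val p q n a b f * part_val p q k a b g"
proof -
  define F where "F = (\<lambda>(s :: nat \<times> nat, t :: nat \<times> nat).
      coeff2 f (fst s) (snd s) * coeff2 g (fst t) (snd t) * a ^ (fst s + fst t) * b ^ (snd s + snd t))"
  define W where "W s = p * fst s + q * snd s" for s :: "nat \<times> nat"
  define B where "B = (SIGMA x:line p q (n + k).
      {(s, t). fst s + fst t = fst x \<and> snd s + snd t = snd x})"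
  have "part_val p q (n + k) a b (f * g) = (\<Sum>x\<in>line p q (n + k).
      (\<Sum>y\<in>{(s, t). fst s + fst t = fst x \<and> snd s + snd t = snd x}. F y))"
    unfolding part_val_def F_def
    by (rule sum.cong) (auto simp: coeff2_mult sum_distrib_right case_prod_unfold intro!: sum.cong)
  also have "\<dots> = (\<Sum>(x, y)\<in>B. F y)"
    unfolding B_def using assms by (subst sum.Sigma) auto
  also have "\<dots> = (\<Sum>y\<in>line p q n \<times> line p q k. F y)"
  \<comment> \<open>\<open>B\<close> also contains pairs of weights n + d and k - d. Their terms
    vanish, so the bijection is made on non-zero terms.\<close>
  proof (rule sum.reindex_bij_witness_not_neutral
      [where i = "\<lambda>(s, t). ((fst s + fst t, snd s + snd t), (s, t))" and j = snd
        and S' = "{xy \<in> B. F (snd xy) = 0}"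
        and T' = "{y \<in> line p q n \<times> line p q k. F y = 0}"])
    have "finite B"
      unfolding B_def using assms by (intro finite_SigmaI) auto
    then show "finite {xy \<in> B. F (snd xy) = 0}" by auto
    show "finite {y \<in> line p q n \<times> line p q k. F y = 0}" using assms by auto
    fix xy assume xy: "xy \<in> B - {xy \<in> B. F (snd xy) = 0}"
    obtain u s t where ust: "xy = (u, (s, t))" by (metis prod.exhaust)
    have st: "xy = ((fst s + fst t, snd s + snd t), (s, t))" "W s + W t = n + k" "F (s, t) \<noteq> 0"
      using xy by (auto simp: ust B_def line_def W_def algebra_simps)
    have "coeff2 f (fst s) (snd s) \<noteq> 0" "coeff2 g (fst t) (snd t) \<noteq> 0"
      using st(3) by (auto simp: F_def)
    then have "n \<le> W s" "k \<le> W t" using assms(3,4) by (auto simp: fil_def W_def)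
    with st(2) have "W s = n" "W t = k" by auto
    then show "snd xy \<in> line p q n \<times> line p q k - {y \<in> line p q n \<times> line p q k. F y = 0}"
      using st by (auto simp: line_def W_def case_prod_unfold)
    show "(case snd xy of (s, t) \<Rightarrow> ((fst s + fst t, snd s + snd t), (s, t))) = xy"
      using st by simp
  next
    fix y assume "y \<in> line p q n \<times> line p q k - {y \<in> line p q n \<times> line p q k. F y = 0}"
    then obtain s t where y: "y = (s, t)" "W s = n" "W t = k" "F (s, t) \<noteq> 0"
      by (auto simp: line_def W_def)
    then show "(case y of (s, t) \<Rightarrow> ((fst s + fst t, snd s + snd t), (s, t)))
        \<in> B - {xy \<in> B. F (snd xy) = 0}"
      by (auto simp: B_def line_def W_def algebra_simps)
  qed (auto simp: B_def case_prod_unfold)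
  also have "\<dots> = part_val p q n a b f * part_val p q k a b g"
    by (simp add: part_val_def sum_product F_def sum.cartesian_product
        case_prod_unfold power_add algebra_simps)
  finally show ?thesis .
qed


text \<open>The Euler derivation x d/dx. Unlike d/dx it preserves every weight, and at points with a
  \<noteq> 0 both vanish together.\<close>

definition theta_x :: "'a::comm_ring_1 series2 \<Rightarrow> 'a series2" where
  "theta_x f = series2 (\<lambda>i j. of_nat i * coeff2 f i j)"

definition theta_y :: "'a::comm_ring_1 series2 \<Rightarrow> 'a series2" where
  "theta_y f = series2 (\<lambda>i j. of_nat j * coeff2 f i j)"

lemma theta_x_mult: "theta_x (f * g) = theta_x f * g + f * theta_x g"
proof (rule series2_eqI)
  fix i j
  show "coeff2 (theta_x (f * g)) i j = coeff2 (theta_x f * g + f * theta_x g) i j"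
    unfolding coeff2_add coeff2_mult theta_x_def coeff2_series2 sum.distrib[symmetric] sum_distrib_left
    by (rule sum.cong) (auto simp: algebra_simps)
qed

lemma theta_y_mult: "theta_y (f * g) = theta_y f * g + f * theta_y g"
proof (rule series2_eqI)
  fix i j
  show "coeff2 (theta_y (f * g)) i j = coeff2 (theta_y f * g + f * theta_y g) i j"
    unfolding coeff2_add coeff2_mult theta_y_def coeff2_series2 sum.distrib[symmetric] sum_distrib_left
    by (rule sum.cong) (auto simp: algebra_simps)
qed

lemma theta_fil: "f \<in> fil p q n \<Longrightarrow> theta_x f \<in> fil p q n" "f \<in> fil p q n \<Longrightarrow> theta_y f \<in> fil p q n"
  unfolding fil_def theta_x_def theta_y_def mem_Collect_eq coeff2_series2 by (metis mult_zero_right)+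

section \<open>Exact orders and the multiplicity\<close>

definition init_ord :: "nat \<Rightarrow> nat \<Rightarrow> 'a::zero series2 \<Rightarrow> nat \<Rightarrow> bool" where
  "init_ord p q f n \<longleftrightarrow> f \<in> fil p q n \<and> (\<exists>i j. coeff2 f i j \<noteq> 0 \<and> p * i + q * j = n)"

lemma series2_nonzeroE:
  assumes "f \<noteq> 0"
  obtains i j where "coeff2 f i j \<noteq> 0"
  using assms series2_eqI[of f 0] by auto

lemma init_ord_exists:
  assumes "f \<noteq> 0"
  obtains n where "init_ord p q f n"
proof -
  define P where "P n \<longleftrightarrow> (\<exists>i j. coeff2 f i j \<noteq> 0 \<and> p * i + q * j = n)" for n
  obtain i j where "coeff2 f i j \<noteq> 0" using assms by (rule series2_nonzeroE)
  then have "P (p * i + q * j)" unfolding P_def by blast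
  then have "P (LEAST n. P n)" by (rule LeastI)
  moreover have "(LEAST n. P n) \<le> p * i + q * j" if "coeff2 f i j \<noteq> 0" for i j
    by (rule Least_le) (use that in \<open>auto simp: P_def\<close>)
  ultimately have "init_ord p q f (LEAST n. P n)"
    unfolding init_ord_def fil_def P_def by auto
  then show thesis by (rule that)
qed

lemma mult_origin_eqI:
  assumes "init_ord 1 1 f n"
  shows "mult_origin f = n"
  unfolding mult_origin_def
  by (rule Least_equality) (use assms in \<open>auto simp: init_ord_def fil_def\<close>)

lemma init_ord_mult_origin:
  assumes "f \<noteq> 0"
  shows "init_ord 1 1 f (mult_origin f)"
  using assms init_ord_exists mult_origin_eqI by metis

text \<open>
  Minimal weight together with minimal \<open>x\<close>-exponent picks out a monomial of each factor whose
  product cannot cancel.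
\<close>

definition corner :: "nat \<Rightarrow> nat \<Rightarrow> 'a::zero series2 \<Rightarrow> nat \<Rightarrow> nat \<Rightarrow> bool" where
  "corner p q f i j \<longleftrightarrow> coeff2 f i j \<noteq> 0 \<and> f \<in> fil p q (p * i + q * j) \<and>
     (\<forall>k l. coeff2 f k l \<noteq> 0 \<longrightarrow> p * k + q * l = p * i + q * j \<longrightarrow> i \<le> k)"

lemma corner_exists:
  assumes "init_ord p q f n"
  obtains i j where "corner p q f i j" "p * i + q * j = n"
proof -
  define P where "P i \<longleftrightarrow> (\<exists>j. coeff2 f i j \<noteq> 0 \<and> p * i + q * j = n)" for i
  have "\<exists>i. P i" using assms unfolding init_ord_def P_def by auto
  then have "P (LEAST i. P i)" by (rule LeastI_ex)
  then obtain j where j: "coeff2 f (LEAST i. P i) j \<noteq> 0" "p * (LEAST i. P i) + q * j = n"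
    unfolding P_def by auto
  have "(LEAST i. P i) \<le> k" if "coeff2 f k l \<noteq> 0" "p * k + q * l = n" for k l
    by (rule Least_le) (use that in \<open>auto simp: P_def\<close>)
  then have "corner p q f (LEAST i. P i) j"
    using assms j by (auto simp: corner_def init_ord_def)
  then show thesis using j(2) by (rule that)
qed

lemma corner_mult:
  fixes f g :: "'a::idom series2"
  assumes "q > 0" "corner p q f i j" "corner p q g k l"
  shows "corner p q (f * g) (i + k) (j + l)"
proof -
  \<comment> \<open>Each factor has at least its minimal weight, so equality of the total forces
    equality in both; the same then holds for the x-exponents, and q > 0 recovers the y-exponents.
    The third assumption is an inequality because the minimality claim below uses \<open>key\<close>
    again.\<close>
  have key: "a = i \<and> b = j \<and> a' = k \<and> b' = l"
    if "coeff2 f a b \<noteq> 0" "coeff2 g a' b' \<noteq> 0" "a + a' \<le> i + k"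
       "p * (a + a') + q * (b + b') = p * (i + k) + q * (j + l)" for a b a' b'
  proof -
    have "p * i + q * j \<le> p * a + q * b" "p * k + q * l \<le> p * a' + q * b'"
      using that assms by (auto simp: corner_def fil_def)
    with that(4) have eq: "p * a + q * b = p * i + q * j" "p * a' + q * b' = p * k + q * l"
      by (auto simp: algebra_simps)
    then have "i \<le> a" "k \<le> a'" using that assms by (auto simp: corner_def)
    with that(3) have "a = i" "a' = k" by auto
    with eq assms(1) show ?thesis by auto
  qed
  have "coeff2 (f * g) (i + k) (j + l) =
      (\<Sum>x\<in>{(s, t). fst s + fst t = i + k \<and> snd s + snd t = j + l}.
        if x = ((i, j), (k, l)) then coeff2 f i j * coeff2 g k l else 0)"
    unfolding coeff2_mult
  proof (rule sum.cong)
    fix x assume x: "x \<in> {(s, t). fst s + fst t = i + k \<and> snd s + snd t = j + l}"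
    obtain a b a' b' where x_eq: "x = ((a, b), (a', b'))" by (metis prod.exhaust)
    show "(case x of (s, t) \<Rightarrow> coeff2 f (fst s) (snd s) * coeff2 g (fst t) (snd t)) =
        (if x = ((i, j), (k, l)) then coeff2 f i j * coeff2 g k l else 0)"
    proof (cases "coeff2 f a b = 0 \<or> coeff2 g a' b' = 0")
      case True
      then show ?thesis by (auto simp: x_eq)
    next
      case False
      have "a + a' = i + k" "b + b' = j + l" using x x_eq by auto
      with False have "a = i \<and> b = j \<and> a' = k \<and> b' = l" by (intro key) auto
      then show ?thesis by (simp add: x_eq)
    qed
  qed auto
  also have "\<dots> = coeff2 f i j * coeff2 g k l"
    by (subst sum.delta) auto
  finally have "coeff2 (f * g) (i + k) (j + l) \<noteq> 0"
    using assms by (auto simp: corner_def)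
  moreover have "f * g \<in> fil p q (p * (i + k) + q * (j + l))"
    using fil_mult[of f p q "p * i + q * j" g "p * k + q * l"] assms
    by (auto simp: corner_def algebra_simps)
  moreover have "i + k \<le> a" if "coeff2 (f * g) a b \<noteq> 0"
    "p * a + q * b = p * (i + k) + q * (j + l)" for a b
    using that(1)
  proof (rule coeff2_mult_nonzeroD)
    fix a1 b1 a2 b2
    assume "coeff2 f a1 b1 \<noteq> 0" "coeff2 g a2 b2 \<noteq> 0" "a1 + a2 = a" "b1 + b2 = b"
    with key[of a1 b1 a2 b2] that(2) show ?thesis by (cases "a \<le> i + k") auto
  qed
  ultimately show ?thesis by (auto simp: corner_def)
qed

text \<open>Orders add because corners do: their coefficients have a non-zero product in a
  domain.\<close>

lemma init_ord_mult:
  fixes f g :: "'a::idom series2"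
  assumes "q > 0" "init_ord p q f n" "init_ord p q g k"
  shows "init_ord p q (f * g) (n + k)"
proof -
  obtain i j where ij: "corner p q f i j" "p * i + q * j = n"
    using assms(2) by (rule corner_exists)
  obtain i' j' where ij': "corner p q g i' j'" "p * i' + q * j' = k"
    using assms(3) by (rule corner_exists)
  have "coeff2 (f * g) (i + i') (j + j') \<noteq> 0" "p * (i + i') + q * (j + j') = n + k"
    using corner_mult[OF assms(1) ij(1) ij'(1)] ij ij' by (auto simp: corner_def algebra_simps)
  moreover have "f * g \<in> fil p q (n + k)"
    using assms by (auto simp: init_ord_def intro: fil_mult)
  ultimately show ?thesis unfolding init_ord_def by blast
qed

lemma mult_origin_mult:
  fixes f g :: "'a::idom series2"
  assumes "f \<noteq> 0" "g \<noteq> 0"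
  shows "mult_origin (f * g) = mult_origin f + mult_origin g"
  using assms by (intro mult_origin_eqI init_ord_mult init_ord_mult_origin) auto

lemma mult_origin_eq_0_iff:
  assumes "f \<noteq> 0"
  shows "mult_origin f = 0 \<longleftrightarrow> coeff2 f 0 0 \<noteq> 0"
  using init_ord_mult_origin[OF assms] mult_origin_eqI[of f 0]
  by (auto simp: init_ord_def fil_def)


section \<open>Weak non-degeneracy for all weights\<close>

text \<open>Quantifying over all positive weights gives a condition that survives passing to a
  factor and blowing up. A monomial initial form satisfies it automatically.\<close>

definition WND :: "'a::idom series2 \<Rightarrow> bool" where
  "WND f \<longleftrightarrow> (\<forall>p q n a b. p > 0 \<longrightarrow> q > 0 \<longrightarrow> init_ord p q f n \<longrightarrow> a \<noteq> 0 \<longrightarrow> b \<noteq> 0 \<longrightarrow>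
     part_val p q n a b f \<noteq> 0 \<or> part_val p q n a b (theta_x f) \<noteq> 0 \<or>
     part_val p q n a b (theta_y f) \<noteq> 0)"

text \<open>By the Leibniz rule a common torus zero of the initial form of f and its Euler
  derivatives is also one for f g.\<close>

lemma WND_factor:
  fixes f g :: "'a::idom series2"
  assumes "WND (f * g)" "f \<noteq> 0" "g \<noteq> 0"
  shows "WND f"
  unfolding WND_def
proof (intro allI impI)
  fix p q n and a b :: 'a
  assume *: "0 < p" "0 < q" "init_ord p q f n" "a \<noteq> 0" "b \<noteq> 0"
  obtain k where k: "init_ord p q g k" using \<open>g \<noteq> 0\<close> by (rule init_ord_exists)
  have fil: "f \<in> fil p q n" "g \<in> fil p q k" using * k by (auto simp: init_ord_def)
  have "init_ord p q (f * g) (n + k)" using * k by (intro init_ord_mult) auto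
  with * assms(1) have "part_val p q (n + k) a b (f * g) \<noteq> 0 \<or>
      part_val p q (n + k) a b (theta_x (f * g)) \<noteq> 0 \<or>
      part_val p q (n + k) a b (theta_y (f * g)) \<noteq> 0" unfolding WND_def by blast
  then show "part_val p q n a b f \<noteq> 0 \<or> part_val p q n a b (theta_x f) \<noteq> 0 \<or>
      part_val p q n a b (theta_y f) \<noteq> 0"
    using *(1,2) fil by (auto simp: theta_x_mult theta_y_mult part_val_add part_val_mult theta_fil)
qed


section \<open>Blowing up\<close>

definition swap2 :: "'a::zero series2 \<Rightarrow> 'a series2" where
  "swap2 f = series2 (\<lambda>i j. coeff2 f j i)"

lemma coeff2_swap2 [simp]: "coeff2 (swap2 f) i j = coeff2 f j i"
  by (simp add: swap2_def)

lemma swap2_swap2 [simp]: "swap2 (swap2 f) = f"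
  by (rule series2_eqI) simp

lemma swap2_eq_0_iff [simp]: "swap2 f = 0 \<longleftrightarrow> f = 0"
  by (metis coeff2_0 coeff2_swap2 series2_eqI)

lemma swap2_mult: "swap2 (f * g) = swap2 f * swap2 (g::'a::comm_ring_1 series2)"
proof (rule series2_eqI)
  fix i j
  show "coeff2 (swap2 (f * g)) i j = coeff2 (swap2 f * swap2 g) i j"
    unfolding coeff2_swap2 coeff2_mult
    by (rule sum.reindex_bij_witness[where i = "\<lambda>(s, t). (prod.swap s, prod.swap t)"
          and j = "\<lambda>(s, t). (prod.swap s, prod.swap t)"]) auto
qed

lemma init_ord_swap2 [simp]: "init_ord p q (swap2 f) n \<longleftrightarrow> init_ord q p f n"
  by (auto simp: init_ord_def fil_def add.commute)

lemma mult_origin_swap2 [simp]: "mult_origin (swap2 f) = mult_origin f"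
  unfolding mult_origin_def coeff2_swap2 by (rule arg_cong[where f = Least]) (metis add.commute)

lemma part_val_swap2: "part_val p q n a b (swap2 f) = part_val q p n b a f"
  unfolding part_val_def
  by (rule sum.reindex_bij_witness[where i = prod.swap and j = prod.swap])
     (auto simp: line_def add.commute mult_ac)

lemma theta_swap2: "theta_x (swap2 f) = swap2 (theta_y f)" "theta_y (swap2 f) = swap2 (theta_x f)"
  by (auto intro!: series2_eqI simp: theta_x_def theta_y_def)

lemma WND_swap2: "WND f \<Longrightarrow> WND (swap2 f)"
  unfolding WND_def theta_swap2 part_val_swap2 init_ord_swap2 by blast

text \<open>The substitution x = x' y', y = y' followed by division by y'^m: x^i y^k becomes x'^i
  y'^(i+k-m), whence k = j + m - i. The parameter m is free because \<open>theta_x f\<close> has to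
  be transformed with the m of f although its own multiplicity may be larger.\<close>

definition blowx :: "nat \<Rightarrow> 'a::zero series2 \<Rightarrow> 'a series2" where
  "blowx m f = series2 (\<lambda>i j. if i \<le> j + m then coeff2 f i (j + m - i) else 0)"

lemma coeff2_blowx: "coeff2 (blowx m f) i j = (if i \<le> j + m then coeff2 f i (j + m - i) else 0)"
  by (simp add: blowx_def)

abbreviation chart_x :: "'a::comm_ring_1 series2 \<Rightarrow> 'a series2" where
  "chart_x \<equiv> strict_transform1 None"

abbreviation chart_y :: "'a::comm_ring_1 series2 \<Rightarrow> 'a series2" where
  "chart_y \<equiv> strict_transform1 (Some 0)"

lemma strict_transform_None: "chart_x f = blowx (mult_origin f) f"
  by (rule series2_eqI) (simp add: coeff2_blowx)

lemma strict_transform_Some_0: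
  "chart_y f = swap2 (blowx (mult_origin f) (swap2 f))"
proof (rule series2_eqI)
  fix i j
  \<comment> \<open>The factor \<open>0 ^ (l - j)\<close> removes l > j. For l < j it is
    \<open>0 ^ 0\<close>, and the binomial coefficient vanishes instead.\<close>
  have "coeff2 (chart_y f) i j =
    (\<Sum>l\<le>i + mult_origin f. if l = j then coeff2 f (i + mult_origin f - j) j else 0)"
    unfolding strict_transform1.simps total_transform.simps coeff2_series2
  proof (rule sum.cong)
    fix l
    show "coeff2 f (i + mult_origin f - l) l * of_nat (l choose j) * 0 ^ (l - j) =
        (if l = j then coeff2 f (i + mult_origin f - j) j else 0)"
      by (cases l j rule: linorder_cases) (auto simp: binomial_eq_0 power_0_left)
  qed auto
  then show "coeff2 (chart_y f) i j =
      coeff2 (swap2 (blowx (mult_origin f) (swap2 f))) i j"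
    by (simp add: coeff2_blowx)
qed

lemma coeff2_blowx_eq:
  assumes "m \<le> i + j"
  shows "coeff2 (blowx m f) i (i + j - m) = coeff2 f i j"
  using assms by (simp add: coeff2_blowx)

lemma blowx_eq_0_iff:
  assumes "f \<in> fil 1 1 m"
  shows "blowx m f = 0 \<longleftrightarrow> f = 0"
proof
  assume "blowx m f = 0"
  then have "coeff2 f i j = 0" if "m \<le> i + j" for i j
    using coeff2_blowx_eq[OF that, of f] by simp
  then show "f = 0" using assms by (intro series2_eqI) (force simp: fil_def)
qed (auto intro!: series2_eqI simp: coeff2_blowx)

lemma blowx_mult:
  fixes f g :: "'a::comm_ring_1 series2"
  assumes "f \<in> fil 1 1 m" "g \<in> fil 1 1 n"
  shows "blowx (m + n) (f * g) = blowx m f * blowx n g"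
proof (rule series2_eqI)
  fix i j
  show "coeff2 (blowx (m + n) (f * g)) i j = coeff2 (blowx m f * blowx n g) i j"
  proof (cases "i \<le> j + (m + n)")
    case False
    have "coeff2 (blowx m f * blowx n g) i j = 0"
    proof (rule ccontr)
      assume "coeff2 (blowx m f * blowx n g) i j \<noteq> 0"
      then show False
        by (rule coeff2_mult_nonzeroD) (use False in \<open>auto simp: coeff2_blowx split: if_splits\<close>)
    qed
    then show ?thesis using False by (simp add: coeff2_blowx)
  next
    case True
    define F where "F = (\<lambda>(s, t). coeff2 f (fst s) (snd s) * coeff2 g (fst t) (snd t))"
    define G where "G = (\<lambda>(s, t). coeff2 (blowx m f) (fst s) (snd s) * coeff2 (blowx n g) (fst t) (snd t))"
    define U where "U = (\<lambda>(s, t). ((fst s, snd s + m - fst s), (fst t :: nat, snd t + n - fst t)))"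
    define V where "V = (\<lambda>(s, t). ((fst s, fst s + snd s - m), (fst t, fst t + snd t - n)))"
    define A where "A = {(s, t). fst s + fst t = i \<and> snd s + snd t = j + (m + n) - i}"
    define B where "B = {(s, t). fst s + fst t = i \<and> snd s + snd t = j}"
    have fil: "m \<le> fst s + snd s \<and> n \<le> fst t + snd t" if "F (s, t) \<noteq> 0" for s t
    proof -
      have "coeff2 f (fst s) (snd s) \<noteq> 0" "coeff2 g (fst t) (snd t) \<noteq> 0"
        using that by (auto simp: F_def)
      then show ?thesis using assms by (force simp: fil_def)
    qed
    have fil': "fst s \<le> snd s + m \<and> fst t \<le> snd t + n" if "G (s, t) \<noteq> 0" for s t
      using that by (auto simp: G_def coeff2_blowx split: if_splits)
    have fin: "finite A" "finite B" by (simp_all add: A_def B_def)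
    \<comment> \<open>The subtractions in \<open>U\<close> and \<open>V\<close> may truncate in
      general; on non-zero terms \<open>fil\<close> and \<open>fil'\<close> make them exact and the
      two maps inverse to each other.\<close>
    have "sum F A = sum F (A - {x. F x = 0})"
      using fin by (intro sum.mono_neutral_right) auto
    also have "\<dots> = sum G (B - {x. G x = 0})"
    proof (rule sum.reindex_bij_witness[where i = U and j = V])
      fix x assume x: "x \<in> A - {x. F x = 0}"
      obtain s t where st: "x = (s, t)" by (metis prod.exhaust)
      have f: "m \<le> fst s + snd s" "n \<le> fst t + snd t" using fil[of s t] x st by auto
      show "U (V x) = x"
        using x f by (auto simp: U_def V_def st prod_eq_iff)
      show FG: "G (V x) = F x"
        using x f by (simp add: U_def V_def st F_def G_def coeff2_blowx_eq)
      show "V x \<in> B - {x. G x = 0}"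
        using x f True FG by (simp add: U_def V_def st A_def B_def) linarith
    next
      fix y assume y: "y \<in> B - {x. G x = 0}"
      obtain s t where st: "y = (s, t)" by (metis prod.exhaust)
      have f: "fst s \<le> snd s + m" "fst t \<le> snd t + n" using fil'[of s t] y st by auto
      show "V (U y) = y"
        using y f by (auto simp: U_def V_def st prod_eq_iff)
      have "F (U y) = G y"
        using y f by (simp add: U_def V_def st F_def G_def coeff2_blowx)
      then show "U y \<in> A - {x. F x = 0}"
        using y f True by (simp add: U_def V_def st A_def B_def) linarith
    qed
    also have "\<dots> = sum G B"
      using fin by (intro sum.mono_neutral_left) auto
    finally have "sum F A = sum G B" .
    then show ?thesis using True by (simp add: coeff2_blowx coeff2_mult F_def G_def A_def B_def)
  qed
qed


text \<open>The chart weights (p, q) pull back to (p + q, q); the term q m belongs to the removed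
  power of the exceptional line.\<close>

lemma weight_shear:
  fixes p q :: nat
  assumes "i + j = k + m"
  shows "(p + q) * i + q * j = p * i + q * k + q * m"
proof -
  have "q * (i + j) = q * (k + m)" using assms by simp
  then show ?thesis by (simp add: algebra_simps)
qed

lemma init_ord_blowx:
  assumes "f \<in> fil 1 1 m" "init_ord p q (blowx m f) n"
  shows "init_ord (p + q) q f (n + q * m)"
proof -
  have "n + q * m \<le> (p + q) * i + q * j" if nz: "coeff2 f i j \<noteq> 0" for i j
  proof -
    have "m \<le> i + j" using nz assms(1) by (auto simp: fil_def)
    then obtain k where k: "i + j = m + k" using le_Suc_ex by blast
    have "coeff2 (blowx m f) i k \<noteq> 0" using coeff2_blowx_eq[of m i j f] k nz by simp
    then have "n \<le> p * i + q * k" using assms(2) by (auto simp: init_ord_def fil_def)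
    moreover have "(p + q) * i + q * j = p * i + q * k + q * m"
      using k by (intro weight_shear) simp
    ultimately show ?thesis by simp
  qed
  moreover obtain i j where ij: "coeff2 (blowx m f) i j \<noteq> 0" "p * i + q * j = n"
    using assms(2) by (auto simp: init_ord_def)
  moreover have "coeff2 f i (j + m - i) \<noteq> 0" "i \<le> j + m"
    using ij by (auto simp: coeff2_blowx split: if_splits)
  moreover have "(p + q) * i + q * (j + m - i) = n + q * m"
  proof -
    have "i + (j + m - i) = j + m" using \<open>i \<le> j + m\<close> by simp
    then show ?thesis using ij(2) weight_shear[of i "j + m - i" j m p q] by simp
  qed
  ultimately show ?thesis unfolding init_ord_def fil_def by blast
qed

text \<open>The chart point (a, b) lies over (a b, b), and b^m is the value of the removed power of
  the exceptional line.\<close>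

lemma part_val_blowx:
  assumes "p > 0" "q > 0" "f \<in> fil 1 1 m"
  shows "b ^ m * part_val p q n a b (blowx m f) = part_val (p + q) q (n + q * m) (a * b) b f"
proof -
  define F where "F = (\<lambda>(i, j). b ^ m * (coeff2 (blowx m f) i j * a ^ i * b ^ j))"
  define G where "G = (\<lambda>(i, j). coeff2 f i j * (a * b) ^ i * b ^ j)"
  define A where "A = {(i, j). (i, j) \<in> line p q n \<and> coeff2 (blowx m f) i j \<noteq> 0}"
  define B where "B = {(i, j). (i, j) \<in> line (p + q) q (n + q * m) \<and> coeff2 f i j \<noteq> 0}"
  have "b ^ m * part_val p q n a b (blowx m f) = sum F (line p q n)"
    by (simp add: part_val_def F_def sum_distrib_left case_prod_unfold)
  also have "\<dots> = sum F A"
    using assms by (intro sum.mono_neutral_right) (auto simp: A_def F_def)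
  also have "\<dots> = sum G B"
  proof (rule sum.reindex_bij_witness
      [where i = "\<lambda>(i, j). (i, i + j - m)" and j = "\<lambda>(i, j). (i, j + m - i)"])
    fix x assume "x \<in> A"
    then obtain i j where x: "x = (i, j)" "p * i + q * j = n" "i \<le> j + m"
      "coeff2 f i (j + m - i) \<noteq> 0"
      by (auto simp: A_def line_def coeff2_blowx split: if_splits)
    define k where "k = j + m - i"
    have k: "i + k = j + m" using x k_def by simp
    show "(case case x of (i, j) \<Rightarrow> (i, j + m - i) of (i, j) \<Rightarrow> (i, i + j - m)) = x"
      using x by simp
    have "(p + q) * i + q * k = p * i + q * j + q * m"
      using k by (intro weight_shear) simp
    then show "(case x of (i, j) \<Rightarrow> (i, j + m - i)) \<in> B"
      using x by (simp add: B_def line_def k_def)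
    have "b ^ i * b ^ k = b ^ j * b ^ m" using k by (metis power_add)
    moreover have "coeff2 f i k * (a * b) ^ i * b ^ k = coeff2 f i k * a ^ i * (b ^ i * b ^ k)"
      by (simp add: power_mult_distrib algebra_simps)
    ultimately have "coeff2 f i k * (a * b) ^ i * b ^ k = b ^ m * (coeff2 f i k * a ^ i * b ^ j)"
      by (simp add: algebra_simps)
    then show "G (case x of (i, j) \<Rightarrow> (i, j + m - i)) = F x"
      using x(1,3) by (simp add: G_def F_def coeff2_blowx k_def)
  next
    fix x assume "x \<in> B"
    then obtain i j where x: "x = (i, j)" "(p + q) * i + q * j = n + q * m" "coeff2 f i j \<noteq> 0"
      by (auto simp: B_def line_def)
    then have "m \<le> i + j" using assms(3) by (auto simp: fil_def)
    then obtain k where k: "i + j = m + k" using le_Suc_ex by blast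
    show "(case case x of (i, j) \<Rightarrow> (i, i + j - m) of (i, j) \<Rightarrow> (i, j + m - i)) = x"
      using x k by simp
    have "(p + q) * i + q * j = p * i + q * k + q * m"
      using k by (intro weight_shear) simp
    then have "p * i + q * k = n" using x(2) by simp
    then show "(case x of (i, j) \<Rightarrow> (i, i + j - m)) \<in> A"
      using x k coeff2_blowx_eq[of m i j f] by (simp add: A_def line_def)
  qed
  also have "\<dots> = sum G (line (p + q) q (n + q * m))"
    using assms by (intro sum.mono_neutral_left) (auto simp: B_def G_def)
  finally show ?thesis by (simp add: part_val_def G_def)
qed

text \<open>The new y-exponent is i + j - m, which turns the second Euler derivation of the chart
  into \<open>theta_x\<close> plus \<open>theta_y\<close> minus m.\<close>

lemma theta_blowx:
  assumes "f \<in> fil 1 1 m"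
  shows "theta_x (blowx m f) = blowx m (theta_x f)"
    and "theta_y (blowx m f) = blowx m (theta_x f + theta_y f - of_nat m * f)"
proof -
  show "theta_x (blowx m f) = blowx m (theta_x f)"
    by (rule series2_eqI) (simp add: theta_x_def coeff2_blowx)
  show "theta_y (blowx m f) = blowx m (theta_x f + theta_y f - of_nat m * f)"
  proof (rule series2_eqI)
    fix i j
    have "of_nat j + of_nat m = of_nat i + (of_nat (j + m - i) :: 'a)" if "i \<le> j + m"
      using that by (metis of_nat_add add_diff_inverse_nat not_le)
    then have "of_nat j = of_nat i + of_nat (j + m - i) - (of_nat m :: 'a)" if "i \<le> j + m"
      using that by (simp add: eq_diff_eq)
    then show "coeff2 (theta_y (blowx m f)) i j =
        coeff2 (blowx m (theta_x f + theta_y f - of_nat m * f)) i j"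
      by (simp add: theta_x_def theta_y_def coeff2_blowx algebra_simps)
  qed
qed

lemma of_nat_fil:
  fixes f :: "'a::comm_ring_1 series2"
  shows "f \<in> fil p q n \<Longrightarrow> of_nat k * f \<in> fil p q n"
  by (induction k) (auto simp: distrib_right intro: fil_add)

lemma part_val_of_nat: "part_val p q n a b (of_nat k * f) = of_nat k * part_val p q n a b f"
  by (simp add: part_val_def sum_distrib_left case_prod_unfold mult.assoc)

text \<open>The substitution maps the torus to itself and pulls positive weights back to positive
  weights. Up to b^m, the three values in the chart are a triangular combination of the three values
  below.\<close>

lemma WND_blowx:
  fixes f :: "'a::idom series2"
  assumes "WND f" "f \<in> fil 1 1 m"
  shows "WND (blowx m f)"
  unfolding WND_def
proof (intro allI impI)
  fix p q n and a b :: 'a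
  assume *: "0 < p" "0 < q" "init_ord p q (blowx m f) n" "a \<noteq> 0" "b \<noteq> 0"
  define E where "E g = part_val (p + q) q (n + q * m) (a * b) b g" for g :: "'a series2"
  note th = theta_fil[OF assms(2)]
  have fil: "theta_x f + theta_y f - of_nat m * f \<in> fil 1 1 m"
    using th assms(2) by (intro fil_add fil_diff of_nat_fil)
  have "E f \<noteq> 0 \<or> E (theta_x f) \<noteq> 0 \<or> E (theta_y f) \<noteq> 0"
    using assms(1) * init_ord_blowx[OF assms(2) *(3)]
    unfolding WND_def E_def by (metis add_gr_0 mult_eq_0_iff)
  moreover have "b ^ m * part_val p q n a b (blowx m f) = E f"
    unfolding E_def using * assms(2) by (intro part_val_blowx)
  moreover have "b ^ m * part_val p q n a b (theta_x (blowx m f)) = E (theta_x f)"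
    unfolding E_def theta_blowx(1)[OF assms(2)] using * th by (intro part_val_blowx)
  moreover have "b ^ m * part_val p q n a b (theta_y (blowx m f)) =
      E (theta_x f) + E (theta_y f) - of_nat m * E f"
    unfolding theta_blowx(2)[OF assms(2)] part_val_blowx[OF *(1,2) fil] E_def
    by (simp add: part_val_add part_val_diff part_val_of_nat)
  ultimately show "part_val p q n a b (blowx m f) \<noteq> 0 \<or>
      part_val p q n a b (theta_x (blowx m f)) \<noteq> 0 \<or> part_val p q n a b (theta_y (blowx m f)) \<noteq> 0"
    by auto
qed

text \<open>At a point with c \<noteq> 0 the constant and the y'-linear coefficient of the strict
  transform are the lowest form at (1, c) and its y-derivative there. Non-degeneracy for the weights
  (1, 1) keeps them from vanishing together.\<close>

lemma mult_strict_transform_other: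
  fixes f :: "'a::idom series2"
  assumes "WND f" "f \<noteq> 0" "c \<noteq> 0"
  shows "mult_origin (strict_transform1 (Some c) f) \<le> 1"
proof -
  define m where "m = mult_origin f"
  have line: "(\<Sum>(i, j)\<in>line 1 1 m. F i j) = (\<Sum>j\<le>m. F (m - j) j)" for F :: "nat \<Rightarrow> nat \<Rightarrow> 'a"
    by (rule sum.reindex_bij_witness[where j = snd and i = "\<lambda>j. (m - j, j)"])
       (auto simp: line_def)
  define S where "S g = (\<Sum>j\<le>m. coeff2 g (m - j) j * c ^ j)" for g
  have S: "part_val 1 1 m 1 c g = S g" for g
    unfolding part_val_def line S_def by simp
  have "S f \<noteq> 0 \<or> S (theta_x f) \<noteq> 0 \<or> S (theta_y f) \<noteq> 0"
    using assms init_ord_mult_origin[OF assms(2)] unfolding WND_def m_def[symmetric] S[symmetric]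
    by (metis zero_less_one zero_neq_one)
  \<comment> \<open>Euler's relation in degree m, used without dividing by m, which may be 0 in
    K.\<close>
  moreover have "S (theta_x f) = of_nat m * S f - S (theta_y f)"
    unfolding S_def sum_distrib_left sum_subtractf[symmetric]
    by (rule sum.cong) (auto simp: theta_x_def theta_y_def of_nat_diff algebra_simps)
  ultimately have *: "S f \<noteq> 0 \<or> S (theta_y f) \<noteq> 0" by auto
  define g where "g = strict_transform1 (Some c) f"
  have g: "coeff2 g i k = (\<Sum>j\<le>i + m. coeff2 f (i + m - j) j * of_nat (j choose k) * c ^ (j - k))" for i k
    by (simp add: g_def m_def)
  have "coeff2 g 0 0 = S f" by (simp add: g S_def)
  moreover have "c * coeff2 g 0 1 = S (theta_y f)"
    unfolding g S_def sum_distrib_left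
  proof (rule sum.cong)
    fix j
    show "c * (coeff2 f (0 + m - j) j * of_nat (j choose 1) * c ^ (j - 1)) =
        coeff2 (theta_y f) (m - j) j * c ^ j"
      by (cases j) (auto simp: theta_y_def algebra_simps)
  qed auto
  ultimately have "\<exists>i j. i + j \<le> 1 \<and> coeff2 g i j \<noteq> 0"
    using * by (metis add.left_neutral le_numeral_extra(3,4) mult_zero_right zero_le_one)
  then obtain i j where ij: "i + j \<le> 1" "coeff2 g i j \<noteq> 0" by auto
  have "mult_origin g \<le> i + j"
    unfolding mult_origin_def by (rule Least_le) (use ij in auto)
  with ij show ?thesis by (simp add: g_def)
qed



section \<open>Hensel's lemma for a quasi-homogeneous binomial factor\<close>

text \<open>The equation y^p = c^p x^q of the curve (t^p, c t^q), which passes through (1,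
  c).\<close>

definition binom2 :: "nat \<Rightarrow> nat \<Rightarrow> 'a::comm_ring_1 \<Rightarrow> 'a series2" where
  "binom2 p q c = mono2 1 0 p - mono2 (c ^ p) q 0"

lemma binom2_fil: "binom2 p q c \<in> fil p q (p * q)"
  unfolding binom2_def by (intro fil_diff fil_mono2) auto

text \<open>A monomial multiple of the binomial trades y^p for c^p x^q; k such trades
  telescope.\<close>

lemma mono2_cong_binom2_aux:
  fixes c d :: "'a::comm_ring_1"
  shows "\<exists>B\<in>fil p q (p * i + q * (j + p * k) - p * q).
    mono2 d i (j + p * k) - mono2 (d * c ^ (p * k)) (i + q * k) j = binom2 p q c * B"
proof (induction k arbitrary: i d)
  case 0
  show ?case by (intro bexI[of _ 0]) (auto intro!: series2_eqI)
next
  case (Suc k)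
  have "p * (i + q) + q * (j + p * k) - p * q = p * i + q * (j + p * Suc k) - p * q"
    by (simp add: algebra_simps)
  with Suc.IH[of "i + q" "d * c ^ p"] obtain B where
    B: "B \<in> fil p q (p * i + q * (j + p * Suc k) - p * q)"
    "mono2 (d * c ^ p) (i + q) (j + p * k) - mono2 (d * c ^ p * c ^ (p * k)) (i + q + q * k) j =
      binom2 p q c * B" by auto
  let ?M = "mono2 d i (j + p * k)"
  have "binom2 p q c * ?M = mono2 d i (j + p * Suc k) - mono2 (d * c ^ p) (i + q) (j + p * k)"
    unfolding binom2_def left_diff_distrib mono2_mult by (simp add: add_ac mult.commute)
  then have "binom2 p q c * (?M + B) =
      mono2 d i (j + p * Suc k) - mono2 (d * c ^ p * c ^ (p * k)) (i + q + q * k) j"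
    by (simp add: distrib_left B(2)[symmetric])
  moreover have "?M \<in> fil p q (p * i + q * (j + p * Suc k) - p * q)"
    by (rule fil_mono2) (simp add: algebra_simps)
  ultimately show ?case using B(1)
    by (intro bexI[of _ "?M + B"] fil_add) (simp_all add: power_add algebra_simps)
qed

text \<open>By coprimality, exponents of equal weight differ by multiples of (q, -p).\<close>

lemma line_step:
  assumes "coprime p q" "p > 0" "(i, j) \<in> line p q n" "(i', j') \<in> line p q n" "j' \<le> j"
  obtains k where "j = j' + p * k" "i' = i + q * k"
proof -
  have eq: "p * i + q * j = p * i' + q * j'" using assms(3,4) by (simp add: line_def)
  obtain d where d: "j = j' + d" using assms(5) le_Suc_ex by blast
  have "p * i + q * d = p * i'" using eq d by (simp add: algebra_simps)
  then have "p dvd q * d" by (metis dvd_add_right_iff dvd_triv_left)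
  then have "p dvd d" using assms(1) coprime_dvd_mult_right_iff by blast
  then obtain k where k: "d = p * k" by (elim dvdE)
  have "p * (i + q * k) = p * i'" using \<open>p * i + q * d = p * i'\<close> k by (simp add: algebra_simps)
  then have "i' = i + q * k" using assms(2) by simp
  then show ?thesis using d k by (intro that[of k]) auto
qed

text \<open>The scalars c^j' and c^j give both monomials the same value at (1, c), in a form
  symmetric in the two exponents.\<close>

lemma mono2_cong_binom2:
  fixes c :: "'a::comm_ring_1"
  assumes "coprime p q" "p > 0" "(i, j) \<in> line p q n" "(i', j') \<in> line p q n"
  shows "\<exists>B\<in>fil p q (n - p * q).
    mono2 (c ^ j') i j - mono2 (c ^ j) i' j' = binom2 p q c * B"
proof -
  have *: "\<exists>B\<in>fil p q (n - p * q). mono2 (c ^ j') i j - mono2 (c ^ j) i' j' = binom2 p q c * B"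
    if ij: "(i, j) \<in> line p q n" "(i', j') \<in> line p q n" "j' \<le> j" for i j i' j'
  proof -
    obtain k where k: "j = j' + p * k" "i' = i + q * k"
      using assms(1,2) ij by (rule line_step)
    have "p * i + q * (j' + p * k) = n" using ij(1) k by (simp add: line_def)
    with mono2_cong_binom2_aux[where i = i and j = j' and k = k and p = p and q = q and d = "c ^ j'" and c = c] show ?thesis
      by (simp add: k power_add)
  qed
  show ?thesis
  proof (cases "j' \<le> j")
    case True
    then show ?thesis using * assms by blast
  next
    case False
    then obtain B where B: "B \<in> fil p q (n - p * q)"
      "mono2 (c ^ j) i' j' - mono2 (c ^ j') i j = binom2 p q c * B"
      using *[of i' j' i j] assms by auto
    have "0 - B \<in> fil p q (n - p * q)" using B(1) by (intro fil_diff) auto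
    moreover have "mono2 (c ^ j') i j - mono2 (c ^ j) i' j' = binom2 p q c * (0 - B)"
      by (simp add: B(2)[symmetric])
    ultimately show ?thesis by blast
  qed
qed

section \<open>Divisibility and lifting, weight by weight\<close>

lemma fil_SucI:
  assumes "f \<in> fil p q n" "\<And>i j. (i, j) \<in> line p q n \<Longrightarrow> coeff2 f i j = 0"
  shows "f \<in> fil p q (Suc n)"
  unfolding fil_def
proof (intro CollectI allI impI)
  fix i j
  assume nz: "coeff2 f i j \<noteq> 0"
  then have "n \<le> p * i + q * j" using assms(1) by (auto simp: fil_def)
  moreover have "n \<noteq> p * i + q * j" using nz assms(2)[of i j] by (auto simp: line_def)
  ultimately show "Suc n \<le> p * i + q * j" by simp
qed

lemma coeff2_const_mult [simp]:
  fixes f :: "'a::comm_ring_1 series2"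
  shows   "coeff2 (fps_const (fps_const c) * f) i j = c * coeff2 f i j"
  by (simp add: coeff2_def)

lemma fil_const_mult:
  fixes f :: "'a::comm_ring_1 series2"
  shows "f \<in> fil p q n \<Longrightarrow> fps_const (fps_const c) * f \<in> fil p q n"
  unfolding fil_def mem_Collect_eq coeff2_const_mult using mult_zero_right by metis

text \<open>Modulo the binomial all monomials of weight n are multiples of the one at (i0, j0). The
  coefficient collected there is, up to a power of c, the value at (1, c) of the weight n part of R,
  hence 0.\<close>

lemma leading_divisible_by_binom2:
  fixes R :: "'a::field series2"
  assumes pq: "coprime p q" "p > 0" "q > 0" and c: "c \<noteq> 0" and n: "p * q \<le> n"
    and R: "R \<in> fil p q n" "part_val p q n 1 c R = 0"
  shows "\<exists>B\<in>fil p q (n - p * q). R - binom2 p q c * B \<in> fil p q (Suc n)"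
proof (cases "line p q n = {}")
  case True
  then show ?thesis using R by (intro bexI[of _ 0] fil_SucI) auto
next
  case False
  then obtain i0 j0 where ij0: "(i0, j0) \<in> line p q n" by auto
  have "\<forall>x\<in>line p q n. \<exists>B. B \<in> fil p q (n - p * q) \<and>
      mono2 (c ^ j0) (fst x) (snd x) - mono2 (c ^ snd x) i0 j0 = binom2 p q c * B"
    using mono2_cong_binom2[OF pq(1,2) _ ij0, of _ _ c] by fastforce
  then obtain B where B: "\<And>x. x \<in> line p q n \<Longrightarrow> B x \<in> fil p q (n - p * q)"
    "\<And>x. x \<in> line p q n \<Longrightarrow>
      mono2 (c ^ j0) (fst x) (snd x) - mono2 (c ^ snd x) i0 j0 = binom2 p q c * B x"
    by metis
  define K where "K x = fps_const (fps_const (coeff2 R (fst x) (snd x) / c ^ j0))" for x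
  define S where "S = (\<Sum>x\<in>line p q n. K x * B x)"
  have S: "S \<in> fil p q (n - p * q)"
    unfolding S_def K_def by (intro fil_sum fil_const_mult B)
  have mult: "binom2 p q c * S =
      (\<Sum>x\<in>line p q n. K x * (mono2 (c ^ j0) (fst x) (snd x) - mono2 (c ^ snd x) i0 j0))"
    unfolding S_def sum_distrib_left by (rule sum.cong) (auto simp: B(2) mult_ac)
  have "coeff2 (binom2 p q c * S) k l = coeff2 R k l" if kl: "(k, l) \<in> line p q n" for k l
  proof -
    let ?r = "\<lambda>x. coeff2 R (fst x) (snd x)"
    have "coeff2 (binom2 p q c * S) k l = (\<Sum>x\<in>line p q n. (if x = (k, l) then ?r x else 0) -
        (if k = i0 \<and> l = j0 then ?r x * c ^ snd x / c ^ j0 else 0))"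
      unfolding mult coeff2_sum K_def coeff2_const_mult coeff2_diff coeff2_mono2 using c
      by (intro sum.cong) (auto simp: algebra_simps)
    also have "\<dots> = coeff2 R k l - (if k = i0 \<and> l = j0 then
        (\<Sum>x\<in>line p q n. ?r x * c ^ snd x) / c ^ j0 else 0)"
      using kl pq by (cases "k = i0 \<and> l = j0") (auto simp: sum_subtractf sum_divide_distrib)
    also have "(\<Sum>x\<in>line p q n. ?r x * c ^ snd x) = part_val p q n 1 c R"
      by (simp add: part_val_def case_prod_unfold)
    finally show ?thesis using R by simp
  qed
  moreover have "R - binom2 p q c * S \<in> fil p q n"
    using fil_mult[OF binom2_fil S, of c] R n by (intro fil_diff) auto
  ultimately have "R - binom2 p q c * S \<in> fil p q (Suc n)" by (intro fil_SucI) auto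
  then show ?thesis using S by blast
qed

text \<open>Coprimality yields a residue j modulo p with q j congruent to n, and q j \<le> p q \<le>
  n leaves room for i. So every weight from p q on carries a correction monomial for the Hensel
  step.\<close>

lemma line_nonempty:
  fixes p q n :: nat
  assumes "coprime p q" "p > 0" "p * q \<le> n"
  obtains i j where "p * i + q * j = n"
proof -
  obtain x where x: "[q * x = Suc 0] (mod p)"
    using assms(1) cong_solve_coprime_nat coprime_commute by blast
  define j where "j = (x * n) mod p"
  have "[q * j = q * (x * n)] (mod p)" unfolding j_def by (intro cong_mult) auto
  also have "q * (x * n) = (q * x) * n" by simp
  also have "[q * x * n = Suc 0 * n] (mod p)" by (intro cong_mult x) auto
  finally have "[n = q * j] (mod p)" by (simp add: cong_sym)
  moreover have "j \<le> p" unfolding j_def using assms(2) by (simp add: less_imp_le)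
  then have "q * j \<le> n" using assms(3) by (metis le_trans mult.commute mult_le_mono2)
  ultimately have "p dvd n - q * j" by (simp add: cong_altdef_nat)
  then obtain i where "n - q * j = p * i" by (elim dvdE)
  then have "p * i + q * j = n" using \<open>q * j \<le> n\<close> by simp
  then show thesis by (rule that)
qed

text \<open>Completeness: the coefficient at (i, j) is stable from index p i + q j on and is read
  off there.\<close>

lemma fil_limit:
  fixes s :: "nat \<Rightarrow> 'a::comm_ring_1 series2"
  assumes "\<And>n. s (Suc n) - s n \<in> fil p q (Suc n + c)"
  obtains l where "\<And>n. l - s n \<in> fil p q (Suc n + c)"
proof -
  have step: "coeff2 (s (Suc n)) i j = coeff2 (s n) i j" if "p * i + q * j < Suc n + c" for n i j
    using filD[OF assms that] by simp
  have eq: "coeff2 (s k) i j = coeff2 (s n) i j" if "n \<le> k" "p * i + q * j < Suc n + c" for n k i j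
    using that(1)
  proof (induction k rule: dec_induct)
    case (step k)
    then show ?case using that \<open>\<And>n i j. p * i + q * j < Suc n + c \<Longrightarrow> _\<close>[of i j k] by simp
  qed simp
  define l where "l = series2 (\<lambda>i j. coeff2 (s (p * i + q * j)) i j)"
  have "coeff2 l i j = coeff2 (s n) i j" if "p * i + q * j < Suc n + c" for n i j
  proof (cases "n \<le> p * i + q * j")
    case True
    then show ?thesis using eq[OF True that] by (simp add: l_def)
  next
    case False
    then show ?thesis using eq[of "p * i + q * j" n i j] by (simp add: l_def)
  qed
  then have "l - s n \<in> fil p q (Suc n + c)" for n
    unfolding fil_def by (auto simp: not_less[symmetric])
  then show thesis by (rule that)
qed

lemma fil_inter_0:
  assumes "\<And>n. f \<in> fil p q n"
  shows "f = 0"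
proof (rule series2_eqI)
  fix i j
  show "coeff2 f i j = coeff2 0 i j"
    using filD[OF assms[of "Suc (p * i + q * j)"], of i j] by simp
qed

text \<open>Coprimality of the two initial forms amounts to H being non-zero at (1, c). Every error
  term can then be written as G B + A H up to higher weight.\<close>

lemma hensel_binom2:
  fixes f H :: "'a::field series2"
  assumes pq: "coprime p q" "p > 0" "q > 0" and c: "c \<noteq> 0"
    and H: "H \<in> fil p q e" "part_val p q e 1 c H \<noteq> 0"
    and f: "f - binom2 p q c * H \<in> fil p q (Suc (p * q + e))"
  obtains g h where "f = g * h" "g - binom2 p q c \<in> fil p q (Suc (p * q))" "h - H \<in> fil p q (Suc e)"
proof -
  let ?G = "binom2 p q c"
  have solve: "\<exists>A B. A \<in> fil p q (p * q + n) \<and> B \<in> fil p q (e + n) \<and>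
      R - ?G * B - A * H \<in> fil p q (Suc (p * q + e + n))"
    if R: "R \<in> fil p q (p * q + e + n)" for R n
  proof -
    obtain i j where ij: "p * i + q * j = p * q + n"
      using pq(1,2) by (rule line_nonempty[of p q "p * q + n"]) auto
    \<comment> \<open>A single monomial for which A H and R agree at (1, c); then R - A H vanishes
      there and its leading part is divisible by G.\<close>
    define A where "A = mono2 (part_val p q (p * q + e + n) 1 c R / (part_val p q e 1 c H * c ^ j)) i j"
    have A: "A \<in> fil p q (p * q + n)" unfolding A_def using ij by (intro fil_mono2) simp
    have "part_val p q (p * q + n) 1 c A = part_val p q (p * q + e + n) 1 c R / part_val p q e 1 c H"
      unfolding A_def using c ij pq by (subst part_val_mono2) (auto simp: line_def)
    then have "part_val p q (p * q + n + e) 1 c (A * H) = part_val p q (p * q + e + n) 1 c R"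
      using H pq A by (subst part_val_mult) auto
    moreover have "p * q + n + e = p * q + e + n" by simp
    ultimately have "part_val p q (p * q + e + n) 1 c (R - A * H) = 0"
      by (simp add: part_val_diff)
    moreover have "R - A * H \<in> fil p q (p * q + e + n)"
      using R fil_mult[OF A H(1)] by (intro fil_diff) (auto simp: add_ac)
    ultimately obtain B where "B \<in> fil p q (p * q + e + n - p * q)"
      "R - A * H - ?G * B \<in> fil p q (Suc (p * q + e + n))"
      using leading_divisible_by_binom2[OF pq c, of "p * q + e + n"] by auto
    then show ?thesis using A by (intro exI[of _ A] exI[of _ B]) (auto simp: algebra_simps)
  qed
  define P where "P n x \<longleftrightarrow> f - fst x * snd x \<in> fil p q (Suc (p * q + e + n)) \<and>
      fst x - ?G \<in> fil p q (Suc (p * q)) \<and> snd x - H \<in> fil p q (Suc e)" for n x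
  define Q where "Q n x y \<longleftrightarrow> fst y - fst x \<in> fil p q (Suc n + p * q) \<and>
      snd y - snd x \<in> fil p q (Suc n + e)" for n and x y :: "'a series2 \<times> 'a series2"
  have "\<exists>s. \<forall>n. P n (s n) \<and> Q n (s n) (s (Suc n))"
  proof (rule dependent_nat_choice)
    show "\<exists>x. P 0 x" using f by (intro exI[of _ "(?G, H)"]) (simp add: P_def)
  next
    fix x n assume P: "P n x"
    obtain g h where x: "x = (g, h)" by (cases x)
    let ?N = "Suc (p * q + e + Suc n)"
    from P have gh: "f - g * h \<in> fil p q (p * q + e + Suc n)"
      "g - ?G \<in> fil p q (Suc (p * q))" "h - H \<in> fil p q (Suc e)"
      by (auto simp: P_def x)
    from solve[OF gh(1)] obtain A B where AB: "A \<in> fil p q (p * q + Suc n)" "B \<in> fil p q (e + Suc n)"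
      "f - g * h - ?G * B - A * H \<in> fil p q ?N" by blast
    \<comment> \<open>Three cross terms remain in the new product. As g - G and h - H start one
      weight above G and H, all three lie beyond the weight just corrected.\<close>
    have X: "(g - ?G) * B \<in> fil p q ?N" using fil_mult[OF gh(2) AB(2)] by (simp add: add_ac)
    have Y: "A * (h - H) \<in> fil p q ?N" using fil_mult[OF AB(1) gh(3)] by (simp add: add_ac)
    have Z: "A * B \<in> fil p q ?N"
      by (rule fil_mono[OF fil_mult[OF AB(1,2)]]) simp
    have "f - g * h - ?G * B - A * H - (g - ?G) * B - A * (h - H) - A * B \<in> fil p q ?N"
      by (rule fil_diff[OF fil_diff[OF fil_diff[OF AB(3) X] Y] Z])
    also have "f - g * h - ?G * B - A * H - (g - ?G) * B - A * (h - H) - A * B =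
        f - (g + A) * (h + B)" by (simp add: algebra_simps)
    finally have 1: "f - (g + A) * (h + B) \<in> fil p q ?N" .
    have "A \<in> fil p q (Suc (p * q))" by (rule fil_mono[OF AB(1)]) simp
    then have 2: "g + A - ?G \<in> fil p q (Suc (p * q))"
      using fil_add[OF gh(2)] by (metis add_diff_eq diff_add_eq)
    have "B \<in> fil p q (Suc e)" by (rule fil_mono[OF AB(2)]) simp
    then have 3: "h + B - H \<in> fil p q (Suc e)"
      using fil_add[OF gh(3)] by (metis add_diff_eq diff_add_eq)
    show "\<exists>y. P (Suc n) y \<and> Q n x y"
      using 1 2 3 AB by (intro exI[of _ "(g + A, h + B)"]) (auto simp: P_def Q_def x add_ac)
  qed
  then obtain s where s: "\<And>n. P n (s n)" "\<And>n. Q n (s n) (s (Suc n))" by blast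
  obtain g where g: "\<And>n. g - fst (s n) \<in> fil p q (Suc n + p * q)"
    by (rule fil_limit[of "\<lambda>n. fst (s n)" p q "p * q"]) (use s(2) in \<open>auto simp: Q_def\<close>)
  obtain h where h: "\<And>n. h - snd (s n) \<in> fil p q (Suc n + e)"
    by (rule fil_limit[of "\<lambda>n. snd (s n)" p q e]) (use s(2) in \<open>auto simp: Q_def\<close>)
  have triv: "u \<in> fil p q 0" for u :: "'a series2" by (simp add: fil_def)
  have "f - g * h \<in> fil p q n" for n
  proof -
    have "f - fst (s n) * snd (s n) \<in> fil p q n"
      by (rule fil_mono[of _ p q "Suc (p * q + e + n)"]) (use s(1) in \<open>auto simp: P_def\<close>)
    moreover have "(g - fst (s n)) * h \<in> fil p q n"
      by (rule fil_mono[OF fil_mult[OF g triv]]) simp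
    moreover have "fst (s n) * (h - snd (s n)) \<in> fil p q n"
      by (rule fil_mono[OF fil_mult[OF triv h]]) simp
    ultimately have "f - fst (s n) * snd (s n) - (g - fst (s n)) * h - fst (s n) * (h - snd (s n))
        \<in> fil p q n" by (metis fil_diff)
    then show ?thesis by (simp add: algebra_simps)
  qed
  then have "f - g * h = 0" by (rule fil_inter_0)
  moreover have "g - ?G \<in> fil p q (Suc (p * q))"
    using fil_add[OF g[of 0], of "fst (s 0) - ?G"] s(1)[of 0] by (simp add: P_def)
  moreover have "h - H \<in> fil p q (Suc e)"
    using fil_add[OF h[of 0], of "snd (s 0) - H"] s(1)[of 0] by (simp add: P_def)
  ultimately show thesis by (intro that) auto
qed


section \<open>Irreducible factors\<close>

lemma theta_add: "theta_x (f + g) = theta_x f + theta_x g" "theta_y (f + g) = theta_y f + theta_y g"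
  by (auto intro!: series2_eqI simp: theta_x_def theta_y_def distrib_left)

lemma line_fst_eq: "(i, j) \<in> line p q n \<Longrightarrow> (i', j) \<in> line p q n \<Longrightarrow> p > 0 \<Longrightarrow> i = i'"
  by (auto simp: line_def)

text \<open>At x = 1 the two exponents give different powers of y. Removing the highest power of y
  dividing the polynomial leaves a non-constant one, whose roots are not 0.\<close>

lemma part_val_root:
  fixes f :: "'a::alg_closed_field series2"
  assumes "p > 0" "q > 0"
    and ij: "(i, j) \<in> line p q n" "coeff2 f i j \<noteq> 0"
    and ij': "(i', j') \<in> line p q n" "coeff2 f i' j' \<noteq> 0" and "j \<noteq> j'"
  obtains c where "c \<noteq> 0" "part_val p q n 1 c f = 0"
proof -
  define P where "P = (\<Sum>(i, j)\<in>line p q n. monom (coeff2 f i j) j)"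
  have coeff: "coeff P l = coeff2 f k l" if "(k, l) \<in> line p q n" for k l
  proof -
    have "coeff P l = (\<Sum>x\<in>line p q n. if x = (k, l) then coeff2 f k l else 0)"
      unfolding P_def coeff_sum
    proof (rule sum.cong)
      fix x assume x: "x \<in> line p q n"
      obtain a b where ab: "x = (a, b)" by (cases x)
      show "coeff (case x of (i, j) \<Rightarrow> monom (coeff2 f i j) j) l = (if x = (k, l) then coeff2 f k l else 0)"
      proof (cases "b = l")
        case True
        then have "a = k" using x that assms(1) ab by (auto intro: line_fst_eq)
        then show ?thesis using True by (simp add: ab)
      qed (simp add: ab)
    qed simp
    then show ?thesis using assms that by simp
  qed
  have nz: "coeff P j \<noteq> 0" "coeff P j' \<noteq> 0" using coeff ij ij' by auto
  then have "P \<noteq> 0" by auto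
  \<comment> \<open>\<open>[:-0, 1:]\<close> is the variable, in the shape produced by the order of
    vanishing at 0.\<close>
  then obtain R where R: "P = [:-0, 1:] ^ order 0 P * R" "\<not> [:-0, 1:] dvd R"
    using order_decomp by blast
  have R0: "poly R 0 \<noteq> 0" using R(2) poly_eq_0_iff_dvd by blast
  have "degree R > 0"
  proof (rule ccontr)
    assume "\<not> degree R > 0"
    then obtain r where "R = [:r:]" by (metis degree_eq_zeroE neq0_conv)
    then have "P = monom r (order 0 P)" using R(1) by (simp add: monom_altdef)
    then have "coeff P j = (if order 0 P = j then r else 0)"
      "coeff P j' = (if order 0 P = j' then r else 0)" by (metis coeff_monom)+
    with nz \<open>j \<noteq> j'\<close> show False by (auto split: if_splits)
  qed
  then obtain c where c: "poly R c = 0" using alg_closed_imp_poly_has_root by blast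
  have "poly P c = 0" by (subst R(1)) (simp add: c)
  moreover have "poly P c = part_val p q n 1 c f"
    by (simp add: P_def part_val_def poly_sum poly_monom case_prod_unfold)
  moreover have "c \<noteq> 0" using c R0 by auto
  ultimately show thesis by (intro that) auto
qed

text \<open>The initial form of f is that of G H with G zero at (1, c). If H vanished there too, the
  Leibniz rule would annihilate both Euler derivatives. Non-degeneracy thus provides the hypothesis
  of Hensel's lemma.\<close>

lemma WND_split_binom2:
  fixes f :: "'a::alg_closed_field series2"
  assumes "WND f" and pq: "coprime p q" "p > 0" "q > 0" and D: "init_ord p q f D"
    and ij: "(i, j) \<in> line p q D" "coeff2 f i j \<noteq> 0"
    and ij': "(i', j') \<in> line p q D" "coeff2 f i' j' \<noteq> 0" and "j' < j"
  obtains g h where "f = g * h" "g \<in> fil p q (p * q)" "h \<in> fil p q (D - p * q)" "p * q \<le> D"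
proof -
  obtain k where k: "j = j' + p * k" "i' = i + q * k"
    using pq(1,2) ij(1) ij'(1) \<open>j' < j\<close> by (metis line_step less_imp_le)
  have "k \<ge> 1" using k \<open>j' < j\<close> by (cases k) auto
  then have "p * q * 1 \<le> p * q * k" by (intro mult_le_mono2)
  also have "\<dots> \<le> D" using ij'(1) k by (simp add: line_def algebra_simps)
  finally have le: "p * q \<le> D" by simp
  obtain c where c: "c \<noteq> 0" "part_val p q D 1 c f = 0"
    using part_val_root[OF pq(2,3) ij ij'] \<open>j' < j\<close> by auto
  define e where "e = D - p * q"
  have De: "D = p * q + e" using le by (simp add: e_def)
  have fD: "f \<in> fil p q D" using D by (simp add: init_ord_def)
  from leading_divisible_by_binom2[OF pq c(1) le fD c(2)] obtain H where
    H: "H \<in> fil p q e" "f - binom2 p q c * H \<in> fil p q (Suc D)"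
    by (auto simp: e_def)
  let ?G = "binom2 p q c"
  have G0: "part_val p q (p * q) 1 c ?G = 0"
    using pq by (simp add: binom2_def part_val_diff part_val_mono2 line_def)
  have "part_val p q e 1 c H \<noteq> 0"
  proof
    assume H0: "part_val p q e 1 c H = 0"
    define r where "r = f - ?G * H"
    have f: "f = ?G * H + r" by (simp add: r_def)
    have r: "r \<in> fil p q (Suc D)" using H(2) by (simp add: r_def)
    have r0: "part_val p q D 1 c (theta_x r) = 0" "part_val p q D 1 c (theta_y r) = 0"
      using part_val_fil[OF theta_fil(1)[OF r]] part_val_fil[OF theta_fil(2)[OF r]] by auto
    note mult = part_val_mult[OF pq(2,3), of _ "p * q" _ e, folded De]
    have "part_val p q D 1 c (theta_x f) = 0" "part_val p q D 1 c (theta_y f) = 0"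
      using r0 unfolding f theta_add theta_x_mult theta_y_mult part_val_add
      by (simp_all add: mult theta_fil binom2_fil H(1) H0 G0)
    with c assms(1) pq D show False unfolding WND_def by (metis zero_neq_one)
  qed
  then obtain g h where gh: "f = g * h" "g - ?G \<in> fil p q (Suc (p * q))" "h - H \<in> fil p q (Suc e)"
    using hensel_binom2[OF pq c(1) H(1)] H(2) unfolding De by blast
  have "g \<in> fil p q (p * q)"
    using fil_add[OF fil_mono[OF gh(2), of "p * q"] binom2_fil[of p q c]] by simp
  moreover have "h \<in> fil p q e"
    using fil_add[OF fil_mono[OF gh(3), of e] H(1)] by simp
  ultimately show thesis using gh(1) le by (intro that) (auto simp: e_def)
qed

text \<open>
  The irreducible non-degenerate series: \<open>x\<close> and \<open>y\<close> up to a unit, and the series whose Newton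
  diagram is one segment from \<open>(q, 0)\<close> to \<open>(0, p)\<close> without inner lattice points.
\<close>

definition toric_branch :: "'a::zero series2 \<Rightarrow> bool" where
  "toric_branch f \<longleftrightarrow> f \<in> fil 1 0 1 \<and> coeff2 f 1 0 \<noteq> 0 \<or> f \<in> fil 0 1 1 \<and> coeff2 f 0 1 \<noteq> 0 \<or>
     (\<exists>p q. p > 0 \<and> q > 0 \<and> coprime p q \<and> f \<in> fil p q (p * q) \<and>
        coeff2 f q 0 \<noteq> 0 \<and> coeff2 f 0 p \<noteq> 0)"

lemma coeff2_var_x_mult:
  fixes f :: "'a::comm_ring_1 series2"
  shows "coeff2 (var_x * f) i j = (if i = 0 then 0 else coeff2 f (i - 1) j)"
  by (simp add: coeff2_def var_x_def)

lemma coeff2_var_y_mult: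
  fixes f :: "'a::comm_ring_1 series2"
  shows "coeff2 (var_y * f) i j = (if j = 0 then 0 else coeff2 f i (j - 1))"
  by (simp add: coeff2_def var_y_def)

text \<open>If neither coordinate divides f, an edge of the Newton diagram starts at (0, Y). Along
  it a factor of weight p q splits off; irreducibility makes the cofactor a unit, which leaves room
  for one primitive segment only.\<close>

lemma irreducible_imp_toric_branch:
  fixes f :: "'a::alg_closed_field series2"
  assumes irr: "irreducible f" and "WND f"
  shows "toric_branch f"
proof -
  have f00: "coeff2 f 0 0 = 0" using irr unit_series2_iff by (auto simp: irreducible_def)
  have unit: "coeff2 h 0 0 \<noteq> 0" if "f = g * h" "coeff2 g 0 0 = 0" for g h
    using irr that unit_series2_iff by (metis irreducibleD)
  consider "f \<in> fil 1 0 1" | "f \<in> fil 0 1 1" | "f \<notin> fil 1 0 1" "f \<notin> fil 0 1 1" by blast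
  then show ?thesis
  proof cases
    case 1
    define h where "h = series2 (\<lambda>i j. coeff2 f (Suc i) j)"
    have "f = var_x * h"
    proof (rule series2_eqI)
      fix i j
      show "coeff2 f i j = coeff2 (var_x * h) i j"
        using filD[OF 1, of i j] by (cases i) (auto simp: coeff2_var_x_mult h_def)
    qed
    moreover have "coeff2 var_x 0 0 = (0::'a)" by (simp add: coeff2_def var_x_def)
    ultimately have "coeff2 h 0 0 \<noteq> 0" by (rule unit)
    then show ?thesis using 1 by (simp add: toric_branch_def h_def)
  next
    case 2
    define h where "h = series2 (\<lambda>i j. coeff2 f i (Suc j))"
    have "f = var_y * h"
    proof (rule series2_eqI)
      fix i j
      show "coeff2 f i j = coeff2 (var_y * h) i j"
        using filD[OF 2, of i j] by (cases j) (auto simp: coeff2_var_y_mult h_def)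
    qed
    moreover have "coeff2 var_y 0 0 = (0::'a)" by (simp add: coeff2_def var_y_def)
    ultimately have "coeff2 h 0 0 \<noteq> 0" by (rule unit)
    then show ?thesis using 2 by (simp add: toric_branch_def h_def)
  next
    case 3
    have "\<exists>j. coeff2 f 0 j \<noteq> 0" using 3(1) by (auto simp: fil_def not_less_eq_eq)
    moreover define Y where "Y = (LEAST j. coeff2 f 0 j \<noteq> 0)"
    ultimately have Y: "coeff2 f 0 Y \<noteq> 0" by (metis (mono_tags) LeastI_ex)
    have Y_le: "Y \<le> j" if "coeff2 f 0 j \<noteq> 0" for j
      unfolding Y_def using that by (rule Least_le)
    have "Y > 0" using Y f00 by (cases Y) auto
    from 3(2) obtain X where X: "coeff2 f X 0 \<noteq> 0" by (auto simp: fil_def not_less_eq_eq)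
    \<comment> \<open>Candidates for a second point of the edge at (0, Y). Exponents beyond X or at
      height at least Y cannot lie below the supporting line, and without them the set is finite;
      \<open>sl\<close> measures the descent from (0, Y).\<close>
    define T where "T = {(i, j). coeff2 f i j \<noteq> 0 \<and> i \<le> X \<and> j < Y}"
    define sl where "sl = (\<lambda>(i, j). (real Y - real j) / real i)"
    have "T \<subseteq> {..X} \<times> {..<Y}" by (auto simp: T_def)
    then have "finite T" by (rule finite_subset) auto
    moreover have XT: "(X, 0) \<in> T" using X \<open>Y > 0\<close> by (auto simp: T_def)
    ultimately have "Max (sl ` T) \<in> sl ` T" by (intro Max_in) auto
    then obtain i0 j0 where ij0: "(i0, j0) \<in> T" "Max (sl ` T) = sl (i0, j0)" by auto
    have max: "sl (i, j) \<le> sl (i0, j0)" if "(i, j) \<in> T" for i j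
      using that \<open>finite T\<close> by (metis Max_ge finite_imageI ij0(2) imageI)
    have pos: "i > 0" if "(i, j) \<in> T" for i j
      using that Y_le[of j] by (cases i) (auto simp: T_def)
    define p0 where "p0 = Y - j0"
    have p0: "p0 > 0" "Y = p0 + j0" and i0: "i0 > 0" using ij0(1) pos by (auto simp: T_def p0_def)
    have T_ge: "i0 * Y \<le> p0 * i + i0 * j" if "(i, j) \<in> T" for i j
    proof -
      have "real i0 * (real Y - real j) \<le> real i * (real Y - real j0)"
        using max[OF that] pos[OF that] i0 by (simp add: sl_def field_simps)
      then have "real (i0 * Y) \<le> real (p0 * i + i0 * j)" by (simp add: p0(2) algebra_simps)
      then show ?thesis by (simp only: of_nat_le_iff)
    qed
    have ge: "i0 * Y \<le> p0 * i + i0 * j" if nz: "coeff2 f i j \<noteq> 0" for i j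
    proof -
      consider "Y \<le> j" | "X < i" | "(i, j) \<in> T" using nz by (force simp: T_def not_le)
      then show ?thesis
      proof cases
        case 1
        then show ?thesis by (simp add: trans_le_add2)
      next
        case 2
        have "i0 * Y \<le> p0 * X" using T_ge[OF XT] by simp
        also have "\<dots> \<le> p0 * i" using 2 by simp
        finally show ?thesis by simp
      qed (rule T_ge)
    qed
    \<comment> \<open>The lattice length of the segment from (0, Y) to (i0, j0). Dividing by it
      gives the coprime weights that Hensel's lemma needs.\<close>
    define d where "d = gcd p0 i0"
    obtain p q where pq: "p0 = p * d" "i0 = q * d" "coprime p q"
      using gcd_coprime_exists[of p0 i0] p0 unfolding d_def by auto
    have pos': "p > 0" "q > 0" "d > 0" using p0 i0 pq by auto
    have ge': "q * Y \<le> p * i + q * j" if "coeff2 f i j \<noteq> 0" for i j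
    proof -
      have "d * (q * Y) \<le> d * (p * i + q * j)" using ge[OF that] by (simp add: pq algebra_simps)
      then show ?thesis using pos' by simp
    qed
    have eq: "p * i0 + q * j0 = q * Y" by (simp add: p0(2) pq algebra_simps)
    have D: "init_ord p q f (q * Y)"
    proof -
      have "coeff2 f 0 Y \<noteq> 0 \<and> p * 0 + q * Y = q * Y" using Y by simp
      then show ?thesis unfolding init_ord_def fil_def using ge' by blast
    qed
    have "coeff2 f i0 j0 \<noteq> 0" "j0 < Y" using ij0 by (auto simp: T_def)
    then obtain g h where gh: "f = g * h" "g \<in> fil p q (p * q)" "h \<in> fil p q (q * Y - p * q)"
      "p * q \<le> q * Y"
      using WND_split_binom2[OF \<open>WND f\<close> pq(3) pos'(1,2) D, of 0 Y i0 j0] Y eq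
      by (auto simp: line_def)
    have "coeff2 g 0 0 = 0" using filD[OF gh(2), of 0 0] pos' by simp
    then have "coeff2 h 0 0 \<noteq> 0" using unit gh(1) by blast
    then have "q * Y - p * q = 0" using filD[OF gh(3), of 0 0] by (metis add_0 gr0I mult_0_right)
    then have "q * Y \<le> p * q" by (simp only: diff_is_0_eq)
    with gh(4) have "q * Y = q * p" by (metis antisym mult.commute)
    then have Yp: "Y = p" using pos' by simp
    \<comment> \<open>Compare Y = p with Y = p d + j0, where d \<ge> 1.\<close>
    have "d = 1" "j0 = 0"
    proof -
      have "p = p * d + j0" using Yp p0(2) pq(1) by simp
      moreover have "p \<le> p * d" using pos' by simp
      ultimately have "j0 = 0" "p * d = p" by linarith+
      then show "d = 1" "j0 = 0" using pos' by auto
    qed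
    then have "coeff2 f q 0 \<noteq> 0" using \<open>coeff2 f i0 j0 \<noteq> 0\<close> pq by simp
    moreover have "f \<in> fil p q (p * q)" using D by (simp add: init_ord_def Yp mult.commute)
    ultimately show ?thesis using Y Yp pos' pq(3) unfolding toric_branch_def by blast
  qed
qed

text \<open>Multiplicity is additive and positive on non-units, so proper factors have smaller
  multiplicity.\<close>

lemma irreducible_factorization_exists:
  fixes f :: "'a::field series2"
  assumes "f \<noteq> 0"
  shows "\<exists>A u. (\<forall>p\<in>#A. irreducible p) \<and> u dvd 1 \<and> f = u * prod_mset A"
  using assms
proof (induction "mult_origin f" arbitrary: f rule: less_induct)
  case less
  show ?case
  proof (cases "f dvd 1")
    case True
    then show ?thesis by (intro exI[of _ "{#}"] exI[of _ f]) simp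
  next
    case False
    show ?thesis
    proof (cases "irreducible f")
      case True
      then show ?thesis by (intro exI[of _ "{#f#}"] exI[of _ 1]) simp
    next
      case nirr: False
      then obtain g h where gh: "f = g * h" "\<not> g dvd 1" "\<not> h dvd 1"
        using False less.prems by (auto simp: irreducible_def)
      then have nz: "g \<noteq> 0" "h \<noteq> 0" using less.prems by auto
      have "mult_origin g > 0" "mult_origin h > 0"
        using gh nz by (auto simp: unit_series2_iff mult_origin_eq_0_iff[symmetric])
      then have "mult_origin g < mult_origin f" "mult_origin h < mult_origin f"
        using mult_origin_mult[OF nz] gh by auto
      from less.hyps[OF this(1) nz(1)] less.hyps[OF this(2) nz(2)] obtain A u B v where
        "\<forall>p\<in>#A. irreducible p" "u dvd 1" "g = u * prod_mset A"
        "\<forall>p\<in>#B. irreducible p" "v dvd 1" "h = v * prod_mset B"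
        by (elim exE conjE)
      then show ?thesis using gh(1)
        by (intro exI[of _ "A + B"] exI[of _ "u * v"]) (auto simp: mult_ac unit_series2_iff coeff2_mult_00)
    qed
  qed
qed


section \<open>Infinitely near singular points\<close>

text \<open>Only these points contribute to delta. The condition on all prefixes permits recursion
  on the first blow-up, whereas \<open>resolution_points\<close> grows at the last one.\<close>

definition singular_points :: "'a::comm_ring_1 series2 \<Rightarrow> 'a option list set" where
  "singular_points f = {Q. \<forall>n\<le>length Q. 2 \<le> mult_origin (strict_transform (take n Q) f)}"

lemma resolution_points_prefix:
  assumes "Q \<in> resolution_points f" "n < length Q"
  shows "2 \<le> mult_origin (strict_transform (take n Q) f)"
  using assms
proof (induction)
  case (blowup Q c)
  then show ?case by (cases "n < length Q") (auto simp: less_Suc_eq)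
qed simp

lemma singular_points_eq:
  "singular_points f = {Q \<in> resolution_points f. 2 \<le> mult_origin (strict_transform Q f)}"
proof (intro equalityI subsetI)
  fix Q assume "Q \<in> singular_points f"
  then show "Q \<in> {Q \<in> resolution_points f. 2 \<le> mult_origin (strict_transform Q f)}"
  proof (induction Q rule: rev_induct)
    case Nil
    then show ?case by (auto simp: singular_points_def intro: resolution_points.origin)
  next
    case (snoc c Q)
    have *: "2 \<le> mult_origin (strict_transform (take n (Q @ [c])) f)" if "n \<le> Suc (length Q)" for n
      using snoc.prems that by (simp add: singular_points_def)
    have "Q \<in> singular_points f"
      unfolding singular_points_def
    proof (intro CollectI allI impI)
      fix n assume "n \<le> length Q"
      then show "2 \<le> mult_origin (strict_transform (take n Q) f)" using *[of n] by simp
    qed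
    with snoc.IH have "Q \<in> resolution_points f" "2 \<le> mult_origin (strict_transform Q f)" by auto
    moreover have "2 \<le> mult_origin (strict_transform (Q @ [c]) f)" using *[of "Suc (length Q)"] by simp
    ultimately show ?case by (auto intro: resolution_points.blowup)
  qed
next
  fix Q assume Q: "Q \<in> {Q \<in> resolution_points f. 2 \<le> mult_origin (strict_transform Q f)}"
  show "Q \<in> singular_points f"
    unfolding singular_points_def
  proof (intro CollectI allI impI)
    fix n assume "n \<le> length Q"
    then show "2 \<le> mult_origin (strict_transform (take n Q) f)"
      using Q resolution_points_prefix[of Q f n] by (cases "n = length Q") auto
  qed
qed

definition delta_at :: "'a::comm_ring_1 series2 \<Rightarrow> 'a option list \<Rightarrow> nat" where
  "delta_at f Q = (let m = mult_origin (strict_transform Q f) in m * (m - 1) div 2)"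

text \<open>Over an infinite set the sum has the default value 0, so this is delta only together
  with finiteness.\<close>

definition finite_delta :: "'a::comm_ring_1 series2 \<Rightarrow> nat" where
  "finite_delta f = (\<Sum>Q\<in>singular_points f. delta_at f Q)"

lemma delta_eq_infsum: "delta f = (\<Sum>\<^sub>\<infinity>Q\<in>singular_points f. enat (delta_at f Q))"
  unfolding delta_def
proof (rule infsum_cong_neutral)
  fix Q assume "Q \<in> resolution_points f - singular_points f"
  then have "mult_origin (strict_transform Q f) \<le> 1" by (auto simp: singular_points_eq)
  then show "(let m = mult_origin (strict_transform Q f) in enat (m * (m - 1) div 2)) = 0"
    by (cases "mult_origin (strict_transform Q f)") (auto simp: zero_enat_def Let_def)
qed (auto simp: singular_points_eq delta_at_def Let_def)

lemma delta_finite: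
  assumes "finite (singular_points f)"
  shows "delta f = enat (finite_delta f)"
proof -
  have "(\<Sum>Q\<in>A. enat (g Q)) = enat (\<Sum>Q\<in>A. g Q)" if "finite A" for A :: "'b set" and g
    using that by (induction A) (auto simp: zero_enat_def)
  then show ?thesis using assms by (simp add: delta_eq_infsum infsum_finite finite_delta_def)
qed

text \<open>Each singular point contributes at least 1, as m (m - 1) / 2 \<ge> 1 for m \<ge>
  2.\<close>

lemma delta_infinite:
  assumes "infinite (singular_points f)"
  shows "delta f = \<infinity>"
  unfolding delta_eq_infsum
proof (rule infsum_superconst_infinite_enat)
  fix Q assume "Q \<in> singular_points f"
  then have "2 \<le> mult_origin (strict_transform Q f)" by (simp add: singular_points_eq)
  then have "2 * 1 \<le> mult_origin (strict_transform Q f) * (mult_origin (strict_transform Q f) - 1)"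
    by (intro mult_le_mono) auto
  then show "1 \<le> enat (delta_at f Q)"
    by (auto simp: delta_at_def Let_def one_enat_def)
qed (use assms in auto)

lemma singular_points_smooth: "mult_origin f < 2 \<Longrightarrow> singular_points f = {}"
  by (force simp: singular_points_def strict_transform_def)

lemma strict_transform_Cons: "strict_transform (c # Q) f = strict_transform Q (strict_transform1 c f)"
  by (simp add: strict_transform_def)

lemma strict_transform_Nil [simp]: "strict_transform [] f = f"
  by (simp add: strict_transform_def)

lemma Cons_singular_points_iff:
  "c # Q \<in> singular_points f \<longleftrightarrow>
    2 \<le> mult_origin f \<and> Q \<in> singular_points (strict_transform1 c f)"
proof
  assume *: "c # Q \<in> singular_points f"
  have "2 \<le> mult_origin (strict_transform (take n (c # Q)) f)" if "n \<le> Suc (length Q)" for n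
    using * that by (simp add: singular_points_def)
  from this[of 0] this[of "Suc _"]
  show "2 \<le> mult_origin f \<and> Q \<in> singular_points (strict_transform1 c f)"
    by (auto simp: singular_points_def strict_transform_Cons)
next
  assume *: "2 \<le> mult_origin f \<and> Q \<in> singular_points (strict_transform1 c f)"
  show "c # Q \<in> singular_points f"
    unfolding singular_points_def
  proof (intro CollectI allI impI)
    fix n assume "n \<le> length (c # Q)"
    then show "2 \<le> mult_origin (strict_transform (take n (c # Q)) f)"
      using * by (cases n) (auto simp: singular_points_def strict_transform_Cons)
  qed
qed

lemma Nil_singular_points_iff: "[] \<in> singular_points f \<longleftrightarrow> 2 \<le> mult_origin f"
  by (simp add: singular_points_def)

text \<open>At a parameter c \<noteq> 0 the strict transform has multiplicity at most 1, so no
  singular point lies there or above.\<close>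

lemma singular_points_blowup:
  fixes f :: "'a::idom series2"
  assumes "WND f" "f \<noteq> 0" "2 \<le> mult_origin f"
  shows "singular_points f = insert [] ((#) None ` singular_points (chart_x f) \<union>
    (#) (Some 0) ` singular_points (chart_y f))"
proof -
  have "singular_points (strict_transform1 (Some c) f) = {}" if "c \<noteq> 0" for c
    using mult_strict_transform_other[OF assms(1,2) that] by (intro singular_points_smooth) simp
  then have "Q \<in> singular_points f \<longleftrightarrow> Q \<in> insert [] ((#) None ` singular_points (chart_x f) \<union>
    (#) (Some 0) ` singular_points (chart_y f))" for Q
  proof (cases Q)
    case Nil
    then show ?thesis using assms by (simp add: Nil_singular_points_iff)
  next
    case (Cons c Q')
    assume *: "\<And>c. c \<noteq> 0 \<Longrightarrow> singular_points (strict_transform1 (Some c) f) = {}"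
    show ?thesis
    proof (cases c)
      case None
      then show ?thesis using assms(3) by (auto simp: Cons Cons_singular_points_iff)
    next
      case (Some d)
      then show ?thesis using assms(3) *[of d] by (cases "d = 0") (auto simp: Cons Cons_singular_points_iff)
    qed
  qed
  then show ?thesis by blast
qed

lemma delta_at_Cons: "delta_at f (c # Q) = delta_at (strict_transform1 c f) Q"
  by (simp add: delta_at_def strict_transform_Cons)

lemma delta_blowup:
  fixes f :: "'a::idom series2"
  assumes "WND f" "f \<noteq> 0" "2 \<le> mult_origin f"
    and "finite (singular_points (chart_x f))"
    and "finite (singular_points (chart_y f))"
  shows "finite (singular_points f)"
    and "finite_delta f = mult_origin f * (mult_origin f - 1) div 2 +
      finite_delta (chart_x f) +
      finite_delta (chart_y f)"
proof -
  let ?A = "(#) None ` singular_points (chart_x f)"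
  let ?B = "(#) (Some 0) ` singular_points (chart_y f)"
  note eq = singular_points_blowup[OF assms(1-3)]
  show "finite (singular_points f)" using assms eq by simp
  have "finite_delta f = delta_at f [] + ((\<Sum>Q\<in>?A. delta_at f Q) + (\<Sum>Q\<in>?B. delta_at f Q))"
    unfolding finite_delta_def eq using assms
    by (subst sum.insert, simp, force, subst sum.union_disjoint) auto
  also have "(\<Sum>Q\<in>?A. delta_at f Q) = finite_delta (chart_x f)"
    unfolding finite_delta_def by (subst sum.reindex) (auto simp: delta_at_Cons)
  also have "(\<Sum>Q\<in>?B. delta_at f Q) = finite_delta (chart_y f)"
    unfolding finite_delta_def by (subst sum.reindex) (auto simp: delta_at_Cons)
  finally show "finite_delta f = mult_origin f * (mult_origin f - 1) div 2 +
      finite_delta (chart_x f) + finite_delta (chart_y f)"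
    by (simp add: delta_at_def Let_def)
qed

section \<open>Double axes and infinite delta\<close>

lemma fil_mult_origin: "f \<in> fil 1 1 (mult_origin f)"
proof (cases "f = 0")
  case False
  then show ?thesis using init_ord_mult_origin by (auto simp: init_ord_def)
qed simp

lemma mult_origin_ge:
  assumes "f \<noteq> 0" "f \<in> fil 1 1 n"
  shows "n \<le> mult_origin f"
  using init_ord_mult_origin[OF assms(1)] assms(2) by (force simp: init_ord_def fil_def)

text \<open>The constant words in c, of every length, are singular points.\<close>

lemma infinite_singular_points:
  fixes f :: "'a::comm_ring_1 series2"
  assumes step: "\<And>f. P f \<Longrightarrow> P (strict_transform1 c f)"
    and mult: "\<And>f. P f \<Longrightarrow> 2 \<le> mult_origin f" and "P f"
  shows "infinite (singular_points f)"
proof -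
  have "replicate n c \<in> singular_points f" for n
    using \<open>P f\<close>
    by (induction n arbitrary: f) (auto simp: Nil_singular_points_iff Cons_singular_points_iff mult step)
  then have "range (\<lambda>n. replicate n c) \<subseteq> singular_points f" by auto
  moreover have "inj (\<lambda>n. replicate n c)" by (rule injI) (metis length_replicate)
  ultimately show ?thesis using infinite_iff_countable_subset by blast
qed

text \<open>The double line x = 0 passes through \<open>None\<close> at every stage, and its
  equation x^2 remains a factor in that chart.\<close>

lemma delta_double_y_axis:
  fixes f :: "'a::comm_ring_1 series2"
  assumes "f \<noteq> 0" "f \<in> fil 1 0 2"
  shows "delta f = \<infinity>"
proof (intro delta_infinite infinite_singular_points[where c = None and P = "\<lambda>f. f \<noteq> 0 \<and> f \<in> fil 1 0 2"])
  fix f :: "'a series2" assume f: "f \<noteq> 0 \<and> f \<in> fil 1 0 2"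
  show "2 \<le> mult_origin f"
    using f by (intro mult_origin_ge) (auto simp: fil_def)
  have "blowx (mult_origin f) f \<in> fil 1 0 2"
    using f by (auto simp: fil_def coeff2_blowx split: if_splits)
  then show "chart_x f \<noteq> 0 \<and> chart_x f \<in> fil 1 0 2"
    using f blowx_eq_0_iff[OF fil_mult_origin[of f]] unfolding strict_transform_None by simp
qed (use assms in auto)

lemma delta_double_x_axis:
  fixes f :: "'a::comm_ring_1 series2"
  assumes "f \<noteq> 0" "f \<in> fil 0 1 2"
  shows "delta f = \<infinity>"
proof (intro delta_infinite infinite_singular_points[where c = "Some 0" and P = "\<lambda>f. f \<noteq> 0 \<and> f \<in> fil 0 1 2"])
  fix f :: "'a series2" assume f: "f \<noteq> 0 \<and> f \<in> fil 0 1 2"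
  show "2 \<le> mult_origin f"
    using f by (intro mult_origin_ge) (auto simp: fil_def intro: trans_le_add2)
  have "swap2 (blowx (mult_origin f) (swap2 f)) \<in> fil 0 1 2"
    using f by (auto simp: fil_def coeff2_blowx split: if_splits)
  moreover have "swap2 f \<in> fil 1 1 (mult_origin f)"
    using fil_mult_origin[of "swap2 f"] by simp
  ultimately show "chart_y f \<noteq> 0 \<and> chart_y f \<in> fil 0 1 2"
    using f blowx_eq_0_iff[of "swap2 f"] unfolding strict_transform_Some_0 by simp
qed (use assms in auto)


section \<open>Newton polyhedra\<close>

text \<open>Dickson's lemma in the plane: an exponent lies above a fixed one or in one of finitely
  many columns and rows, each of which has a lowest entry.\<close>

lemma minimal_exponents:
  fixes S :: "(nat \<times> nat) set"
  obtains M where "finite M" "M \<subseteq> S" "\<And>i j. (i, j) \<in> S \<Longrightarrow> \<exists>(k, l)\<in>M. k \<le> i \<and> l \<le> j"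
proof (cases "S = {}")
  case True
  then show thesis by (intro that[of "{}"]) auto
next
  case False
  then obtain i0 j0 where ij0: "(i0, j0) \<in> S" by auto
  define c where "c i = (i, LEAST j. (i, j) \<in> S)" for i
  define r where "r j = (LEAST i. (i, j) \<in> S, j)" for j
  define M where "M = insert (i0, j0) (S \<inter> (c ` {..i0} \<union> r ` {..j0}))"
  show thesis
  proof (rule that)
    show "finite M" "M \<subseteq> S" using ij0 by (auto simp: M_def)
    fix i j assume ij: "(i, j) \<in> S"
    have "c i \<in> S" "snd (c i) \<le> j"
      unfolding c_def using ij by (auto intro: LeastI Least_le)
    have "r j \<in> S" "fst (r j) \<le> i"
      unfolding r_def using ij by (auto intro: LeastI Least_le)
    consider "i0 \<le> i" "j0 \<le> j" | "i < i0" | "j < j0" by linarith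
    then show "\<exists>(k, l)\<in>M. k \<le> i \<and> l \<le> j"
    proof cases
      case 1
      then show ?thesis by (auto simp: M_def)
    next
      case 2
      have "c i \<in> M" using \<open>c i \<in> S\<close> 2 by (auto simp: M_def)
      then show ?thesis using \<open>snd (c i) \<le> j\<close> by (intro bexI[of _ "c i"]) (auto simp: c_def)
    next
      case 3
      have "r j \<in> M" using \<open>r j \<in> S\<close> 3 by (auto simp: M_def)
      then show ?thesis using \<open>fst (r j) \<le> i\<close> by (intro bexI[of _ "r j"]) (auto simp: r_def)
    qed
  qed
qed

definition upper_set :: "(nat \<times> nat) set \<Rightarrow> (real \<times> real) set" where
  "upper_set S = (\<Union>(i, j)\<in>S. (\<lambda>v. (real i, real j) + v) ` ({0..} \<times> {0..}))"

lemma newton_polyhedron_eq: "newton_polyhedron S = convex hull upper_set S"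
  by (simp add: newton_polyhedron_def upper_set_def)

lemma mem_upper_set: "(x, y) \<in> upper_set S \<longleftrightarrow> (\<exists>(i, j)\<in>S. real i \<le> x \<and> real j \<le> y)"
proof
  assume "(x, y) \<in> upper_set S"
  then obtain i j a b where "(i, j) \<in> S" "0 \<le> a" "0 \<le> b" "(x, y) = (real i, real j) + (a, b)"
    by (auto simp: upper_set_def)
  then show "\<exists>(i, j)\<in>S. real i \<le> x \<and> real j \<le> y"
    by (intro bexI[of _ "(i, j)"]) auto
next
  assume "\<exists>(i, j)\<in>S. real i \<le> x \<and> real j \<le> y"
  then obtain i j where "(i, j) \<in> S" "real i \<le> x" "real j \<le> y" by auto
  then show "(x, y) \<in> upper_set S"
    unfolding upper_set_def
    by (intro UN_I[of "(i, j)"]) (auto intro!: image_eqI[of _ _ "(x - real i, y - real j)"])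
qed

lemma upper_set_subset:
  assumes "\<And>i j. (i, j) \<in> S \<Longrightarrow> \<exists>(k, l)\<in>T. k \<le> i \<and> l \<le> j"
  shows "upper_set S \<subseteq> upper_set T"
proof
  fix v assume "v \<in> upper_set S"
  then obtain x y i j where v: "v = (x, y)" "(i, j) \<in> S" "real i \<le> x" "real j \<le> y"
    by (cases v) (auto simp: mem_upper_set)
  from assms[OF v(2)] obtain k l where "(k, l) \<in> T" "k \<le> i" "l \<le> j" by auto
  with v show "v \<in> upper_set T" by (auto simp: mem_upper_set intro!: bexI[of _ "(k, l)"])
qed

lemma newton_polyhedron_mono:
  assumes "\<And>i j. (i, j) \<in> S \<Longrightarrow> \<exists>(k, l)\<in>T. k \<le> i \<and> l \<le> j"
  shows "newton_polyhedron S \<subseteq> newton_polyhedron T"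
  unfolding newton_polyhedron_eq by (intro hull_mono upper_set_subset assms)

abbreviation \<mu> :: "(nat \<times> nat) set \<Rightarrow> real" where
  "\<mu> \<equiv> newton_number_convenient"

lemma newton_number_cong:
  assumes "newton_polyhedron S = newton_polyhedron T"
  shows "\<mu> S = \<mu> T"
proof -
  have "below_diagram S = below_diagram T"
    using assms by (simp add: below_diagram_def newton_diagram_def)
  then show ?thesis
    by (simp add: newton_number_convenient_def newton_area_def newton_axes_length_def)
qed

lemma convex_newton_polyhedron [simp]: "convex (newton_polyhedron S)"
  by (simp add: newton_polyhedron_def)

text \<open>The support may be infinite, but finitely many exponents generate the same polyhedron, a
  compact convex hull plus the closed quadrant.\<close>

lemma closed_newton_polyhedron [simp]: "closed (newton_polyhedron S)"
proof -
  obtain M where M: "finite M" "M \<subseteq> S" "\<And>i j. (i, j) \<in> S \<Longrightarrow> \<exists>(k, l)\<in>M. k \<le> i \<and> l \<le> j"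
    using minimal_exponents[of S] by metis
  define M' where "M' = (\<lambda>(i, j). (real i, real j)) ` M"
  define Q :: "(real \<times> real) set" where "Q = {0..} \<times> {0..}"
  have "upper_set S = upper_set M"
    using M by (intro equalityI upper_set_subset) auto
  also have "\<dots> = (\<Union>x\<in>M'. \<Union>y\<in>Q. {x + y})"
    by (auto simp: upper_set_def M'_def Q_def)
  also have "\<dots> = M' + Q" by (auto simp: set_plus_def)
  finally have "newton_polyhedron S = convex hull M' + convex hull Q"
    unfolding newton_polyhedron_eq by (simp add: convex_hull_set_plus)
  also have "convex hull Q = Q" unfolding Q_def
    by (intro hull_same convex_Times) auto
  also have "convex hull M' + Q = (\<Union>x\<in>convex hull M'. \<Union>y\<in>Q. {x + y})"
    by (auto simp: set_plus_def)
  also have "closed \<dots>"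
  proof (rule compact_closed_sums)
    show "compact (convex hull M')"
      unfolding M'_def using M by (intro finite_imp_compact_convex_hull) auto
    show "closed Q" unfolding Q_def by (intro closed_Times) auto
  qed
  finally show ?thesis .
qed

lemma upper_set_subset_polyhedron: "upper_set S \<subseteq> newton_polyhedron S"
  unfolding newton_polyhedron_eq by (rule hull_subset)

text \<open>Dual description by half planes: a separating normal has non-negative entries because a
  full quadrant is attached to every exponent.\<close>

lemma mem_newton_polyhedron_iff:
  assumes "S \<noteq> {}"
  shows "(x, y) \<in> newton_polyhedron S \<longleftrightarrow>
    (\<forall>p\<ge>0. \<forall>q\<ge>0. \<exists>(i, j)\<in>S. p * real i + q * real j \<le> p * x + q * y)"
proof (intro iffI allI impI)
  fix p q :: real
  assume xy: "(x, y) \<in> newton_polyhedron S" and pq: "0 \<le> p" "0 \<le> q"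
  show "\<exists>(i, j)\<in>S. p * real i + q * real j \<le> p * x + q * y"
  proof (rule ccontr)
    assume "\<not> ?thesis"
    then have gt: "p * x + q * y < p * real i + q * real j" if "(i, j) \<in> S" for i j
      using that by force
    have "upper_set S \<subseteq> {v. (p, q) \<bullet> v > p * x + q * y}"
    proof
      fix v assume "v \<in> upper_set S"
      then obtain a b i j where v: "v = (a, b)" "(i, j) \<in> S" "real i \<le> a" "real j \<le> b"
        by (cases v) (auto simp: mem_upper_set)
      have "p * real i \<le> p * a" "q * real j \<le> q * b"
        using v pq by (auto intro: mult_left_mono)
      with gt[OF v(2)] show "v \<in> {v. (p, q) \<bullet> v > p * x + q * y}" by (simp add: v(1))
    qed
    then have "newton_polyhedron S \<subseteq> {v. (p, q) \<bullet> v > p * x + q * y}"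
      unfolding newton_polyhedron_eq by (rule hull_minimal) (rule convex_halfspace_gt)
    with xy show False by auto
  qed
next
  assume *: "\<forall>p\<ge>0. \<forall>q\<ge>0. \<exists>(i, j)\<in>S. p * real i + q * real j \<le> p * x + q * y"
  show "(x, y) \<in> newton_polyhedron S"
  proof (rule ccontr)
    assume "(x, y) \<notin> newton_polyhedron S"
    then obtain a b where ab: "a \<bullet> (x, y) < b" "\<And>v. v \<in> newton_polyhedron S \<Longrightarrow> b < a \<bullet> v"
      using separating_hyperplane_closed_point[OF convex_newton_polyhedron closed_newton_polyhedron]
      by blast
    obtain p q where a: "a = (p, q)" by (cases a)
    have gt: "b < p * (real i + s) + q * (real j + t)" if "(i, j) \<in> S" "s \<ge> 0" "t \<ge> 0" for i j s t
    proof -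
      have "(real i + s, real j + t) \<in> upper_set S"
        using that by (auto simp: mem_upper_set intro!: bexI[of _ "(i, j)"])
      then show ?thesis using ab(2)[of "(real i + s, real j + t)"] upper_set_subset_polyhedron
        by (auto simp: a)
    qed
    obtain i0 j0 where ij0: "(i0, j0) \<in> S" using assms by auto
    have nonneg: "0 \<le> r" if less: "\<And>s. 0 \<le> s \<Longrightarrow> b < d + r * s" for r d
    proof (rule ccontr)
      assume "\<not> 0 \<le> r"
      then show False using less[of "\<bar>b - d\<bar> / (- r)"] by (simp add: divide_nonneg_neg)
    qed
    have "0 \<le> p"
      using gt[OF ij0, of _ 0] by (intro nonneg[of "p * real i0 + q * real j0"]) (simp add: algebra_simps)
    moreover have "0 \<le> q"
      using gt[OF ij0, of 0] by (intro nonneg[of "p * real i0 + q * real j0"]) (simp add: algebra_simps)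
    ultimately obtain i j where ij: "(i, j) \<in> S" "p * real i + q * real j \<le> p * x + q * y"
      using * by blast
    with gt[OF ij(1), of 0 0] ab(1) show False by (simp add: a)
  qed
qed

lemma newton_polyhedron_weight:
  assumes "S \<noteq> {}" "(x, y) \<in> newton_polyhedron S" "p \<ge> 0" "q \<ge> 0"
    and "\<And>i j. (i, j) \<in> S \<Longrightarrow> c \<le> p * real i + q * real j"
  shows "c \<le> p * x + q * y"
proof -
  obtain i j where "(i, j) \<in> S" "p * real i + q * real j \<le> p * x + q * y"
    using assms(2-4) mem_newton_polyhedron_iff[OF assms(1)] by blast
  then show ?thesis using assms(5)[of i j] by simp
qed

lemma newton_polyhedron_nonneg:
  assumes "(x, y) \<in> newton_polyhedron S"
  shows "0 \<le> x" "0 \<le> y"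
proof -
  have "S \<noteq> {}" using assms by (auto simp: newton_polyhedron_def)
  then show "0 \<le> x" "0 \<le> y"
    using newton_polyhedron_weight[OF _ assms, of 1 0 0] newton_polyhedron_weight[OF _ assms, of 0 1 0]
    by auto
qed

lemma newton_polyhedron_upward:
  assumes "(x, y) \<in> newton_polyhedron S" "x \<le> x'" "y \<le> y'"
  shows "(x', y') \<in> newton_polyhedron S"
proof -
  have S: "S \<noteq> {}" using assms by (auto simp: newton_polyhedron_def)
  show ?thesis
    unfolding mem_newton_polyhedron_iff[OF S]
  proof (intro allI impI)
    fix p q :: real assume pq: "0 \<le> p" "0 \<le> q"
    then obtain i j where "(i, j) \<in> S" "p * real i + q * real j \<le> p * x + q * y"
      using assms(1) mem_newton_polyhedron_iff[OF S] by blast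
    moreover have "p * x + q * y \<le> p * x' + q * y'"
      using pq assms by (intro add_mono mult_left_mono)
    ultimately show "\<exists>(i, j)\<in>S. p * real i + q * real j \<le> p * x' + q * y'" by force
  qed
qed

lemma newton_polyhedron_point: "(i, j) \<in> S \<Longrightarrow> (real i, real j) \<in> newton_polyhedron S"
  by (rule subsetD[OF upper_set_subset_polyhedron]) (auto simp: mem_upper_set)


section \<open>Diagrams meeting both axes\<close>

definition meets_axes :: "(nat \<times> nat) set \<Rightarrow> bool" where
  "meets_axes S \<longleftrightarrow> (\<exists>i. (i, 0) \<in> S) \<and> (\<exists>j. (0, j) \<in> S)"

definition x_intercept :: "(nat \<times> nat) set \<Rightarrow> nat" where
  "x_intercept S = (LEAST i. (i, 0) \<in> S)"

definition y_intercept :: "(nat \<times> nat) set \<Rightarrow> nat" where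
  "y_intercept S = (LEAST j. (0, j) \<in> S)"

lemma meets_axes_nonempty: "meets_axes S \<Longrightarrow> S \<noteq> {}"
  by (auto simp: meets_axes_def)

lemma x_intercept_mem: "meets_axes S \<Longrightarrow> (x_intercept S, 0) \<in> S"
  unfolding meets_axes_def x_intercept_def by (metis LeastI)

lemma y_intercept_mem: "meets_axes S \<Longrightarrow> (0, y_intercept S) \<in> S"
  unfolding meets_axes_def y_intercept_def by (metis LeastI)

lemma x_intercept_le: "(i, 0) \<in> S \<Longrightarrow> x_intercept S \<le> i"
  unfolding x_intercept_def by (rule Least_le)

lemma y_intercept_le: "(0, j) \<in> S \<Longrightarrow> y_intercept S \<le> j"
  unfolding y_intercept_def by (rule Least_le)

lemma x_axis_polyhedron:
  assumes "meets_axes S"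
  shows "(t, 0) \<in> newton_polyhedron S \<longleftrightarrow> real (x_intercept S) \<le> t"
proof
  assume t: "(t, 0) \<in> newton_polyhedron S"
  \<comment> \<open>With second weight equal to the intercept, any exponent off the axis is heavy
    enough.\<close>
  have "real (x_intercept S) \<le> 1 * real i + real (x_intercept S) * real j" if "(i, j) \<in> S" for i j
  proof (cases j)
    case 0
    then show ?thesis using x_intercept_le that by simp
  next
    case (Suc k)
    then show ?thesis by (simp add: algebra_simps)
  qed
  from newton_polyhedron_weight[OF meets_axes_nonempty[OF assms] t _ _ this]
  show "real (x_intercept S) \<le> t" by simp
next
  assume "real (x_intercept S) \<le> t"
  then show "(t, 0) \<in> newton_polyhedron S"
    using newton_polyhedron_point[OF x_intercept_mem[OF assms]] newton_polyhedron_upward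
    by (metis le_numeral_extra(3) of_nat_0)
qed

lemma swap_polyhedron:
  "(x, y) \<in> newton_polyhedron (prod.swap ` S) \<longleftrightarrow> (y, x) \<in> newton_polyhedron S"
proof (cases "S = {}")
  case True
  then show ?thesis by (simp add: newton_polyhedron_def)
next
  case False
  have "(\<exists>(i, j)\<in>prod.swap ` S. p * real i + q * real j \<le> p * x + q * y) \<longleftrightarrow>
      (\<exists>(i, j)\<in>S. q * real i + p * real j \<le> q * y + p * x)" for p q
    by (force simp: add.commute)
  then show ?thesis
    using False by (subst (1 2) mem_newton_polyhedron_iff) auto
qed

lemma mem_swap_image [simp]: "(i, j) \<in> prod.swap ` S \<longleftrightarrow> (j, i) \<in> S"
  by (metis image_iff swap_simp swap_swap)

lemma meets_axes_swap [simp]: "meets_axes (prod.swap ` S) \<longleftrightarrow> meets_axes S"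
  by (auto simp: meets_axes_def)

lemma intercept_swap [simp]:
  "x_intercept (prod.swap ` S) = y_intercept S" "y_intercept (prod.swap ` S) = x_intercept S"
  by (simp_all add: x_intercept_def y_intercept_def)

lemma y_axis_polyhedron:
  assumes "meets_axes S"
  shows "(0, t) \<in> newton_polyhedron S \<longleftrightarrow> real (y_intercept S) \<le> t"
  using x_axis_polyhedron[of "prod.swap ` S" t] assms by (simp add: swap_polyhedron)

text \<open>Strict positivity of both weights bounds the face, by c / p and c / q.\<close>

lemma supporting_line_face:
  assumes "S \<noteq> {}" "p > 0" "q > 0" "\<And>i j. (i, j) \<in> S \<Longrightarrow> c \<le> p * real i + q * real j"
  shows "(newton_polyhedron S \<inter> {v. (p, q) \<bullet> v = c}) face_of newton_polyhedron S"
    and "compact (newton_polyhedron S \<inter> {v. (p, q) \<bullet> v = c})"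
proof -
  let ?F = "newton_polyhedron S \<inter> {v. (p, q) \<bullet> v = c}"
  show "?F face_of newton_polyhedron S"
  proof (rule face_of_Int_supporting_hyperplane_ge)
    fix v assume "v \<in> newton_polyhedron S"
    then show "(p, q) \<bullet> v \<ge> c"
      using newton_polyhedron_weight[OF assms(1) _ _ _ assms(4), of "fst v" "snd v"] assms(2,3)
      by (cases v) auto
  qed simp
  have "?F \<subseteq> {0..c / p} \<times> {0..c / q}"
  proof
    fix v assume "v \<in> ?F"
    then obtain x y where v: "v = (x, y)" "(x, y) \<in> newton_polyhedron S" "p * x + q * y = c"
      by (cases v) auto
    note nn = newton_polyhedron_nonneg[OF v(2)]
    have "p * x \<le> c" "q * y \<le> c" using v(3) nn assms by (metis add_increasing add_increasing2 le_less mult_nonneg_nonneg order_refl)+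
    then show "v \<in> {0..c / p} \<times> {0..c / q}"
      using nn assms by (simp add: v(1) field_simps)
  qed
  moreover have "bounded ({0..c / p} \<times> {0..c / q})" by (intro bounded_Times) auto
  ultimately have "bounded ?F" using bounded_subset by blast
  moreover have "closed ?F" by (intro closed_Int closed_newton_polyhedron closed_hyperplane)
  ultimately show "compact ?F" by (simp add: compact_eq_bounded_closed)
qed

lemma newton_diagramI:
  assumes "S \<noteq> {}" "p > 0" "q > 0" "\<And>i j. (i, j) \<in> S \<Longrightarrow> c \<le> p * real i + q * real j"
    and "(x, y) \<in> newton_polyhedron S" "p * x + q * y = c"
  shows "(x, y) \<in> newton_diagram S"
  unfolding newton_diagram_def
  using supporting_line_face[OF assms(1-4)] assms(5,6) by auto

lemma x_intercept_diagram:
  assumes "meets_axes S"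
  shows "(real (x_intercept S), 0) \<in> newton_diagram S"
proof (rule newton_diagramI)
  fix i j assume ij: "(i, j) \<in> S"
  \<comment> \<open>The added 1 keeps the second weight positive even for intercept 0.\<close>
  show "real (x_intercept S) \<le> 1 * real i + (real (x_intercept S) + 1) * real j"
  proof (cases j)
    case 0
    then show ?thesis using x_intercept_le ij by simp
  next
    case (Suc k)
    then show ?thesis by (simp add: algebra_simps)
  qed
qed (use assms meets_axes_nonempty x_axis_polyhedron in auto)

lemma y_intercept_diagram:
  assumes "meets_axes S"
  shows "(0, real (y_intercept S)) \<in> newton_diagram S"
proof (rule newton_diagramI)
  fix i j assume ij: "(i, j) \<in> S"
  show "real (y_intercept S) \<le> (real (y_intercept S) + 1) * real i + 1 * real j"
  proof (cases i)
    case 0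
    then show ?thesis using y_intercept_le ij by simp
  next
    case (Suc k)
    then show ?thesis by (simp add: algebra_simps)
  qed
qed (use assms meets_axes_nonempty y_axis_polyhedron in auto)

lemma newton_diagram_subset: "newton_diagram S \<subseteq> newton_polyhedron S"
  unfolding newton_diagram_def using face_of_imp_subset by blast

text \<open>The weights (0, 1) and (1, 0) show that a point of the polyhedron on an axis forces an
  exponent on that axis.\<close>

lemma convenient_iff:
  assumes "S \<noteq> {}"
  shows "convenient S \<longleftrightarrow> meets_axes S"
proof
  assume "convenient S"
  then obtain s t where "(s, 0) \<in> newton_polyhedron S" "(0, t) \<in> newton_polyhedron S"
    unfolding convenient_def using newton_diagram_subset by blast
  then have "\<exists>(i, j)\<in>S. 0 * real i + 1 * real j \<le> 0 * s + 1 * 0"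
    "\<exists>(i, j)\<in>S. 1 * real i + 0 * real j \<le> 1 * 0 + 0 * t"
    unfolding mem_newton_polyhedron_iff[OF assms] by (meson zero_le_one order_refl)+
  then show "meets_axes S" unfolding meets_axes_def by auto
next
  assume "meets_axes S"
  then show "convenient S"
    unfolding convenient_def using x_intercept_diagram y_intercept_diagram by blast
qed

text \<open>A compact face contains no ray, so it is met by every ray from the origin at its entry point.\<close>

lemma newton_diagram_minimal:
  assumes "p \<in> newton_diagram S" "p \<noteq> 0" "r *\<^sub>R p \<in> newton_polyhedron S" "r < 1"
  shows False
proof -
  obtain F where F: "F face_of newton_polyhedron S" "compact F" "p \<in> F"
    using assms(1) by (auto simp: newton_diagram_def)
  obtain x y where p: "p = (x, y)" by (cases p)
  have pP: "(x, y) \<in> newton_polyhedron S" using F face_of_imp_subset p by blast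
  note nn = newton_polyhedron_nonneg[OF pP]
  obtain B where B: "\<And>v. v \<in> F \<Longrightarrow> norm v \<le> B"
    using F(2) compact_imp_bounded bounded_iff by metis
  have le_B: "real n * norm p \<le> B" if "n \<ge> 2" for n
  proof -
    have "1 * x \<le> real n * x" "1 * y \<le> real n * y"
      using nn that by (intro mult_right_mono; simp)+
    then have nP: "real n *\<^sub>R p \<in> newton_polyhedron S"
      using newton_polyhedron_upward[OF pP, of "real n * x" "real n * y"] by (simp add: p)
    \<comment> \<open>Since \<open>p\<close> lies strictly between its multiples by r and n, the
      face contains the multiple by n, for every n \<ge> 2; such a face is unbounded.\<close>
    have "p \<in> open_segment (r *\<^sub>R p) (real n *\<^sub>R p)"
    proof -
      define u where "u = (1 - r) / (real n - r)"
      have "u * (real n - r) = 1 - r" using that assms(4) by (simp add: u_def)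
      moreover have "(1 - u) * r + u * real n = r + u * (real n - r)" by (simp add: algebra_simps)
      ultimately have u: "(1 - u) * r + u * real n = 1" "0 < u" "u < 1"
        using that assms(4) by (simp_all add: u_def)
      have "p = ((1 - u) * r + u * real n) *\<^sub>R p" using u by simp
      then have "p = (1 - u) *\<^sub>R (r *\<^sub>R p) + u *\<^sub>R (real n *\<^sub>R p)"
        by (simp add: scaleR_left_distrib)
      moreover have "r *\<^sub>R p \<noteq> real n *\<^sub>R p" using assms that by auto
      ultimately show ?thesis using u unfolding in_segment by blast
    qed
    then have "real n *\<^sub>R p \<in> F" using face_ofD[OF F(1)] F(3) assms(3) nP by blast
    then show ?thesis using B by fastforce
  qed
  obtain n where "B < real n * norm p"
    using assms(2) reals_Archimedean3[of "norm p"] by auto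
  moreover have "real (n + 2) * norm p \<le> B" by (rule le_B) simp
  moreover have "real n * norm p \<le> real (n + 2) * norm p" by (intro mult_right_mono) auto
  ultimately show False by linarith
qed

text \<open>An entry point is not relatively interior, so a supporting line passes through it. A
  strictly positive normal gives a compact face; a normal with a zero entry puts the point on a
  coordinate axis, where it is the intercept.\<close>

lemma newton_diagram_entry_point:
  assumes S: "meets_axes S" and w: "w \<in> newton_polyhedron S"
    and min: "\<And>t. 0 \<le> t \<Longrightarrow> t < 1 \<Longrightarrow> t *\<^sub>R w \<notin> newton_polyhedron S"
  shows "w \<in> newton_diagram S"
proof -
  let ?P = "newton_polyhedron S"
  obtain x y where xy: "w = (x, y)" by (cases w)
  note nn = newton_polyhedron_nonneg[OF w[unfolded xy]]
  have "w \<notin> rel_interior ?P"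
  proof
    assume "w \<in> rel_interior ?P"
    \<comment> \<open>From a relatively interior \<open>w\<close> the segment starting at 2 w could
      be prolonged beyond \<open>w\<close>, to a multiple with factor 2 - e < 1.\<close>
    have 2: "2 *\<^sub>R w \<in> ?P"
      using newton_polyhedron_upward[of x y S "2 * x" "2 * y"] w nn by (simp add: xy)
    have "?P \<noteq> {}" using w by auto
    with \<open>w \<in> rel_interior ?P\<close> have "\<forall>x\<in>?P. \<exists>e>1. (1 - e) *\<^sub>R x + e *\<^sub>R w \<in> ?P"
      using convex_rel_interior_iff[of ?P w] by simp
    from bspec[OF this 2] obtain e where e: "e > 1" "(1 - e) *\<^sub>R (2 *\<^sub>R w) + e *\<^sub>R w \<in> ?P"
      by blast
    have "(1 - e) *\<^sub>R (2 *\<^sub>R w) + e *\<^sub>R w = (2 - e) *\<^sub>R w"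
      by (simp add: scaleR_left_distrib[symmetric])
    with e(2) have e2: "(2 - e) *\<^sub>R w \<in> ?P" by simp
    show False
    proof (cases "2 - e \<ge> 0")
      case True
      then show False using min[of "2 - e"] e(1) e2 by simp
    next
      case False
      have "0 \<le> (2 - e) * x" "0 \<le> (2 - e) * y"
        using newton_polyhedron_nonneg[of "(2 - e) * x" "(2 - e) * y" S] e2 by (auto simp: xy)
      then have "x = 0" "y = 0" using False nn by (auto simp: zero_le_mult_iff)
      then show False using min[of 0] w by (simp add: xy)
    qed
  qed
  moreover have "closure ?P = ?P" by (simp add: closure_closed)
  ultimately obtain a where a: "a \<noteq> 0" "\<And>v. v \<in> ?P \<Longrightarrow> a \<bullet> w \<le> a \<bullet> v"
    using supporting_hyperplane_relative_frontier[of ?P w] w convex_newton_polyhedron by metis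
  obtain p q where pq: "a = (p, q)" by (cases a)
  have le: "p * x + q * y \<le> p * u + q * v" if "(u, v) \<in> ?P" for u v
    using a(2)[OF that] by (simp add: pq xy)
  have p: "p \<ge> 0" using le[of "x + 1" y] newton_polyhedron_upward[of x y S "x + 1" y] w
    by (simp add: xy algebra_simps)
  have q: "q \<ge> 0" using le[of x "y + 1"] newton_polyhedron_upward[of x y S x "y + 1"] w
    by (simp add: xy algebra_simps)
  have "p > 0 \<and> q > 0 \<or> p = 0 \<and> q > 0 \<or> p > 0 \<and> q = 0" using a(1) p q by (auto simp: pq zero_prod_def)
  then consider "p > 0" "q > 0" | "p = 0" "q > 0" | "p > 0" "q = 0" by blast
  then show ?thesis
  proof cases
    case 1
    show ?thesis unfolding xy
      using meets_axes_nonempty[OF S] 1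
    proof (rule newton_diagramI)
      show "(x, y) \<in> ?P" using w xy by simp
    qed (auto intro: le newton_polyhedron_point)
  next
    case 2
    let ?X = "real (x_intercept S)"
    have "y = 0" using le[of ?X 0] x_axis_polyhedron[OF S, of ?X] 2 nn by (simp add: mult_le_0_iff)
    then have X: "?X \<le> x" using w x_axis_polyhedron[OF S] xy by simp
    have "x = ?X"
    proof (rule ccontr)
      assume "x \<noteq> ?X"
      then have "(?X / x) *\<^sub>R w = (?X, 0)" "?X / x < 1" "0 \<le> ?X / x"
        using X \<open>y = 0\<close> by (auto simp: xy)
      then show False using min[of "?X / x"] x_axis_polyhedron[OF S, of ?X] by simp
    qed
    then show ?thesis using x_intercept_diagram[OF S] \<open>y = 0\<close> xy by simp
  next
    case 3
    let ?Y = "real (y_intercept S)"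
    have "x = 0" using le[of 0 ?Y] y_axis_polyhedron[OF S, of ?Y] 3 nn by (simp add: mult_le_0_iff)
    then have Y: "?Y \<le> y" using w y_axis_polyhedron[OF S] xy by simp
    have "y = ?Y"
    proof (rule ccontr)
      assume "y \<noteq> ?Y"
      then have "(?Y / y) *\<^sub>R w = (0, ?Y)" "?Y / y < 1" "0 \<le> ?Y / y"
        using Y \<open>x = 0\<close> by (auto simp: xy)
      then show False using min[of "?Y / y"] y_axis_polyhedron[OF S, of ?Y] by simp
    qed
    then show ?thesis using y_intercept_diagram[OF S] \<open>x = 0\<close> xy by simp
  qed
qed

text \<open>Every ray of the quadrant enters the polyhedron at a point of the diagram. The value t =
  1 is left out so that the diagram itself belongs to the region.\<close>

lemma below_diagram_eq:
  assumes S: "meets_axes S" and "(0, 0) \<notin> S"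
  shows "below_diagram S = {v. 0 \<le> fst v \<and> 0 \<le> snd v \<and>
    (\<forall>t. 0 \<le> t \<longrightarrow> t < 1 \<longrightarrow> t *\<^sub>R v \<notin> newton_polyhedron S)}"
proof (intro equalityI subsetI)
  let ?P = "newton_polyhedron S"
  have "x_intercept S \<noteq> 0" using x_intercept_mem[OF S] assms(2) by metis
  then have 0: "0 \<notin> ?P" using x_axis_polyhedron[OF S, of 0] by (simp add: zero_prod_def)
  {
    fix v assume "v \<in> below_diagram S"
    then obtain p where p: "p \<in> newton_diagram S" "v \<in> closed_segment 0 p"
      by (auto simp: below_diagram_def)
    then obtain s where s: "v = s *\<^sub>R p" "0 \<le> s" "s \<le> 1" by (auto simp: in_segment)
    have pP: "p \<in> ?P" using p newton_diagram_subset by blast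
    have nn: "0 \<le> fst p" "0 \<le> snd p" using newton_polyhedron_nonneg[of "fst p" "snd p"] pP by auto
    have "t *\<^sub>R v \<notin> ?P" if "0 \<le> t" "t < 1" for t
    proof
      assume "t *\<^sub>R v \<in> ?P"
      then have "(t * s) *\<^sub>R p \<in> ?P" by (simp add: s)
      moreover have "t * s \<le> t * 1" using s that by (intro mult_left_mono) auto
      then have "t * s < 1" using that by simp
      moreover have "p \<noteq> 0" using pP 0 by auto
      ultimately show False using newton_diagram_minimal[OF p(1)] by blast
    qed
    then show "v \<in> {v. 0 \<le> fst v \<and> 0 \<le> snd v \<and> (\<forall>t. 0 \<le> t \<longrightarrow> t < 1 \<longrightarrow> t *\<^sub>R v \<notin> ?P)}"
      using nn s by auto
  next
    fix v assume "v \<in> {v. 0 \<le> fst v \<and> 0 \<le> snd v \<and> (\<forall>t. 0 \<le> t \<longrightarrow> t < 1 \<longrightarrow> t *\<^sub>R v \<notin> ?P)}"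
    then obtain x y where v: "v = (x, y)" "0 \<le> x" "0 \<le> y"
      "\<And>t. 0 \<le> t \<Longrightarrow> t < 1 \<Longrightarrow> t *\<^sub>R v \<notin> ?P" by (cases v) auto
    show "v \<in> below_diagram S"
    proof (cases "v = 0")
      case True
      then show ?thesis using x_intercept_diagram[OF S] by (auto simp: below_diagram_def)
    next
      case False
      \<comment> \<open>The scalings that reach the polyhedron; their infimum is attained by
        closedness and yields the entry point.\<close>
      define T where "T = {t. 0 \<le> t \<and> t *\<^sub>R v \<in> ?P}"
      have "T \<noteq> {}"
      proof (cases "x > 0")
        case True
        let ?t = "real (x_intercept S) / x"
        have "(?t * x, ?t * y) \<in> ?P"
          using newton_polyhedron_upward[of "real (x_intercept S)" 0 S "?t * x" "?t * y"] True v
            x_axis_polyhedron[OF S, of "real (x_intercept S)"] by simp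
        then show ?thesis using True by (auto simp: T_def v(1) intro!: exI[of _ ?t])
      next
        case x: False
        then have y: "y > 0" using False v by (auto simp: zero_prod_def)
        let ?t = "real (y_intercept S) / y"
        have "(?t * x, ?t * y) \<in> ?P"
          using newton_polyhedron_upward[of 0 "real (y_intercept S)" S "?t * x" "?t * y"] y v
            y_axis_polyhedron[OF S, of "real (y_intercept S)"] by simp
        then show ?thesis using y by (auto simp: T_def v(1) intro!: exI[of _ ?t])
      qed
      moreover have "closed T"
      proof -
        have "closed ((\<lambda>t. t *\<^sub>R v) -` ?P)"
          by (intro closed_vimage closed_newton_polyhedron continuous_intros)
        moreover have "T = {0..} \<inter> (\<lambda>t. t *\<^sub>R v) -` ?P" by (auto simp: T_def)
        ultimately show ?thesis by auto
      qed
      moreover have bdd: "bdd_below T" by (rule bdd_belowI[of _ 0]) (auto simp: T_def)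
      ultimately have inf: "Inf T \<in> T" by (intro closed_contains_Inf)
      define s where "s = Inf T"
      have s: "0 \<le> s" "s *\<^sub>R v \<in> ?P" using inf by (auto simp: T_def s_def)
      have s1: "1 \<le> s" using v(4)[of s] s by force
      have "t *\<^sub>R (s *\<^sub>R v) \<notin> ?P" if "0 \<le> t" "t < 1" for t
      proof
        assume "t *\<^sub>R (s *\<^sub>R v) \<in> ?P"
        then have "t * s \<in> T" using that s by (simp add: T_def)
        then have "s \<le> t * s" unfolding s_def using bdd by (rule cInf_lower)
        then show False using that s1 by simp
      qed
      then have "s *\<^sub>R v \<in> newton_diagram S" using S s(2) by (intro newton_diagram_entry_point)
      moreover have "v \<in> closed_segment 0 (s *\<^sub>R v)"
        unfolding in_segment using s1 by (intro exI[of _ "1 / s"]) auto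
      ultimately show ?thesis by (auto simp: below_diagram_def)
    qed
  }
qed


section \<open>Areas\<close>

text \<open>For supports meeting both axes this is the region below the diagram up to a null set.
  Being defined by non-membership in the polyhedron, it decomposes directly under blowing
  up.\<close>

definition defect :: "(nat \<times> nat) set \<Rightarrow> (real \<times> real) set" where
  "defect S = {v. 0 \<le> fst v \<and> 0 \<le> snd v \<and> v \<notin> newton_polyhedron S}"

lemma borel_quadrant: "{v :: real \<times> real. 0 \<le> fst v \<and> 0 \<le> snd v} \<in> sets borel"
proof -
  have "{v :: real \<times> real. 0 \<le> fst v \<and> 0 \<le> snd v} = {0..} \<times> {0..}" by auto
  also have "closed \<dots>" by (intro closed_Times) auto
  finally show ?thesis by auto
qed

lemma defect_borel [measurable]: "defect S \<in> sets borel"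
proof -
  have "defect S = {v. 0 \<le> fst v \<and> 0 \<le> snd v} - newton_polyhedron S" by (auto simp: defect_def)
  then show ?thesis using borel_quadrant by auto
qed

lemma defect_fmeasurable:
  assumes "meets_axes S"
  shows "defect S \<in> fmeasurable lborel"
proof (rule fmeasurableI)
  have "defect S \<subseteq> cbox (0, 0) (real (x_intercept S), real (y_intercept S))"
  proof
    fix v assume v: "v \<in> defect S"
    obtain x y where xy: "v = (x, y)" by (cases v)
    have "x \<le> real (x_intercept S)"
    proof (rule ccontr)
      assume "\<not> ?thesis"
      then have "(x, y) \<in> newton_polyhedron S"
        using newton_polyhedron_upward[of "real (x_intercept S)" 0 S x y] v
          x_axis_polyhedron[OF assms, of "real (x_intercept S)"]
        by (auto simp: xy defect_def)
      then show False using v by (auto simp: xy defect_def)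
    qed
    moreover have "y \<le> real (y_intercept S)"
    proof (rule ccontr)
      assume "\<not> ?thesis"
      then have "(x, y) \<in> newton_polyhedron S"
        using newton_polyhedron_upward[of 0 "real (y_intercept S)" S x y] v
          y_axis_polyhedron[OF assms, of "real (y_intercept S)"]
        by (auto simp: xy defect_def)
      then show False using v by (auto simp: xy defect_def)
    qed
    ultimately show "v \<in> cbox (0, 0) (real (x_intercept S), real (y_intercept S))"
      using v by (auto simp: xy defect_def cbox_Pair_eq)
  qed
  then have "emeasure lborel (defect S) \<le>
      emeasure lborel (cbox (0, 0) (real (x_intercept S), real (y_intercept S)))"
    by (intro emeasure_mono) auto
  also have "\<dots> < \<infinity>" by (rule emeasure_lborel_cbox_finite)
  finally show "emeasure lborel (defect S) < \<infinity>" .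
qed simp

lemma newton_polyhedron_origin:
  assumes "(0, 0) \<in> S"
  shows "newton_polyhedron S = {v. 0 \<le> fst v \<and> 0 \<le> snd v}"
proof (intro equalityI subsetI)
  fix v assume "v \<in> newton_polyhedron S"
  then show "v \<in> {v. 0 \<le> fst v \<and> 0 \<le> snd v}"
    using newton_polyhedron_nonneg[of "fst v" "snd v" S] by simp
next
  fix v :: "real \<times> real" assume "v \<in> {v. 0 \<le> fst v \<and> 0 \<le> snd v}"
  moreover have "(0, 0) \<in> newton_polyhedron S" using newton_polyhedron_point[OF assms] by simp
  ultimately have "(fst v, snd v) \<in> newton_polyhedron S"
    using newton_polyhedron_upward by (metis mem_Collect_eq)
  then show "v \<in> newton_polyhedron S" by simp
qed

lemma below_diagram_origin:
  assumes "(0, 0) \<in> S"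
  shows "below_diagram S \<subseteq> {0}"
proof
  fix v assume "v \<in> below_diagram S"
  then obtain p where p: "p \<in> newton_diagram S" "v \<in> closed_segment 0 p"
    by (auto simp: below_diagram_def)
  have "0 *\<^sub>R p \<in> newton_polyhedron S" using newton_polyhedron_origin[OF assms] by simp
  then have "p = 0" using newton_diagram_minimal[OF p(1), of 0] by force
  then show "v \<in> {0}" using p(2) by simp
qed

text \<open>The polyhedron is closed upwards, so the factors 1 - 1/(n+1) can replace all t < 1,
  which makes the intersection countable.\<close>

lemma below_diagram_borel:
  assumes S: "meets_axes S" and "(0, 0) \<notin> S"
  shows "below_diagram S \<in> sets borel"
proof -
  let ?P = "newton_polyhedron S"
  have *: "(\<forall>t. 0 \<le> t \<longrightarrow> t < 1 \<longrightarrow> t *\<^sub>R v \<notin> ?P) \<longleftrightarrow> (\<forall>n. (1 - 1 / real (Suc n)) *\<^sub>R v \<notin> ?P)"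
    if v: "0 \<le> fst v" "0 \<le> snd v" for v
  proof (intro iffI allI impI)
    fix t :: real assume all: "\<forall>n. (1 - 1 / real (Suc n)) *\<^sub>R v \<notin> ?P" and t: "0 \<le> t" "t < 1"
    obtain n where "1 / real (Suc n) < 1 - t"
      using t reals_Archimedean[of "1 - t"] by (auto simp: inverse_eq_divide)
    then have le: "t \<le> 1 - 1 / real (Suc n)" by simp
    show "t *\<^sub>R v \<notin> ?P"
    proof
      assume "t *\<^sub>R v \<in> ?P"
      then have "(t * fst v, t * snd v) \<in> ?P" by (simp add: scaleR_prod_def)
      then have "((1 - 1 / real (Suc n)) * fst v, (1 - 1 / real (Suc n)) * snd v) \<in> ?P"
        by (rule newton_polyhedron_upward) (use v le mult_right_mono in blast)+
      then have "(1 - 1 / real (Suc n)) *\<^sub>R v \<in> ?P" by (simp only: scaleR_prod_def real_scaleR_def)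
      then show False using all by blast
    qed
  qed auto
  have "below_diagram S = {v. 0 \<le> fst v \<and> 0 \<le> snd v} \<inter>
      (\<Inter>n. (\<lambda>v. (1 - 1 / real (Suc n)) *\<^sub>R v) -` (- ?P))"
    unfolding below_diagram_eq[OF assms] using * by auto
  moreover have "(\<lambda>v. (1 - 1 / real (Suc n)) *\<^sub>R v) -` (- ?P) \<in> sets borel" for n
    by (intro borel_open open_vimage continuous_intros) (simp add: open_Compl)
  ultimately show ?thesis using borel_quadrant by auto
qed

text \<open>The two regions differ only on the frontier of a convex set, which is negligible. If the
  origin is an exponent, both have measure 0.\<close>

lemma newton_area_eq:
  assumes S: "meets_axes S"
  shows "newton_area S = measure lborel (defect S)"
proof (cases "(0, 0) \<in> S")
  case True
  have "newton_area S = 0"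
    unfolding newton_area_def using below_diagram_origin[OF True]
    by (metis emeasure_lborel_countable countable_finite finite.emptyI finite_insert finite_subset
        enn2real_0 measure_def)
  moreover have "defect S = {}" using newton_polyhedron_origin[OF True] by (auto simp: defect_def)
  ultimately show ?thesis by simp
next
  case False
  let ?P = "newton_polyhedron S"
  have "frontier ?P \<in> null_sets lborel"
  proof -
    have "negligible (frontier ?P)" by (intro negligible_convex_frontier) simp
    then show ?thesis
      by (simp add: negligible_iff_null_sets null_sets_completion_iff)
  qed
  then have "AE v in lborel. v \<notin> frontier ?P" by (rule AE_not_in)
  moreover have "v \<in> below_diagram S \<longleftrightarrow> v \<in> defect S" if v: "v \<notin> frontier ?P" for v
  proof
    assume "v \<in> below_diagram S"
    then have b: "0 \<le> fst v" "0 \<le> snd v" "\<And>t. 0 \<le> t \<Longrightarrow> t < 1 \<Longrightarrow> t *\<^sub>R v \<notin> ?P"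
      unfolding below_diagram_eq[OF S False] by auto
    have "v \<notin> ?P"
    proof
      assume "v \<in> ?P"
      have "(\<lambda>n. (1 - 1 / real (Suc n)) *\<^sub>R v) \<longlonglongrightarrow> (1 - 0) *\<^sub>R v"
        by (intro tendsto_intros LIMSEQ_Suc[OF lim_1_over_n])
      moreover have "(1 - 1 / real (Suc n)) *\<^sub>R v \<in> - ?P" for n
        using b(3)[of "1 - 1 / real (Suc n)"] by simp
      ultimately have "v \<in> closure (- ?P)"
        unfolding closure_sequential by (auto intro!: exI[of _ "\<lambda>n. (1 - 1 / real (Suc n)) *\<^sub>R v"])
      then have "v \<in> frontier ?P"
        using \<open>v \<in> ?P\<close> by (simp add: frontier_closures closure_closed)
      with v show False by simp
    qed
    with b show "v \<in> defect S" by (simp add: defect_def)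
  next
    assume "v \<in> defect S"
    then have d: "0 \<le> fst v" "0 \<le> snd v" "v \<notin> ?P" by (auto simp: defect_def)
    have "t *\<^sub>R v \<notin> ?P" if t: "0 \<le> t" "t < 1" for t
    proof
      assume "t *\<^sub>R v \<in> ?P"
      moreover have "t * fst v \<le> 1 * fst v" "t * snd v \<le> 1 * snd v"
        using t d by (intro mult_right_mono; simp)+
      ultimately have "(fst v, snd v) \<in> ?P"
        using newton_polyhedron_upward[of "t * fst v" "t * snd v" S "fst v" "snd v"]
        by (simp add: scaleR_prod_def)
      with d show False by simp
    qed
    with d show "v \<in> below_diagram S" unfolding below_diagram_eq[OF S False] by simp
  qed
  ultimately have "AE v in lborel. v \<in> below_diagram S \<longleftrightarrow> v \<in> defect S" by auto
  then show ?thesis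
    unfolding newton_area_def
    by (rule measure_eq_AE) (use below_diagram_borel[OF S False] in auto)
qed

lemma newton_axes_length_eq:
  assumes S: "meets_axes S"
  shows "newton_axes_length S = real (x_intercept S) + real (y_intercept S)"
proof (cases "(0, 0) \<in> S")
  case True
  have "x_intercept S = 0" "y_intercept S = 0"
    using x_intercept_le[OF True] y_intercept_le[OF True] by auto
  moreover have "{t. (t, 0) \<in> below_diagram S} \<subseteq> {0}" "{t. (0, t) \<in> below_diagram S} \<subseteq> {0}"
    using below_diagram_origin[OF True] by (auto simp: zero_prod_def)
  then have "finite {t. (t, 0) \<in> below_diagram S}" "finite {t. (0, t) \<in> below_diagram S}"
    using finite_subset by blast+
  then have "measure lborel {t. (t, 0) \<in> below_diagram S} = 0"
    "measure lborel {t. (0, t) \<in> below_diagram S} = 0"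
    by (simp_all add: measure_def emeasure_lborel_countable countable_finite)
  ultimately show ?thesis by (simp add: newton_axes_length_def)
next
  case False
  have aux: "{t. 0 \<le> t \<and> (\<forall>s. 0 \<le> s \<longrightarrow> s < 1 \<longrightarrow> s * t < c)} = {0..c}" if "c > 0" for c :: real
  proof (intro equalityI subsetI)
    fix t assume t: "t \<in> {t. 0 \<le> t \<and> (\<forall>s. 0 \<le> s \<longrightarrow> s < 1 \<longrightarrow> s * t < c)}"
    have "t \<le> c"
    proof (rule ccontr)
      assume "\<not> t \<le> c"
      then have "c / t * t < c" using t that by (auto dest!: spec[of _ "c / t"])
      then show False using \<open>\<not> t \<le> c\<close> that by simp
    qed
    with t show "t \<in> {0..c}" by simp
  next
    fix t assume t: "t \<in> {0..c}"
    have "s * t < c" if "0 \<le> s" "s < 1" for s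
    proof (cases "t = 0")
      case False
      then have "s * t < 1 * t" using t that by (intro mult_strict_right_mono) auto
      then show ?thesis using t by simp
    qed (use \<open>c > 0\<close> in simp)
    with t show "t \<in> {t. 0 \<le> t \<and> (\<forall>s. 0 \<le> s \<longrightarrow> s < 1 \<longrightarrow> s * t < c)}" by simp
  qed
  have pos: "real (x_intercept S) > 0" "real (y_intercept S) > 0"
    using x_intercept_mem[OF S] y_intercept_mem[OF S] False by (metis gr0I of_nat_0_less_iff)+
  have "{t. (t, 0) \<in> below_diagram S} = {0..real (x_intercept S)}"
    unfolding below_diagram_eq[OF S False] aux[OF pos(1), symmetric]
    by (simp add: x_axis_polyhedron[OF S] not_le)
  moreover have "{t. (0, t) \<in> below_diagram S} = {0..real (y_intercept S)}"
    unfolding below_diagram_eq[OF S False] aux[OF pos(2), symmetric]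
    by (simp add: y_axis_polyhedron[OF S] not_le)
  ultimately show ?thesis by (simp add: newton_axes_length_def)
qed

lemma newton_number_defect:
  assumes "meets_axes S"
  shows "\<mu> S =
    2 * measure lborel (defect S) - real (x_intercept S) - real (y_intercept S) + 1"
  using assms by (simp add: newton_number_convenient_def newton_area_eq newton_axes_length_eq)

text \<open>Cavalieri's principle: the slice at height y has length L (1 - y / B), wherever it
  starts. The free left border c covers right triangles as well as the oblique ones in the
  monotonicity proof.\<close>

lemma emeasure_wedge:
  fixes c :: "real \<Rightarrow> real"
  assumes "B > 0" "L \<ge> 0" and c: "continuous_on UNIV c"
  shows "{(x, y). 0 \<le> y \<and> y \<le> B \<and> c y \<le> x \<and> x < c y + L * (1 - y / B)} \<in> sets borel" (is "?W \<in> _")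
    and "emeasure lborel {(x, y). 0 \<le> y \<and> y \<le> B \<and> c y \<le> x \<and> x < c y + L * (1 - y / B)} =
      ennreal (L * B / 2)"
proof -
  have [measurable]: "c \<in> borel_measurable borel" using c by (rule borel_measurable_continuous_onI)
  have "?W = {v \<in> space (borel \<Otimes>\<^sub>M borel). 0 \<le> snd v \<and> snd v \<le> B \<and> c (snd v) \<le> fst v \<and>
      fst v < c (snd v) + L * (1 - snd v / B)}"
    by (auto simp: space_pair_measure)
  also have "\<dots> \<in> sets (borel \<Otimes>\<^sub>M borel)" by measurable
  finally show meas: "?W \<in> sets borel" by (simp only: borel_prod)
  have "emeasure lborel ?W = emeasure (lborel \<Otimes>\<^sub>M lborel) ?W" by (simp add: lborel_prod)
  also have "\<dots> = (\<integral>\<^sup>+y. emeasure lborel ((\<lambda>x. (x, y)) -` ?W) \<partial>lborel)"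
    using meas by (intro lborel_pair.emeasure_pair_measure_alt2) (simp only: lborel_prod sets_lborel)
  also have "\<dots> = (\<integral>\<^sup>+y. ennreal (L * (1 - y / B)) * indicator {0..B} y \<partial>lborel)"
  proof (rule nn_integral_cong)
    fix y :: real
    show "emeasure lborel ((\<lambda>x. (x, y)) -` ?W) = ennreal (L * (1 - y / B)) * indicator {0..B} y"
    proof -
      have eq: "(\<lambda>x. (x, y)) -` ?W = (if 0 \<le> y \<and> y \<le> B then {c y..<c y + L * (1 - y / B)} else {})"
        by auto
      have "0 \<le> L * (1 - y / B)" if "y \<le> B" using that assms by simp
      then show ?thesis unfolding eq by (auto simp: indicator_def)
    qed
  qed
  also have "\<dots> = ennreal (L * (B - B\<^sup>2 / (2 * B)) - L * (0 - 0\<^sup>2 / (2 * B)))"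
  proof (rule nn_integral_FTC_Icc)
    fix y assume y: "y \<in> {0..B}"
    show "((\<lambda>y. L * (y - y\<^sup>2 / (2 * B))) has_real_derivative L * (1 - y / B)) (at y)"
      using assms by (auto intro!: derivative_eq_intros simp: field_simps)
    show "0 \<le> L * (1 - y / B)" using y assms by simp
  qed (use assms in auto)
  also have "L * (B - B\<^sup>2 / (2 * B)) - L * (0 - 0\<^sup>2 / (2 * B)) = L * B / 2"
    using assms by (simp add: field_simps power2_eq_square)
  finally show "emeasure lborel ?W = ennreal (L * B / 2)" .
qed

lemma measure_triangle:
  fixes A B :: real
  assumes "A > 0" "B > 0"
  shows "{v. 0 \<le> fst v \<and> 0 \<le> snd v \<and> B * fst v + A * snd v < A * B} \<in> fmeasurable lborel"
    and "measure lborel {v. 0 \<le> fst v \<and> 0 \<le> snd v \<and> B * fst v + A * snd v < A * B} = A * B / 2"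
proof -
  let ?T = "{v. 0 \<le> fst v \<and> 0 \<le> snd v \<and> B * fst v + A * snd v < A * B}"
  have *: "?T =
      {(x, y). 0 \<le> y \<and> y \<le> B \<and> 0 \<le> x \<and> x < 0 + A * (1 - y / B)}"
  proof -
    have "y \<le> B" if "0 \<le> x" "B * x + A * y < A * B" for x y
    proof -
      have "0 \<le> B * x" using that assms by simp
      then have "A * y < A * B" using that by linarith
      then show ?thesis using assms by simp
    qed
    moreover have "B * x + A * y < A * B \<longleftrightarrow> x < A * (1 - y / B)" for x y
      using assms by (simp add: field_simps)
    ultimately show ?thesis by auto
  qed
  have T: "?T \<in> sets borel" "emeasure lborel ?T = ennreal (A * B / 2)"
    unfolding * using assms by (intro emeasure_wedge; simp)+
  then show "?T \<in> fmeasurable lborel" by (intro fmeasurableI) simp_all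
  show "measure lborel ?T = A * B / 2" using T(2) assms by (simp add: measure_def)
qed


section \<open>Area under reflection and shear\<close>

lemma emeasure_swap:
  fixes A :: "(real \<times> real) set"
  assumes "A \<in> sets borel"
  shows "prod.swap -` A \<in> sets borel" and "emeasure lborel (prod.swap -` A) = emeasure lborel A"
proof -
  have [measurable]: "prod.swap \<in> borel \<rightarrow>\<^sub>M (borel :: (real \<times> real) measure)"
    by (intro borel_measurable_continuous_onI continuous_on_swap)
  show meas: "prod.swap -` A \<in> sets borel"
    using measurable_sets[OF \<open>prod.swap \<in> borel \<rightarrow>\<^sub>M borel\<close> assms] by simp
  have "lborel = distr lborel lborel (\<lambda>(x, y). (y, x) :: real \<times> real)"
    using lborel_pair.distr_pair_swap[where 'a = real and 'b = real] by (simp only: lborel_prod)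
  also have "(\<lambda>(x, y). (y, x) :: real \<times> real) = prod.swap" by (auto simp: fun_eq_iff)
  finally have "emeasure lborel A = emeasure (distr lborel lborel prod.swap) A" by simp
  also have "\<dots> = emeasure lborel (prod.swap -` A)"
    using assms by (subst emeasure_distr) auto
  finally show "emeasure lborel (prod.swap -` A) = emeasure lborel A" ..
qed

text \<open>Each vertical fibre is only translated, by x - m.\<close>

lemma emeasure_shear:
  fixes A :: "(real \<times> real) set" and m :: real
  assumes "A \<in> sets borel"
  shows "(\<lambda>v. (fst v, fst v + snd v - m)) -` A \<in> sets borel"
    and "emeasure lborel ((\<lambda>v. (fst v, fst v + snd v - m)) -` A) = emeasure lborel A"
proof -
  let ?f = "\<lambda>v :: real \<times> real. (fst v, fst v + snd v - m)"
  have "?f \<in> borel \<rightarrow>\<^sub>M borel"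
    by (intro borel_measurable_continuous_onI continuous_intros)
  from measurable_sets[OF this assms] show meas: "?f -` A \<in> sets borel" by simp
  have alt: "emeasure lborel X = (\<integral>\<^sup>+x. emeasure lborel (Pair x -` X) \<partial>lborel)"
    if "X \<in> sets borel" for X :: "(real \<times> real) set"
  proof -
    have "emeasure lborel X = emeasure (lborel \<Otimes>\<^sub>M lborel) X" by (simp only: lborel_prod)
    also have "\<dots> = (\<integral>\<^sup>+x. emeasure lborel (Pair x -` X) \<partial>lborel)"
      using that by (intro lborel.emeasure_pair_measure_alt) (simp only: lborel_prod sets_lborel)
    finally show ?thesis .
  qed
  have "emeasure lborel (Pair x -` (?f -` A)) = emeasure lborel (Pair x -` A)" for x
  proof -
    have "Pair x \<in> borel \<rightarrow>\<^sub>M (borel :: (real \<times> real) measure)"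
      by (intro borel_measurable_continuous_onI continuous_intros)
    from measurable_sets[OF this assms] have [measurable]: "Pair x -` A \<in> sets borel" by simp
    have "emeasure lborel (Pair x -` A) = emeasure (distr lborel borel ((+) (x - m))) (Pair x -` A)"
      by (simp only: lborel_distr_plus)
    also have "\<dots> = emeasure lborel ((+) (x - m) -` (Pair x -` A))"
      by (subst emeasure_distr) auto
    also have "(+) (x - m) -` (Pair x -` A) = Pair x -` (?f -` A)"
      by (auto simp: algebra_simps)
    finally show ?thesis ..
  qed
  then show "emeasure lborel (?f -` A) = emeasure lborel A"
    by (simp add: alt[OF meas] alt[OF assms])
qed

lemma newton_number_swap:
  assumes "meets_axes S"
  shows "\<mu> (prod.swap ` S) = \<mu> S"
proof -
  have "defect (prod.swap ` S) = prod.swap -` defect S"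
    by (auto simp: defect_def swap_polyhedron)
  then have "measure lborel (defect (prod.swap ` S)) = measure lborel (defect S)"
    using emeasure_swap(2)[OF defect_borel, of S] by (simp add: measure_def)
  then show ?thesis using assms by (simp add: newton_number_defect)
qed

text \<open>The value is (A - 1) (B - 1), in characteristic 0 the Milnor number of x^A +
  y^B.\<close>

lemma newton_number_triangle:
  assumes "A > 0" "B > 0" "(A, 0) \<in> S" "(0, B) \<in> S"
    and ge: "\<And>i j. (i, j) \<in> S \<Longrightarrow> A * B \<le> B * i + A * j"
  shows "\<mu> S = real A * real B - real A - real B + 1"
proof -
  have S: "meets_axes S" using assms by (auto simp: meets_axes_def)
  note nonempty = meets_axes_nonempty[OF S]
  have ge': "real A * real B \<le> real B * real i + real A * real j" if "(i, j) \<in> S" for i j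
    using ge[OF that] by (simp only: of_nat_mult[symmetric] of_nat_add[symmetric] of_nat_le_iff)
  have iff: "(x, y) \<in> newton_polyhedron S \<longleftrightarrow> real A * real B \<le> real B * x + real A * y"
    if xy: "0 \<le> x" "0 \<le> y" for x y
  proof
    assume "(x, y) \<in> newton_polyhedron S"
    then show "real A * real B \<le> real B * x + real A * y"
      using newton_polyhedron_weight[OF nonempty _ _ _ ge'] by simp
  next
    assume le: "real A * real B \<le> real B * x + real A * y"
    show "(x, y) \<in> newton_polyhedron S"
      unfolding mem_newton_polyhedron_iff[OF nonempty]
    proof (intro allI impI)
      fix p q :: real assume pq: "0 \<le> p" "0 \<le> q"
      \<comment> \<open>The minimum of the linear form over the two vertices (A, 0) and (0,
        B).\<close>
      define c where "c = min (p * real A) (q * real B)"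
      have "c * (real A * real B) \<le> c * (real B * x + real A * y)"
        using le pq by (intro mult_left_mono) (auto simp: c_def)
      also have "\<dots> \<le> p * real A * (real B * x) + q * real B * (real A * y)"
        unfolding distrib_left using xy by (intro add_mono mult_right_mono) (auto simp: c_def)
      also have "\<dots> = (p * x + q * y) * (real A * real B)" by (simp add: algebra_simps)
      finally have "c \<le> p * x + q * y" using assms(1,2) by simp
      then have "p * real A \<le> p * x + q * y \<or> q * real B \<le> p * x + q * y"
        by (simp add: c_def min_le_iff_disj)
      then show "\<exists>(i, j)\<in>S. p * real i + q * real j \<le> p * x + q * y"
        using assms(3,4) by force
    qed
  qed
  have "defect S = {v. 0 \<le> fst v \<and> 0 \<le> snd v \<and> real B * fst v + real A * snd v < real A * real B}"
    using iff by (auto simp: defect_def not_le)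
  then have "measure lborel (defect S) = real A * real B / 2"
    using measure_triangle(2)[of "real A" "real B"] assms(1,2) by simp
  moreover have "x_intercept S = A"
    unfolding x_intercept_def using assms(2,3) ge[of _ 0] by (intro Least_equality) auto
  moreover have "y_intercept S = B"
    unfolding y_intercept_def using assms(1,4) ge[of 0] by (intro Least_equality) auto
  ultimately show ?thesis using S by (simp add: newton_number_defect)
qed

lemma newton_number_origin:
  assumes "(0, 0) \<in> S"
  shows "\<mu> S = 1"
proof -
  have "meets_axes S" using assms by (auto simp: meets_axes_def)
  moreover have "defect S = {}" using newton_polyhedron_origin[OF assms] by (auto simp: defect_def)
  moreover have "x_intercept S = 0" "y_intercept S = 0"
    using x_intercept_le[OF assms] y_intercept_le[OF assms] by auto
  ultimately show ?thesis by (simp add: newton_number_defect)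
qed


section \<open>The Newton number and blowing up\<close>

text \<open>The supports of the strict transforms in the charts \<open>None\<close> and \<open>Some 0\<close> for multiplicity \<open>m\<close>.\<close>

definition blow_x :: "nat \<Rightarrow> (nat \<times> nat) set \<Rightarrow> (nat \<times> nat) set" where
  "blow_x m S = (\<lambda>(i, j). (i, i + j - m)) ` S"

definition blow_y :: "nat \<Rightarrow> (nat \<times> nat) set \<Rightarrow> (nat \<times> nat) set" where
  "blow_y m S = (\<lambda>(i, j). (i + j - m, j)) ` S"

text \<open>
  Half planes with normal \<open>(p, q)\<close> become half planes of the first chart if \<open>q \<le> p\<close> and of the
  second chart if \<open>p \<le> q\<close>.
\<close>

lemma polyhedron_blowup:
  assumes "S \<noteq> {}" and m: "\<And>i j. (i, j) \<in> S \<Longrightarrow> m \<le> i + j"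
  shows "(x, y) \<in> newton_polyhedron S \<longleftrightarrow>
    (x, x + y - real m) \<in> newton_polyhedron (blow_x m S) \<and>
    (x + y - real m, y) \<in> newton_polyhedron (blow_y m S)"
proof -
  have ne: "blow_x m S \<noteq> {}" "blow_y m S \<noteq> {}" using assms by (auto simp: blow_x_def blow_y_def)
  have X: "(\<exists>(i, j)\<in>blow_x m S. p * real i + q * real j \<le> p * x + q * (x + y - real m)) \<longleftrightarrow>
      (\<exists>(i, j)\<in>S. (p + q) * real i + q * real j \<le> (p + q) * x + q * y)" for p q
  proof -
    have "p * real i + q * real (i + j - m) \<le> p * x + q * (x + y - real m) \<longleftrightarrow>
        (p + q) * real i + q * real j \<le> (p + q) * x + q * y" if "(i, j) \<in> S" for i j
      using m[OF that] by (simp add: of_nat_diff algebra_simps)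
    then show ?thesis unfolding blow_x_def by force
  qed
  have Y: "(\<exists>(i, j)\<in>blow_y m S. p * real i + q * real j \<le> p * (x + y - real m) + q * y) \<longleftrightarrow>
      (\<exists>(i, j)\<in>S. p * real i + (p + q) * real j \<le> p * x + (p + q) * y)" for p q
  proof -
    have "p * real (i + j - m) + q * real j \<le> p * (x + y - real m) + q * y \<longleftrightarrow>
        p * real i + (p + q) * real j \<le> p * x + (p + q) * y" if "(i, j) \<in> S" for i j
      using m[OF that] by (simp add: of_nat_diff algebra_simps)
    then show ?thesis unfolding blow_y_def by force
  qed
  show ?thesis
    unfolding mem_newton_polyhedron_iff[OF assms(1)] mem_newton_polyhedron_iff[OF ne(1)]
      mem_newton_polyhedron_iff[OF ne(2)] X Y
  proof (intro iffI conjI allI impI)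
    fix p q :: real
    assume *: "(\<forall>p\<ge>0. \<forall>q\<ge>0. \<exists>(i, j)\<in>S. (p + q) * real i + q * real j \<le> (p + q) * x + q * y) \<and>
      (\<forall>p\<ge>0. \<forall>q\<ge>0. \<exists>(i, j)\<in>S. p * real i + (p + q) * real j \<le> p * x + (p + q) * y)"
      and pq: "0 \<le> p" "0 \<le> q"
    show "\<exists>(i, j)\<in>S. p * real i + q * real j \<le> p * x + q * y"
    proof (cases "q \<le> p")
      case True
      then have "\<exists>(i, j)\<in>S. (p - q + q) * real i + q * real j \<le> (p - q + q) * x + q * y"
        using * pq by (metis diff_ge_0_iff_ge)
      then show ?thesis by simp
    next
      case False
      then have "\<exists>(i, j)\<in>S. p * real i + (p + (q - p)) * real j \<le> p * x + (p + (q - p)) * y"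
        using * pq by (metis diff_ge_0_iff_ge linear)
      then show ?thesis by simp
    qed
  qed (use add_nonneg_nonneg in blast)+
qed

lemma swap_blow: "prod.swap ` blow_y m S = blow_x m (prod.swap ` S)"
  by (auto simp: blow_x_def blow_y_def image_image case_prod_unfold add.commute)

text \<open>Exponents of lowest degree land on the x-axis of the chart, keeping their x-coordinate;
  those on the y-axis move down by m.\<close>

lemma blow_x_intercepts:
  assumes S: "meets_axes S" and m: "\<And>i j. (i, j) \<in> S \<Longrightarrow> m \<le> i + j"
    and a: "(a, m - a) \<in> S" "a \<le> m" "\<And>i j. (i, j) \<in> S \<Longrightarrow> i + j = m \<Longrightarrow> a \<le> i"
  shows "meets_axes (blow_x m S) \<and> x_intercept (blow_x m S) = a \<and>
    y_intercept (blow_x m S) = y_intercept S - m"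
proof -
  let ?Y = "y_intercept S"
  have mem: "(a, 0) \<in> blow_x m S" "(0, ?Y - m) \<in> blow_x m S"
    using imageI[OF a(1), of "\<lambda>(i, j). (i, i + j - m)"] a(2)
      imageI[OF y_intercept_mem[OF S], of "\<lambda>(i, j). (i, i + j - m)"]
    by (simp_all add: blow_x_def)
  have "a \<le> i" if "(i, 0) \<in> blow_x m S" for i
  proof -
    from that obtain j where "(i, j) \<in> S" "i + j - m = 0" by (auto simp: blow_x_def)
    then show ?thesis using a(3)[of i j] m[of i j] by simp
  qed
  moreover have "?Y - m \<le> j" if "(0, j) \<in> blow_x m S" for j
    using that y_intercept_le by (auto simp: blow_x_def intro: diff_le_mono)
  ultimately have "x_intercept (blow_x m S) = a" "y_intercept (blow_x m S) = ?Y - m"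
    unfolding x_intercept_def[of "blow_x m S"] y_intercept_def[of "blow_x m S"]
    using mem by (auto intro!: Least_equality)
  then show ?thesis using mem by (auto simp: meets_axes_def)
qed

text \<open>Twice the triangle contributes m^2. The intercepts in the charts are a, Y - m and X - m,
  m - b, with sum X + Y - m - (b - a); together with the constants 1 of both charts this accounts
  for the remaining terms.\<close>

lemma newton_number_blowup:
  assumes S: "meets_axes S" and m: "m > 0" "\<And>i j. (i, j) \<in> S \<Longrightarrow> m \<le> i + j"
    and a: "(a, m - a) \<in> S" "a \<le> m" "\<And>i j. (i, j) \<in> S \<Longrightarrow> i + j = m \<Longrightarrow> a \<le> i"
    and b: "(b, m - b) \<in> S" "b \<le> m" "\<And>i j. (i, j) \<in> S \<Longrightarrow> i + j = m \<Longrightarrow> i \<le> b"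
  shows "\<mu> S = real m * real m - real m +
    \<mu> (blow_x m S) + \<mu> (blow_y m S) -
    (real b - real a) - 1"
proof -
  define X where "X = x_intercept S"
  define Y where "Y = y_intercept S"
  have XS: "(X, 0) \<in> S" "(0, Y) \<in> S"
    using x_intercept_mem[OF S] y_intercept_mem[OF S] by (auto simp: X_def Y_def)
  have mXY: "m \<le> X" "m \<le> Y" using m(2)[OF XS(1)] m(2)[OF XS(2)] by auto
  have "a \<le> b" using a(3)[OF b(1)] b(2) by simp
  have ax: "meets_axes (blow_x m S)" and Xi: "x_intercept (blow_x m S) = a"
    and Yi: "y_intercept (blow_x m S) = Y - m"
    unfolding Y_def using blow_x_intercepts[OF S m(2) a] by auto
  have "meets_axes (blow_x m (prod.swap ` S)) \<and> x_intercept (blow_x m (prod.swap ` S)) = m - b \<and>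
      y_intercept (blow_x m (prod.swap ` S)) = y_intercept (prod.swap ` S) - m"
  proof (rule blow_x_intercepts)
    fix i j assume ij: "(i, j) \<in> prod.swap ` S"
    then show "m \<le> i + j" using m(2)[of j i] by simp
    assume "i + j = m"
    then show "m - b \<le> i" using ij b(3)[of j i] by simp
  qed (use S b(1,2) in simp_all)
  then have ax': "meets_axes (blow_y m S)" and Xi': "x_intercept (blow_y m S) = X - m"
    and Yi': "y_intercept (blow_y m S) = m - b"
    unfolding swap_blow[symmetric] X_def by simp_all
  let ?f = "\<lambda>v :: real \<times> real. (fst v, fst v + snd v - real m)"
  let ?g = "\<lambda>v :: real \<times> real. (fst v + snd v - real m, snd v)"
  define T where "T = {v :: real \<times> real. 0 \<le> fst v \<and> 0 \<le> snd v \<and> real m * fst v + real m * snd v < real m * real m}"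
  define D where "D = ?f -` defect (blow_x m S)"
  define E where "E = ?g -` defect (blow_y m S)"
  have E_alt: "E = prod.swap -` (?f -` (prod.swap -` defect (blow_y m S)))"
    by (auto simp: E_def add.commute)
  have T_iff: "(x, y) \<in> T \<longleftrightarrow> 0 \<le> x \<and> 0 \<le> y \<and> x + y < real m" for x y
  proof -
    have "real m * x + real m * y < real m * real m \<longleftrightarrow> real m * (x + y) < real m * real m"
      by (simp add: algebra_simps)
    also have "\<dots> \<longleftrightarrow> x + y < real m" using m(1) by simp
    finally show ?thesis by (simp add: T_def)
  qed
  have T: "T \<in> fmeasurable lborel" "measure lborel T = real m * real m / 2"
    unfolding T_def using measure_triangle[of "real m" "real m"] m(1) by auto
  have D: "D \<in> sets borel" "emeasure lborel D = emeasure lborel (defect (blow_x m S))"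
    unfolding D_def by (intro emeasure_shear defect_borel)+
  have E: "E \<in> sets borel" "emeasure lborel E = emeasure lborel (defect (blow_y m S))"
    unfolding E_alt by (simp_all add: emeasure_shear emeasure_swap)
  have fm: "D \<in> fmeasurable lborel" "E \<in> fmeasurable lborel"
    using D E defect_fmeasurable[OF ax] defect_fmeasurable[OF ax']
    by (auto simp: fmeasurable_def)
  have mem_P: "(x, y) \<in> newton_polyhedron S \<longleftrightarrow>
    (x, x + y - real m) \<in> newton_polyhedron (blow_x m S) \<and>
    (x + y - real m, y) \<in> newton_polyhedron (blow_y m S)" for x y
    by (rule polyhedron_blowup[OF meets_axes_nonempty[OF S] m(2)])
  \<comment> \<open>\<open>D\<close> stays left of a and \<open>E\<close> below m - b. With a \<le>
    b and x + y \<ge> m this makes them disjoint and keeps them in the quadrant.\<close>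
  have D_less: "x < real a" if "(x, y) \<in> D" for x y
  proof (rule ccontr)
    assume "\<not> x < real a"
    moreover have "(real a, 0) \<in> newton_polyhedron (blow_x m S)" using x_axis_polyhedron[OF ax] Xi by simp
    ultimately have "(x, x + y - real m) \<in> newton_polyhedron (blow_x m S)"
      using newton_polyhedron_upward[of "real a" 0 _ x "x + y - real m"] that
      by (simp add: D_def defect_def)
    with that show False by (simp add: D_def defect_def)
  qed
  have E_less: "y < real m - real b" if "(x, y) \<in> E" for x y
  proof (rule ccontr)
    assume "\<not> y < real m - real b"
    moreover have "(0, real m - real b) \<in> newton_polyhedron (blow_y m S)"
      using y_axis_polyhedron[OF ax'] Yi' b(2) by (simp add: of_nat_diff)
    ultimately have "(x + y - real m, y) \<in> newton_polyhedron (blow_y m S)"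
      using newton_polyhedron_upward[of 0 "real m - real b" _ "x + y - real m" y] that
      by (simp add: E_def defect_def)
    with that show False by (simp add: E_def defect_def)
  qed
  have ab': "real a \<le> real m" "0 \<le> real b" "real a \<le> real b" using a \<open>a \<le> b\<close> by auto
  have union: "defect S = T \<union> (D \<union> E)"
  proof (intro equalityI subsetI)
    fix v assume v: "v \<in> defect S"
    obtain x y where xy: "v = (x, y)" by (cases v)
    from v have *: "0 \<le> x" "0 \<le> y" "(x, y) \<notin> newton_polyhedron S" by (auto simp: xy defect_def)
    show "v \<in> T \<union> (D \<union> E)"
    proof (cases "x + y < real m")
      case True
      then show ?thesis using * by (simp add: xy T_iff)
    next
      case False
      then show ?thesis using * mem_P[of x y] by (auto simp: xy D_def E_def defect_def)
    qed
  next
    fix v assume v: "v \<in> T \<union> (D \<union> E)"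
    obtain x y where xy: "v = (x, y)" by (cases v)
    consider "v \<in> T" | "v \<in> D" | "v \<in> E" using v by blast
    then show "v \<in> defect S"
    proof cases
      case 1
      then have *: "0 \<le> x" "0 \<le> y" "x + y < real m" by (auto simp: xy T_iff)
      moreover have "(x, y) \<notin> newton_polyhedron S"
        using newton_polyhedron_nonneg(1)[of "x + y - real m" y "blow_y m S"] * mem_P[of x y] by auto
      ultimately show ?thesis by (simp add: xy defect_def)
    next
      case 2
      then show ?thesis using D_less[of x y] ab' mem_P[of x y] by (auto simp: xy D_def defect_def)
    next
      case 3
      then show ?thesis using E_less[of x y] ab' mem_P[of x y] by (auto simp: xy E_def defect_def)
    qed
  qed
  have "D \<inter> E = {}"
  proof (intro equals0I)
    fix v assume v: "v \<in> D \<inter> E"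
    obtain x y where xy: "v = (x, y)" by (cases v)
    have "x < real a" "y < real m - real b" "0 \<le> x + y - real m"
      using v D_less[of x y] E_less[of x y] by (auto simp: xy D_def defect_def)
    then show False using ab' by linarith
  qed
  moreover have "T \<inter> (D \<union> E) = {}"
    by (auto simp: T_iff D_def E_def defect_def)
  ultimately have "measure lborel (defect S) =
      measure lborel T + (measure lborel D + measure lborel E)"
    unfolding union using T fm fmeasurableD2[OF T(1)] fmeasurableD2[OF fm(1)] fmeasurableD2[OF fm(2)]
    by (subst measure_Union; (subst measure_Union)?)
       (auto simp: fmeasurableD fmeasurableD2[OF fmeasurable.Un] D(1) E(1))
  also have "measure lborel D = measure lborel (defect (blow_x m S))" using D by (simp add: measure_def)
  also have "measure lborel E = measure lborel (defect (blow_y m S))" using E by (simp add: measure_def)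
  finally have meas: "measure lborel (defect S) = real m * real m / 2 +
      (measure lborel (defect (blow_x m S)) + measure lborel (defect (blow_y m S)))"
    using T(2) by simp
  show ?thesis
    unfolding newton_number_defect[OF S] newton_number_defect[OF ax] newton_number_defect[OF ax']
      meas Xi Yi Xi' Yi' X_def[symmetric] Y_def[symmetric]
    using mXY b(2) by (simp add: of_nat_diff algebra_simps)
qed


section \<open>Monotonicity of the Newton number\<close>

text \<open>Lowering the x-intercept from X to Z shortens the length term by X - Z, which the area
  has to pay for. The triangle with vertices (Z, 0), (X, 0), (e, 1) has area (X - Z) / 2 and lies in
  \<open>defect S\<close> but outside \<open>defect T\<close>. Integrality of the exponents is what
  guarantees height 1.\<close>

lemma newton_number_mono_x:
  assumes S: "meets_axes S" and T: "meets_axes T" and sub: "newton_polyhedron S \<subseteq> newton_polyhedron T"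
    and Y: "y_intercept S = y_intercept T"
  shows "\<mu> T \<le> \<mu> S"
proof -
  let ?X = "real (x_intercept S)" and ?Z = "real (x_intercept T)"
  have ZX: "?Z \<le> ?X" using sub x_axis_polyhedron[OF S, of ?X] x_axis_polyhedron[OF T, of ?X] by auto
  define L where "L = {x. (x, 1) \<in> newton_polyhedron S}"
  have nonneg: "0 \<le> x" if "x \<in> L" for x using newton_polyhedron_nonneg(1) that by (auto simp: L_def)
  have XL: "?X \<in> L"
    using newton_polyhedron_upward[of ?X 0 S ?X 1] x_axis_polyhedron[OF S, of ?X] by (simp add: L_def)
  have bdd: "bdd_below L" by (rule bdd_belowI[of _ 0]) (rule nonneg)
  have "closed ((\<lambda>x. (x, 1)) -` newton_polyhedron S)"
    by (intro closed_vimage closed_newton_polyhedron continuous_intros)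
  then have "closed L" by (simp add: L_def vimage_def)
  define e where "e = Inf L"
  have eL: "e \<in> L" unfolding e_def using XL bdd \<open>closed L\<close> by (intro closed_contains_Inf) auto
  have e_le: "e \<le> x" if "x \<in> L" for x unfolding e_def using that bdd by (rule cInf_lower)
  have e: "0 \<le> e" "e \<le> ?X" using nonneg[OF eL] e_le[OF XL] by auto
  \<comment> \<open>The line from (X, 0) to (e, 1) supports S: an exponent at height j \<ge> 1
    joined to (X, 0) crosses height 1 in a point of \<open>L\<close>.\<close>
  have slope: "?X \<le> 1 * real i + (?X - e) * real j" if ij: "(i, j) \<in> S" for i j
  proof (cases "j = 0")
    case True
    then show ?thesis using ij x_intercept_le by simp
  next
    case False
    have "(1 - 1 / real j) *\<^sub>R (?X, 0) + (1 / real j) *\<^sub>R (real i, real j) \<in> newton_polyhedron S"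
    proof (rule convexD)
      show "(?X, 0) \<in> newton_polyhedron S" using x_axis_polyhedron[OF S] by simp
      show "(real i, real j) \<in> newton_polyhedron S" using ij by (rule newton_polyhedron_point)
    qed (use False in auto)
    then have "(1 - 1 / real j) * ?X + real i / real j \<in> L" using False by (simp add: L_def)
    then have "e \<le> (1 - 1 / real j) * ?X + real i / real j" by (rule e_le)
    then have "e * real j \<le> ((1 - 1 / real j) * ?X + real i / real j) * real j"
      by (intro mult_right_mono) auto
    also have "\<dots> = (real j - 1) * ?X + real i" using False by (simp add: field_simps)
    finally show ?thesis by (simp add: algebra_simps)
  qed
  \<comment> \<open>The left side of the triangle, from (Z, 0) to (e, 1).\<close>
  define c where "c y = (1 - y) * ?Z + y * e" for y
  define W where "W = {(x, y). 0 \<le> y \<and> y \<le> 1 \<and> c y \<le> x \<and> x < c y + (?X - ?Z) * (1 - y / 1)}"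
  have W: "W \<in> sets borel" "emeasure lborel W = ennreal ((?X - ?Z) * 1 / 2)"
    unfolding W_def using ZX by (intro emeasure_wedge; auto simp: c_def intro!: continuous_intros)+
  have "W \<inter> defect T = {}"
  proof (intro equals0I)
    fix v assume v: "v \<in> W \<inter> defect T"
    obtain x y where xy: "v = (x, y)" by (cases v)
    have y: "0 \<le> y" "y \<le> 1" "c y \<le> x" using v by (auto simp: xy W_def)
    have "(1 - y) *\<^sub>R (?Z, 0) + y *\<^sub>R (e, 1) \<in> newton_polyhedron T"
    proof (rule convexD)
      show "(?Z, 0) \<in> newton_polyhedron T" using x_axis_polyhedron[OF T] by simp
      show "(e, 1) \<in> newton_polyhedron T" using eL sub by (auto simp: L_def)
    qed (use y in auto)
    then have "(c y, y) \<in> newton_polyhedron T" by (simp add: c_def)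
    then have "(x, y) \<in> newton_polyhedron T" using y newton_polyhedron_upward by blast
    then show False using v by (simp add: xy defect_def)
  qed
  moreover have sub1: "W \<subseteq> defect S"
  proof
    fix v assume v: "v \<in> W"
    obtain x y where xy: "v = (x, y)" by (cases v)
    have y: "0 \<le> y" "y \<le> 1" "c y \<le> x" "x < c y + (?X - ?Z) * (1 - y)" using v by (auto simp: xy W_def)
    have "0 \<le> (1 - y) * ?Z" "0 \<le> y * e" using y e by simp_all
    then have "0 \<le> c y" by (simp add: c_def)
    moreover have "(x, y) \<notin> newton_polyhedron S"
    proof
      assume "(x, y) \<in> newton_polyhedron S"
      then have "?X \<le> 1 * x + (?X - e) * y"
        using newton_polyhedron_weight[OF meets_axes_nonempty[OF S] _ _ _ slope] e by simp
      moreover have "c y + (?X - ?Z) * (1 - y) = ?X - (?X - e) * y" by (simp add: c_def algebra_simps)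
      ultimately show False using y(4) by linarith
    qed
    ultimately show "v \<in> defect S" using y by (simp add: xy defect_def)
  qed
  moreover have sub2: "defect T \<subseteq> defect S" using sub by (auto simp: defect_def)
  moreover have fm: "defect S \<in> fmeasurable lborel" "defect T \<in> fmeasurable lborel"
    using defect_fmeasurable S T by auto
  moreover have Wf: "W \<in> fmeasurable lborel" using W by (intro fmeasurableI) auto
  ultimately have "measure lborel W + measure lborel (defect T) = measure lborel (W \<union> defect T)"
    by (subst measure_Union) (auto simp: fmeasurableD2)
  also have "\<dots> \<le> measure lborel (defect S)"
    using sub1 sub2 fm Wf by (intro measure_mono_fmeasurable) auto
  finally have "measure lborel W + measure lborel (defect T) \<le> measure lborel (defect S)" .
  moreover have "2 * measure lborel W = ?X - ?Z" using W(2) ZX by (simp only: measure_def) simp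
  ultimately have "2 * measure lborel (defect T) - ?Z \<le> 2 * measure lborel (defect S) - ?X"
    using ZX by (simp add: algebra_simps)
  then show ?thesis
    unfolding newton_number_defect[OF S] newton_number_defect[OF T] Y by simp
qed

lemma newton_number_mono_y:
  assumes S: "meets_axes S" and T: "meets_axes T" and sub: "newton_polyhedron S \<subseteq> newton_polyhedron T"
    and X: "x_intercept S = x_intercept T"
  shows "\<mu> T \<le> \<mu> S"
proof -
  have "newton_polyhedron (prod.swap ` S) \<subseteq> newton_polyhedron (prod.swap ` T)"
    using sub by (auto simp: swap_polyhedron)
  then have "\<mu> (prod.swap ` T) \<le> \<mu> (prod.swap ` S)"
    using S T X by (intro newton_number_mono_x) auto
  then show ?thesis using S T by (simp add: newton_number_swap)
qed

text \<open>The intermediate set \<open>U\<close> lets only one intercept change at a time; as the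
  origin is not in T, the inserted point leaves the y-intercept alone. With the origin in T
  monotonicity can fail: then T has value 1, and a smooth S has value 0.\<close>

lemma newton_number_mono:
  assumes S: "meets_axes S" and T: "meets_axes T" and sub: "newton_polyhedron S \<subseteq> newton_polyhedron T"
    and "(0, 0) \<notin> T"
  shows "\<mu> T \<le> \<mu> S"
proof -
  define U where "U = insert (x_intercept T, 0) S"
  have U: "meets_axes U" using S by (auto simp: meets_axes_def U_def)
  have pos: "x_intercept T \<noteq> 0" using x_intercept_mem[OF T] assms(4) by metis
  have 1: "newton_polyhedron S \<subseteq> newton_polyhedron U"
    by (rule newton_polyhedron_mono) (force simp: U_def)
  have "upper_set U \<subseteq> newton_polyhedron T"
  proof
    fix v assume "v \<in> upper_set U"
    then obtain x y i j where v: "v = (x, y)" "(i, j) \<in> U" "real i \<le> x" "real j \<le> y"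
      by (cases v) (auto simp: mem_upper_set)
    have "(real i, real j) \<in> newton_polyhedron T"
      using v(2) sub newton_polyhedron_point[of i j S] newton_polyhedron_point[OF x_intercept_mem[OF T]]
      by (auto simp: U_def)
    then show "v \<in> newton_polyhedron T" using v newton_polyhedron_upward by blast
  qed
  then have 2: "newton_polyhedron U \<subseteq> newton_polyhedron T"
    unfolding newton_polyhedron_eq[of U] by (rule hull_minimal) simp
  have "y_intercept S = y_intercept U"
    using pos by (simp add: y_intercept_def U_def)
  then have "\<mu> U \<le> \<mu> S"
    using S U 1 by (intro newton_number_mono_x)
  moreover have "x_intercept U = x_intercept T"
    unfolding x_intercept_def[of U]
  proof (rule Least_equality)
    fix i assume "(i, 0) \<in> U"
    then have "(real i, 0) \<in> newton_polyhedron T"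
      using newton_polyhedron_point[of i 0 U] 2 by auto
    then show "x_intercept T \<le> i" by (simp add: x_axis_polyhedron[OF T])
  qed (simp add: U_def)
  then have "\<mu> T \<le> \<mu> U"
    using T U 2 by (intro newton_number_mono_y)
  ultimately show ?thesis by simp
qed


section \<open>From facets to arbitrary weights\<close>

lemma poly2_sum: "poly2 (\<Sum>x\<in>A. g x) a b = (\<Sum>x\<in>A. poly2 (g x) a b)"
  by (simp add: poly2_def poly_sum)

lemma poly2_monom: "poly2 (monom (monom c i) j) a b = c * a ^ i * b ^ j"
  by (simp add: poly2_def poly_monom poly_power)

lemma poly2_0 [simp]: "poly2 0 a b = 0"
  by (simp add: poly2_def)

lemma pderiv_x_sum:
  fixes g :: "'b \<Rightarrow> 'a::idom poly poly"
  shows "pderiv_x (\<Sum>x\<in>A. g x) = (\<Sum>x\<in>A. pderiv_x (g x))"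
proof -
  have "pderiv_x (g + h) = pderiv_x g + pderiv_x h" for g h :: "'a poly poly"
    by (rule poly_eqI) (simp add: pderiv_x_def coeff_map_poly pderiv_add)
  then show ?thesis
    by (induction A rule: infinite_finite_induct) (simp_all add: pderiv_x_def)
qed

lemma pderiv_y_sum: "pderiv_y (\<Sum>x\<in>A. g x) = (\<Sum>x\<in>A. pderiv_y (g x))"
  unfolding pderiv_y_def
  by (induction A rule: infinite_finite_induct) (simp_all add: pderiv_add)

lemma poly2_pderiv_x_monom:
  "a * poly2 (pderiv_x (monom (monom c i) j)) a b = of_nat i * c * a ^ i * b ^ j"
proof -
  have "pderiv_x (monom (monom c i) j) = monom (monom (of_nat i * c) (i - 1)) j"
    by (simp add: pderiv_x_def map_poly_monom pderiv_monom)
  then show ?thesis by (cases i) (simp_all add: poly2_monom algebra_simps)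
qed

lemma poly2_pderiv_y_monom:
  "b * poly2 (pderiv_y (monom (monom c i) j)) a b = of_nat j * c * a ^ i * b ^ j"
proof -
  have "pderiv_y (monom (monom c i) j) = monom (monom (of_nat j * c) i) (j - 1)"
    by (simp add: pderiv_y_def pderiv_monom of_nat_poly mult_monom smult_monom)
  then show ?thesis by (cases j) (simp_all add: poly2_monom algebra_simps)
qed

text \<open>The exponents of minimal weight form a single monomial, which has no zero in the torus,
  or span a compact edge, where the facet condition applies. Multiplication by a and b turns partial
  derivatives into Euler derivatives.\<close>

lemma WNND_imp_WND:
  fixes f :: "'a::field series2"
  assumes "WNND f"
  shows "WND f"
  unfolding WND_def
proof (intro allI impI)
  fix p q n and a b :: 'a
  assume pq: "0 < p" "0 < q" and n: "init_ord p q f n" and ab: "a \<noteq> 0" "b \<noteq> 0"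
  define I where "I = {(i, j) \<in> line p q n. coeff2 f i j \<noteq> 0}"
  have finI: "finite I" unfolding I_def using pq by (auto intro: finite_subset[OF _ finite_line])
  have part: "part_val p q n a b g = (\<Sum>(i, j)\<in>I. coeff2 g i j * a ^ i * b ^ j)"
    if "\<And>i j. coeff2 f i j = 0 \<Longrightarrow> coeff2 g i j = 0" for g
    unfolding part_val_def using pq that by (intro sum.mono_neutral_right) (auto simp: I_def)
  obtain i0 j0 where ij0: "(i0, j0) \<in> I" using n by (auto simp: I_def init_ord_def line_def)
  show "part_val p q n a b f \<noteq> 0 \<or> part_val p q n a b (theta_x f) \<noteq> 0 \<or>
      part_val p q n a b (theta_y f) \<noteq> 0"
  proof (cases "I = {(i0, j0)}")
    case True
    then have "part_val p q n a b f = coeff2 f i0 j0 * a ^ i0 * b ^ j0" by (simp add: part)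
    then show ?thesis using ij0 ab by (auto simp: I_def)
  next
    case False
    then obtain i1 j1 where ij1: "(i1, j1) \<in> I" "(i1, j1) \<noteq> (i0, j0)" using ij0 by auto
    let ?P = "newton_polyhedron (supp f)"
    define H where "H = {v. (real p, real q) \<bullet> v = real n}"
    define F where "F = ?P \<inter> H"
    have ne: "supp f \<noteq> {}" using ij0 by (auto simp: I_def supp_def)
    have ge: "real n \<le> real p * real i + real q * real j" if "(i, j) \<in> supp f" for i j
    proof -
      have "n \<le> p * i + q * j" using that n by (auto simp: init_ord_def fil_def)
      then show ?thesis by (simp only: of_nat_mult[symmetric] of_nat_add[symmetric] of_nat_le_iff)
    qed
    have face: "F face_of ?P" "compact F"
      unfolding F_def H_def using supporting_line_face[OF ne _ _ ge] pq by simp_all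
    have mem_F: "(real i, real j) \<in> F \<longleftrightarrow> (i, j) \<in> line p q n" if "(i, j) \<in> supp f" for i j
    proof -
      have "real p * real i + real q * real j = real n \<longleftrightarrow> p * i + q * j = n"
        by (simp only: of_nat_mult[symmetric] of_nat_add[symmetric] of_nat_eq_iff)
      then show ?thesis using newton_polyhedron_point[OF that] by (simp add: F_def H_def line_def)
    qed
    \<comment> \<open>A face inside a line that contains two distinct points has dimension exactly
      1.\<close>
    have "aff_dim F \<le> aff_dim H" unfolding F_def by (rule aff_dim_subset) simp
    also have "\<dots> = 1" unfolding H_def using pq by (subst aff_dim_hyperplane) (auto simp: zero_prod_def)
    finally have "aff_dim F \<le> 1" .
    moreover have "{(real i0, real j0), (real i1, real j1)} \<subseteq> F"
      using mem_F[of i0 j0] mem_F[of i1 j1] ij0 ij1 by (auto simp: I_def)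
    then have "aff_dim {(real i0, real j0), (real i1, real j1)} \<le> aff_dim F" by (rule aff_dim_subset)
    moreover have "aff_dim {(real i0, real j0), (real i1, real j1)} = 1" using ij1(2) by (auto simp: aff_dim_2)
    ultimately have "F edge_of ?P" using face(1) by (simp add: edge_of_def)
    then have facet: "F \<in> newton_facets (supp f)" using face(2) by (simp add: newton_facets_def)
    have "{(i, j) \<in> supp f. (real i, real j) \<in> F} = I"
      using mem_F by (auto simp: I_def supp_def)
    then have in_face: "in_face F f = (\<Sum>(i, j)\<in>I. monom (monom (coeff2 f i j) i) j)"
      by (simp add: in_face_def)
    have "poly2 (in_face F f) a b = part_val p q n a b f"
      by (simp add: part in_face poly2_sum poly2_monom case_prod_unfold)
    moreover have "a * poly2 (pderiv_x (in_face F f)) a b = part_val p q n a b (theta_x f)"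
      by (subst part) (auto simp: theta_x_def in_face pderiv_x_sum poly2_sum sum_distrib_left
          poly2_pderiv_x_monom case_prod_unfold)
    moreover have "b * poly2 (pderiv_y (in_face F f)) a b = part_val p q n a b (theta_y f)"
      by (subst part) (auto simp: theta_y_def in_face pderiv_y_sum poly2_sum sum_distrib_left
          poly2_pderiv_y_monom case_prod_unfold)
    ultimately show ?thesis
      using assms facet ab unfolding WNND_def Let_def by (metis mult_eq_0_iff)
  qed
qed


section \<open>Branches under blowing up\<close>

declare strict_transform1.simps [simp del]

lemma chart_y_swap: "chart_y f = swap2 (chart_x (swap2 f))"
  by (simp only: strict_transform_Some_0 strict_transform_None mult_origin_swap2)

lemma chart_x_swap: "chart_x f = swap2 (chart_y (swap2 f))"
  by (simp only: chart_y_swap swap2_swap2)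

lemma chart_x_eq_0_iff [simp]: "chart_x f = 0 \<longleftrightarrow> f = 0"
  unfolding strict_transform_None by (rule blowx_eq_0_iff[OF fil_mult_origin])

lemma chart_x_mult:
  fixes f g :: "'a::idom series2"
  assumes "f \<noteq> 0" "g \<noteq> 0"
  shows "chart_x (f * g) = chart_x f * chart_x g"
  unfolding strict_transform_None mult_origin_mult[OF assms]
  by (rule blowx_mult) (rule fil_mult_origin)+

lemma chart_y_mult:
  fixes f g :: "'a::idom series2"
  assumes "f \<noteq> 0" "g \<noteq> 0"
  shows "chart_y (f * g) = chart_y f * chart_y g"
  using assms by (simp add: chart_y_swap swap2_mult chart_x_mult)

lemma WND_chart_x: "WND f \<Longrightarrow> WND (chart_x f)"
  unfolding strict_transform_None by (rule WND_blowx[OF _ fil_mult_origin])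

lemma WND_chart_y: "WND f \<Longrightarrow> WND (chart_y f)"
  unfolding chart_y_swap by (intro WND_swap2 WND_chart_x)

lemma fil_swap2: "f \<in> fil p q n \<Longrightarrow> swap2 f \<in> fil q p n"
  unfolding fil_def mem_Collect_eq coeff2_swap2 by (metis add.commute)

lemma toric_branch_swap2:
  assumes "toric_branch f"
  shows "toric_branch (swap2 f)"
proof -
  consider "f \<in> fil 1 0 1" "coeff2 f 1 0 \<noteq> 0" | "f \<in> fil 0 1 1" "coeff2 f 0 1 \<noteq> 0"
    | p q where "p > 0" "q > 0" "coprime p q" "f \<in> fil p q (p * q)" "coeff2 f q 0 \<noteq> 0" "coeff2 f 0 p \<noteq> 0"
    using assms unfolding toric_branch_def by blast
  then show ?thesis
  proof cases
    case (3 p q)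
    then have "swap2 f \<in> fil q p (q * p)" "coprime q p"
      using fil_swap2 by (simp_all add: mult.commute coprime_commute)
    then show ?thesis unfolding toric_branch_def using 3
      by (intro disjI2 exI[of _ q] exI[of _ p]) simp
  qed (use fil_swap2 in \<open>auto simp: toric_branch_def\<close>)
qed

text \<open>
  The lowest form of \<open>f\<close> runs from \<open>x\<^sup>a y\<^sup>j\<close> to \<open>x\<^sup>b y\<^sup>l\<close>.
\<close>

definition init_ends :: "'a::zero series2 \<Rightarrow> nat \<Rightarrow> nat \<Rightarrow> nat \<Rightarrow> nat \<Rightarrow> bool" where
  "init_ends f a j b l \<longleftrightarrow> corner 1 1 f a j \<and> corner 1 1 (swap2 f) l b"

lemma init_ends_mult:
  fixes f g :: "'a::idom series2"
  assumes "init_ends f a j b l" "init_ends g a' j' b' l'"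
  shows "init_ends (f * g) (a + a') (j + j') (b + b') (l + l')"
  using assms by (auto simp: init_ends_def swap2_mult intro: corner_mult)

lemma init_ends_swap2: "init_ends f a j b l \<Longrightarrow> init_ends (swap2 f) l b j a"
  by (simp add: init_ends_def)

text \<open>Used for branches with tangent x = 0: they pass through \<open>None\<close> and not
  through \<open>Some 0\<close>, and as their lowest form is a monomial they add nothing to the edge
  of slope -1.\<close>

definition tangent_x :: "'a::comm_ring_1 series2 \<Rightarrow> bool" where
  "tangent_x f \<longleftrightarrow> toric_branch (chart_x f) \<and> coeff2 (chart_y f) 0 0 \<noteq> 0 \<and> (\<exists>a j. init_ends f a j a j)"

lemma tangent_xI:
  assumes "f \<in> fil 1 1 m" "coeff2 f m 0 \<noteq> 0" "\<And>i j. coeff2 f i j \<noteq> 0 \<Longrightarrow> i + j = m \<Longrightarrow> j = 0"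
    and "toric_branch (blowx m f)"
  shows "tangent_x f"
proof -
  have "init_ord 1 1 f m" using assms(1,2) by (force simp: init_ord_def)
  then have m: "mult_origin f = m" by (rule mult_origin_eqI)
  have "coeff2 (chart_y f) 0 0 = coeff2 f m 0"
    by (simp only: strict_transform_Some_0 m coeff2_swap2 coeff2_blowx) simp
  moreover have "chart_x f = blowx m f" by (simp only: strict_transform_None m)
  moreover have "init_ends f m 0 m 0"
  proof -
    have "m \<le> k" if "coeff2 f k l \<noteq> 0" "k + l = m" for k l
      using assms(3)[OF that] that by simp
    moreover have "m \<le> k + l" "m \<le> l + k" if "coeff2 f k l \<noteq> 0" for k l
      using that assms(1) by (auto simp: fil_def add.commute)
    ultimately show ?thesis using assms(2) by (auto simp: init_ends_def corner_def fil_def)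
  qed
  ultimately show ?thesis using assms(2,4) unfolding tangent_x_def by metis
qed

text \<open>One step of Euclid's algorithm: for q < p the multiplicity is q, and the segment from
  (q, 0) to (0, p) becomes the one from (q, 0) to (0, p - q); for p < q the axes are exchanged. If p
  = q = 1, the branch avoids both fixed points and its lowest form has a segment of slope
  -1.\<close>

lemma toric_branch_cases:
  fixes f :: "'a::idom series2"
  assumes "toric_branch f"
  shows "tangent_x f \<or> tangent_x (swap2 f) \<or>
    coeff2 (chart_x f) 0 0 \<noteq> 0 \<and> coeff2 (chart_y f) 0 0 \<noteq> 0 \<and> init_ends f 0 1 1 0"
proof -
  have x: "tangent_x f" if "f \<in> fil 1 0 1" "coeff2 f 1 0 \<noteq> 0" for f :: "'a series2"
  proof (rule tangent_xI[where m = 1])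
    show "j = 0" if nz: "coeff2 f i j \<noteq> 0" "i + j = 1" for i j
      using \<open>f \<in> fil 1 0 1\<close> nz by (auto simp: fil_def)
    have "blowx 1 f \<in> fil 1 0 1" using that by (auto simp: fil_def coeff2_blowx split: if_splits)
    moreover have "coeff2 (blowx 1 f) 1 0 \<noteq> 0" using that by (simp add: coeff2_blowx)
    ultimately show "toric_branch (blowx 1 f)" by (simp add: toric_branch_def)
  qed (use that in \<open>auto simp: fil_def intro: trans_le_add1\<close>)
  have pq: "tangent_x f" if pq: "0 < q" "q < p" "coprime p q" and f: "f \<in> fil p q (p * q)"
    "coeff2 f q 0 \<noteq> 0" "coeff2 f 0 p \<noteq> 0" for f :: "'a series2" and p q
  proof (rule tangent_xI[where m = q])
    have ge: "p * q \<le> p * i + q * j" if "coeff2 f i j \<noteq> 0" for i j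
      using f(1) that by (auto simp: fil_def)
    show fil: "f \<in> fil 1 1 q"
    proof -
      have "q \<le> i + j" if "coeff2 f i j \<noteq> 0" for i j
      proof -
        have "p * q \<le> p * i + p * j" using ge[OF that] pq(2) by (meson add_left_mono le_trans less_imp_le mult_le_mono1)
        then have "p * q \<le> p * (i + j)" by (simp add: distrib_left)
        then show ?thesis using pq by simp
      qed
      then show ?thesis by (simp add: fil_def)
    qed
    show "j = 0" if nz: "coeff2 f i j \<noteq> 0" "i + j = q" for i j
    proof -
      have "p * (i + j) \<le> p * i + q * j" using ge[OF nz(1)] nz(2) by simp
      then have "p * j \<le> q * j" by (simp add: distrib_left)
      then show ?thesis using pq by auto
    qed
    obtain d where d: "p = q + d" "d > 0" using pq less_imp_add_positive by blast
    have "coprime d q" using pq(3) d by (simp add: coprime_iff_gcd_eq_1 add.commute[of q])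
    moreover have "blowx q f \<in> fil d q (d * q)"
      unfolding fil_def
    proof (intro CollectI allI impI)
      fix i j assume "coeff2 (blowx q f) i j \<noteq> 0"
      then have "i \<le> j + q" "coeff2 f i (j + q - i) \<noteq> 0" by (auto simp: coeff2_blowx split: if_splits)
      moreover obtain l where "j + q = i + l" using \<open>i \<le> j + q\<close> le_Suc_ex by blast
      ultimately have "p * q \<le> p * i + q * l" "q * (j + q) = q * (i + l)" using ge[of i l] by auto
      then show "d * q \<le> d * i + q * j" by (simp add: d algebra_simps)
    qed
    moreover have "coeff2 (blowx q f) q 0 \<noteq> 0" "coeff2 (blowx q f) 0 d \<noteq> 0"
      using f(2,3) by (auto simp: coeff2_blowx d add.commute)
    ultimately show "toric_branch (blowx q f)"
      using pq(1) d(2) unfolding toric_branch_def by blast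
  qed (use f in auto)
  from assms consider "f \<in> fil 1 0 1" "coeff2 f 1 0 \<noteq> 0" | "f \<in> fil 0 1 1" "coeff2 f 0 1 \<noteq> 0"
    | p q where "p > 0" "q > 0" "coprime p q" "f \<in> fil p q (p * q)" "coeff2 f q 0 \<noteq> 0" "coeff2 f 0 p \<noteq> 0"
    unfolding toric_branch_def by blast
  then show ?thesis
  proof cases
    case 1
    then show ?thesis using x by blast
  next
    case 2
    then have "tangent_x (swap2 f)" by (intro x) (auto simp: fil_def)
    then show ?thesis by blast
  next
    case (3 p q)
    consider "q < p" | "p < q" | "p = q" by linarith
    then show ?thesis
    proof cases
      case 1
      then show ?thesis using pq 3 by blast
    next
      case 2
      have "tangent_x (swap2 f)"
        using 3 2 fil_swap2[OF 3(4)]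
        by (intro pq[of p q]) (auto simp: mult.commute coprime_commute)
      then show ?thesis by blast
    next
      case eq: 3
      then have [simp]: "p = 1" "q = 1" using 3(3) by auto
      have "\<exists>i j. coeff2 f i j \<noteq> 0 \<and> 1 * i + 1 * j = 1"
        by (rule exI[of _ 1], rule exI[of _ 0]) (use 3 in simp)
      then have "init_ord 1 1 f 1" using 3(4) by (simp add: init_ord_def)
      then have m: "mult_origin f = 1" by (rule mult_origin_eqI)
      have "coeff2 (chart_x f) 0 0 \<noteq> 0"
        unfolding strict_transform_None m using 3 by (simp add: coeff2_blowx)
      moreover have "coeff2 (chart_y f) 0 0 \<noteq> 0"
        unfolding strict_transform_Some_0 m using 3 by (simp add: coeff2_blowx)
      moreover have "init_ends f 0 1 1 0"
        using 3 fil_swap2[OF 3(4)] by (simp add: init_ends_def corner_def)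
      ultimately show ?thesis by blast
    qed
  qed
qed

lemma toric_branch_nonzero: "toric_branch f \<Longrightarrow> f \<noteq> 0"
  by (auto simp: toric_branch_def)

lemma toric_branch_nonunit: "toric_branch f \<Longrightarrow> coeff2 f 0 0 = 0"
  using filD[of f _ _ _ 0 0] by (auto simp: toric_branch_def)

lemma mult_origin_unit: "coeff2 u 0 0 \<noteq> 0 \<Longrightarrow> mult_origin u = 0"
  by (subst mult_origin_eq_0_iff) auto

lemma unit_init_ends: "coeff2 u 0 0 \<noteq> 0 \<Longrightarrow> init_ends u 0 0 0 0"
  by (auto simp: init_ends_def corner_def fil_def)

lemma unit_charts:
  assumes "coeff2 u 0 0 \<noteq> 0"
  shows "coeff2 (chart_x u) 0 0 \<noteq> 0" "coeff2 (chart_y u) 0 0 \<noteq> 0"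
  unfolding strict_transform_None strict_transform_Some_0 mult_origin_unit[OF assms]
  using assms by (simp_all add: coeff2_blowx)

section \<open>Products of toric branches\<close>

lemma toric_product_nonzero:
  fixes A :: "'a::idom series2 multiset"
  assumes "\<forall>p\<in>#A. toric_branch p" "coeff2 u 0 0 \<noteq> 0"
  shows "u * prod_mset A \<noteq> 0"
proof -
  have "u \<noteq> 0" using assms(2) by auto
  moreover have "0 \<notin># A" using assms(1) toric_branch_nonzero by blast
  ultimately show ?thesis by (simp add: prod_mset_zero_iff)
qed

text \<open>Every factor contributes multiplicity at least 1. This bounds the number of factors in
  the base cases m = 0 and m = 1.\<close>

lemma size_le_mult_origin:
  fixes A :: "'a::idom series2 multiset"
  assumes "\<forall>p\<in>#A. toric_branch p" "coeff2 u 0 0 \<noteq> 0"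
  shows "size A \<le> mult_origin (u * prod_mset A)"
  using assms(1)
proof (induction A)
  case (add p A)
  have nz: "p \<noteq> 0" "u * prod_mset A \<noteq> 0"
    using add.prems toric_branch_nonzero toric_product_nonzero[of A u] assms(2) by auto
  have "mult_origin p \<noteq> 0" using add.prems toric_branch_nonunit[of p] mult_origin_eq_0_iff[OF nz(1)] by simp
  moreover have "mult_origin (u * prod_mset (add_mset p A)) = mult_origin p + mult_origin (u * prod_mset A)"
    using mult_origin_mult[OF nz] by (simp add: mult_ac)
  ultimately show ?case using add by simp
qed simp

text \<open>Each factor goes into B or into C, or becomes a unit in both charts and lengthens the
  edge of slope -1 by one. The count is written additively to avoid truncated subtraction.\<close>

lemma toric_product_charts:
  fixes A :: "'a::idom series2 multiset"
  assumes "\<forall>p\<in>#A. toric_branch p" "coeff2 u 0 0 \<noteq> 0"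
  shows "\<exists>B C v w a j b l. chart_x (u * prod_mset A) = v * prod_mset B \<and> coeff2 v 0 0 \<noteq> 0 \<and>
    (\<forall>p\<in>#B. toric_branch p) \<and> chart_y (u * prod_mset A) = w * prod_mset C \<and> coeff2 w 0 0 \<noteq> 0 \<and>
    (\<forall>p\<in>#C. toric_branch p) \<and> init_ends (u * prod_mset A) a j b l \<and>
    a + size A = size B + size C + b"
  using assms(1)
proof (induction A)
  case empty
  have "init_ends u 0 0 0 0" using assms(2) by (rule unit_init_ends)
  then show ?case
    using unit_charts[OF assms(2)]
    by (intro exI[of _ "{#}"] exI[of _ "chart_x u"] exI[of _ "chart_y u"] exI[of _ 0]) simp
next
  case (add p A)
  let ?f = "u * prod_mset A"
  have p: "toric_branch p" using add.prems by simp
  have nz: "p \<noteq> 0" "?f \<noteq> 0"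
    using add.prems toric_branch_nonzero toric_product_nonzero[of A u] assms(2) by auto
  obtain B C v w a j b l where IH: "chart_x ?f = v * prod_mset B" "coeff2 v 0 0 \<noteq> 0"
    "\<forall>p\<in>#B. toric_branch p" "chart_y ?f = w * prod_mset C" "coeff2 w 0 0 \<noteq> 0"
    "\<forall>p\<in>#C. toric_branch p" "init_ends ?f a j b l" "a + size A = size B + size C + b"
    using add.IH add.prems by auto
  have eq: "u * prod_mset (add_mset p A) = p * ?f" by (simp add: mult_ac)
  have charts: "chart_x (p * ?f) = chart_x p * (v * prod_mset B)"
    "chart_y (p * ?f) = chart_y p * (w * prod_mset C)"
    using chart_x_mult[OF nz] chart_y_mult[OF nz] IH by (simp_all only:)
  from toric_branch_cases[OF p] consider "tangent_x p" | "tangent_x (swap2 p)"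
    | "coeff2 (chart_x p) 0 0 \<noteq> 0" "coeff2 (chart_y p) 0 0 \<noteq> 0" "init_ends p 0 1 1 0" by blast
  then show ?case
  proof cases
    case 1
    then obtain a' j' where t: "toric_branch (chart_x p)" "coeff2 (chart_y p) 0 0 \<noteq> 0"
      "init_ends p a' j' a' j'" by (auto simp: tangent_x_def)
    show ?thesis
    proof (intro exI conjI)
      show "chart_x (u * prod_mset (add_mset p A)) = v * prod_mset (add_mset (chart_x p) B)"
        unfolding eq charts by (simp add: mult_ac)
      show "chart_y (u * prod_mset (add_mset p A)) = (chart_y p * w) * prod_mset (C)"
        unfolding eq charts by (simp add: mult_ac)
      show "init_ends (u * prod_mset (add_mset p A)) (a' + a) (j' + j) (a' + b) (j' + l)"
        unfolding eq by (rule init_ends_mult[OF t(3) IH(7)])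
    qed (use t IH in \<open>auto simp: coeff2_mult_00\<close>)
  next
    case 2
    then obtain a' j' where t: "toric_branch (chart_x (swap2 p))" "coeff2 (chart_y (swap2 p)) 0 0 \<noteq> 0"
      "init_ends (swap2 p) a' j' a' j'" unfolding tangent_x_def by blast
    have t: "toric_branch (chart_y p)" "coeff2 (chart_x p) 0 0 \<noteq> 0" "init_ends p j' a' j' a'"
      using toric_branch_swap2[OF t(1)] t(2) init_ends_swap2[OF t(3)]
      unfolding chart_y_swap[of p] chart_x_swap[of p] by simp_all
    show ?thesis
    proof (intro exI conjI)
      show "chart_x (u * prod_mset (add_mset p A)) = (chart_x p * v) * prod_mset (B)"
        unfolding eq charts by (simp add: mult_ac)
      show "chart_y (u * prod_mset (add_mset p A)) = w * prod_mset (add_mset (chart_y p) C)"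
        unfolding eq charts by (simp add: mult_ac)
      show "init_ends (u * prod_mset (add_mset p A)) (j' + a) (a' + j) (j' + b) (a' + l)"
        unfolding eq by (rule init_ends_mult[OF t(3) IH(7)])
    qed (use t IH in \<open>auto simp: coeff2_mult_00\<close>)
  next
    case t: 3
    show ?thesis
    proof (intro exI conjI)
      show "chart_x (u * prod_mset (add_mset p A)) = (chart_x p * v) * prod_mset (B)"
        unfolding eq charts by (simp add: mult_ac)
      show "chart_y (u * prod_mset (add_mset p A)) = (chart_y p * w) * prod_mset (C)"
        unfolding eq charts by (simp add: mult_ac)
      show "init_ends (u * prod_mset (add_mset p A)) (0 + a) (1 + j) (1 + b) (0 + l)"
        unfolding eq by (rule init_ends_mult[OF t(3) IH(7)])
    qed (use t IH in \<open>auto simp: coeff2_mult_00\<close>)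
  qed
qed


section \<open>Newton number and delta invariant\<close>

text \<open>The supports behind the supremum in the Newton number; their index is called k because m
  denotes the multiplicity.\<close>

definition with_axes :: "nat \<Rightarrow> (nat \<times> nat) set \<Rightarrow> (nat \<times> nat) set" where
  "with_axes k S = S \<union> {(k, 0), (0, k)}"

lemma meets_axes_with_axes [simp]: "meets_axes (with_axes k S)"
  by (auto simp: meets_axes_def with_axes_def)

lemma supp_chart_x: "supp (chart_x f) = blow_x (mult_origin f) (supp f)"
proof -
  let ?m = "mult_origin f"
  have "(i, j) \<in> supp (blowx ?m f) \<longleftrightarrow> (i, j) \<in> blow_x ?m (supp f)" for i j
  proof
    assume "(i, j) \<in> supp (blowx ?m f)"
    then have "i \<le> j + ?m" "coeff2 f i (j + ?m - i) \<noteq> 0" by (auto simp: coeff2_blowx split: if_splits)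
    then show "(i, j) \<in> blow_x ?m (supp f)"
      unfolding blow_x_def by (intro image_eqI[of _ _ "(i, j + ?m - i)"]) auto
  next
    assume "(i, j) \<in> blow_x ?m (supp f)"
    then obtain l where l: "coeff2 f i l \<noteq> 0" "j = i + l - ?m" by (auto simp: blow_x_def)
    moreover have "?m \<le> i + l" using fil_mult_origin[of f] l(1) by (auto simp: fil_def)
    ultimately show "(i, j) \<in> supp (blowx ?m f)" by (simp add: coeff2_blowx_eq)
  qed
  then show ?thesis unfolding strict_transform_None by auto
qed

lemma supp_swap2: "supp (swap2 f) = prod.swap ` supp f"
proof -
  have "(i, j) \<in> supp (swap2 f) \<longleftrightarrow> (i, j) \<in> prod.swap ` supp f" for i j
    by (simp only: mem_swap_image mem_supp coeff2_swap2)
  then show ?thesis by auto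
qed

lemma supp_chart_y: "supp (chart_y f) = blow_y (mult_origin f) (supp f)"
  unfolding chart_y_swap supp_swap2 supp_chart_x mult_origin_swap2
  by (auto simp: blow_x_def blow_y_def image_image case_prod_unfold add.commute)


text \<open>The exponent (k, 0) goes to (k, k - m) instead of (k - m, 0). Both lie above (a, 0), so
  the polyhedron does not see the difference.\<close>

lemma newton_number_with_axes_blow_x:
  assumes "m \<le> k" "(a, 0) \<in> blow_x m S" "a \<le> k - m"
  shows "\<mu> (blow_x m (with_axes k S)) =
    \<mu> (with_axes (k - m) (blow_x m S))"
proof (intro newton_number_cong equalityI newton_polyhedron_mono)
  have eq: "blow_x m (with_axes k S) = blow_x m S \<union> {(k, k - m), (0, k - m)}"
    by (auto simp: blow_x_def with_axes_def)
  fix i j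
  show "\<exists>(i', j')\<in>with_axes (k - m) (blow_x m S). i' \<le> i \<and> j' \<le> j"
    if "(i, j) \<in> blow_x m (with_axes k S)"
    using that unfolding eq
    by (cases "(i, j) \<in> blow_x m S") (auto simp: with_axes_def)
  show "\<exists>(i', j')\<in>blow_x m (with_axes k S). i' \<le> i \<and> j' \<le> j"
    if ij: "(i, j) \<in> with_axes (k - m) (blow_x m S)"
  proof -
    consider "(i, j) \<in> blow_x m S" | "(i, j) = (k - m, 0)" | "(i, j) = (0, k - m)"
      using ij by (auto simp: with_axes_def)
    then show ?thesis
    proof cases
      case 1
      then show ?thesis unfolding eq by (intro bexI[of _ "(i, j)"]) auto
    next
      case 2
      then show ?thesis unfolding eq using assms by (intro bexI[of _ "(a, 0)"]) auto
    next
      case 3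
      then show ?thesis unfolding eq by (intro bexI[of _ "(0, k - m)"]) auto
    qed
  qed
qed

lemma swap_with_axes: "prod.swap ` with_axes k S = with_axes k (prod.swap ` S)"
  by (auto simp: with_axes_def)

lemma newton_number_with_axes_blow_y:
  assumes "m \<le> k" "(0, b) \<in> blow_y m S" "b \<le> k - m"
  shows "\<mu> (blow_y m (with_axes k S)) =
    \<mu> (with_axes (k - m) (blow_y m S))"
proof -
  have "meets_axes (blow_y m (with_axes k S))"
  proof -
    have "(k - m, 0) \<in> blow_y m (with_axes k S)"
      using imageI[of "(k, 0)" "with_axes k S" "\<lambda>(i, j). (i + j - m, j)"]
      by (simp add: blow_y_def with_axes_def)
    moreover have "(0, b) \<in> blow_y m (with_axes k S)"
      using assms(2) by (auto simp: blow_y_def with_axes_def)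
    ultimately show ?thesis unfolding meets_axes_def by blast
  qed
  then have "\<mu> (blow_y m (with_axes k S)) =
      \<mu> (blow_x m (with_axes k (prod.swap ` S)))"
    by (metis newton_number_swap swap_blow swap_with_axes)
  also have "\<dots> = \<mu> (with_axes (k - m) (blow_x m (prod.swap ` S)))"
    using assms by (intro newton_number_with_axes_blow_x[where a = b]) (auto simp: swap_blow[symmetric])
  also have "\<dots> = \<mu> (with_axes (k - m) (blow_y m S))"
    by (metis meets_axes_with_axes newton_number_swap swap_blow swap_with_axes)
  finally show ?thesis .
qed

text \<open>Up to exchanging the axes the diagram is a segment from (1, 0), and (A - 1) (B - 1) = 0
  for A = 1.\<close>

lemma newton_number_mult_1:
  assumes "coeff2 f 0 0 = 0" "coeff2 f 1 0 \<noteq> 0 \<or> coeff2 f 0 1 \<noteq> 0" "k \<ge> 1"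
  shows "\<mu> (with_axes k (supp f)) = 0"
proof -
  have *: "\<mu> (with_axes k (supp f)) = 0" if f: "coeff2 f 0 0 = 0" "coeff2 f 1 0 \<noteq> 0" for f :: "'a series2"
  proof -
    let ?T = "with_axes k (supp f)"
    have T: "(0, y_intercept ?T) \<in> ?T" by (intro y_intercept_mem) simp
    moreover have "(0, 0) \<notin> ?T" using f assms(3) by (auto simp: with_axes_def)
    ultimately have "y_intercept ?T > 0" by (metis gr0I)
    moreover have "1 * y_intercept ?T \<le> y_intercept ?T * i + 1 * j" if "(i, j) \<in> ?T" for i j
      using that y_intercept_le[of j ?T] by (cases i) auto
    moreover have "(1, 0) \<in> ?T" using f by (simp add: with_axes_def)
    ultimately show ?thesis using newton_number_triangle[of 1 "y_intercept ?T" ?T] T by simp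
  qed
  show ?thesis
  proof (cases "coeff2 f 1 0 \<noteq> 0")
    case False
    then have "\<mu> (with_axes k (supp (swap2 f))) = 0" using assms by (intro *) auto
    then show ?thesis
      unfolding supp_swap2 swap_with_axes[symmetric] by (simp add: newton_number_swap)
  qed (use * assms in blast)
qed

text \<open>
  Neither \<open>x\<^sup>2\<close> nor \<open>y\<^sup>2\<close> divides \<open>f\<close>, as witnessed by the exponents \<open>(i, y)\<close> and \<open>(x, j)\<close>;
  the number \<open>x + y\<close> drops under blowing up.
\<close>

lemma newton_number_toric_product:
  fixes f :: "'a::idom series2"
  assumes "WND f" and f: "f = u * prod_mset A" "coeff2 u 0 0 \<noteq> 0" "\<forall>p\<in>#A. toric_branch p"
    and iy: "coeff2 f i y \<noteq> 0" "i \<le> 1" and xj: "coeff2 f x j \<noteq> 0" "j \<le> 1"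
  shows "finite (singular_points f) \<and> (\<exists>K. \<forall>k\<ge>K. \<mu> (with_axes k (supp f)) =
    2 * real (finite_delta f) - real (size A) + 1)"
  using assms
proof (induction "x + y" arbitrary: f u A i y x j rule: less_induct)
  case less
  note f = less.prems(2-4) and iy = less.prems(5,6) and xj = less.prems(7,8)
  define m where "m = mult_origin f"
  have nz: "f \<noteq> 0" using toric_product_nonzero[OF f(3,2)] f(1) by simp
  have size_le: "size A \<le> m" using size_le_mult_origin[OF f(3,2)] f(1) by (simp add: m_def)
  have m_fil: "f \<in> fil 1 1 m" unfolding m_def by (rule fil_mult_origin)
  have m_le: "m \<le> k + l" if "coeff2 f k l \<noteq> 0" for k l
    using m_fil that by (auto simp: fil_def)
  consider "m = 0" | "m = 1" | "m \<ge> 2" by linarith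
  then show ?case
  proof cases
    case 1
    then have "(0, 0) \<in> supp f" using mult_origin_eq_0_iff[OF nz] by (simp add: m_def)
    then have "\<mu> (with_axes k (supp f)) = 1" for k
      by (intro newton_number_origin) (simp add: with_axes_def)
    moreover have "singular_points f = {}" using 1 by (intro singular_points_smooth) (simp add: m_def)
    ultimately show ?thesis using size_le 1 by (simp add: finite_delta_def)
  next
    case 2
    have "size A \<noteq> 0"
    proof
      assume "size A = 0"
      then have "f = u" using f(1) by simp
      then show False using 2 mult_origin_unit[OF f(2)] by (simp add: m_def)
    qed
    then have "size A = 1" using size_le 2 by linarith
    moreover have "singular_points f = {}" using 2 by (intro singular_points_smooth) (simp add: m_def)
    moreover obtain k l where "coeff2 f k l \<noteq> 0" "k + l = 1"
      using init_ord_mult_origin[OF nz] 2 by (auto simp: init_ord_def m_def)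
    then have "coeff2 f 1 0 \<noteq> 0 \<or> coeff2 f 0 1 \<noteq> 0" by (cases k) auto
    moreover have "coeff2 f 0 0 = 0" using m_le[of 0 0] 2 by auto
    ultimately show ?thesis using newton_number_mult_1[of f]
      by (auto simp: finite_delta_def intro!: exI[of _ 1])
  next
    case 3
    obtain B C v w a b c l where bl: "chart_x f = v * prod_mset B" "coeff2 v 0 0 \<noteq> 0"
      "\<forall>p\<in>#B. toric_branch p" "chart_y f = w * prod_mset C" "coeff2 w 0 0 \<noteq> 0"
      "\<forall>p\<in>#C. toric_branch p" "init_ends f a c b l" "a + size A = size B + size C + b"
      using toric_product_charts[OF f(3,2)] f(1) by auto
    have ac: "coeff2 f a c \<noteq> 0" "a + c = m" and bl': "coeff2 f b l \<noteq> 0" "b + l = m"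
    proof -
      have "init_ord 1 1 f (a + c)" "init_ord 1 1 (swap2 f) (l + b)"
        using bl(7) by (auto simp: init_ends_def corner_def init_ord_def)
      then show "a + c = m" "b + l = m"
        using mult_origin_eqI[of f "a + c"] mult_origin_eqI[of f "l + b"] by (simp_all add: m_def)
      show "coeff2 f a c \<noteq> 0" "coeff2 f b l \<noteq> 0"
        using bl(7) by (auto simp: init_ends_def corner_def)
    qed
    have a_min: "a \<le> i'" if "coeff2 f i' j' \<noteq> 0" "i' + j' = m" for i' j'
      using bl(7) that ac by (auto simp: init_ends_def corner_def)
    have l_min: "l \<le> j'" if "coeff2 f i' j' \<noteq> 0" "i' + j' = m" for i' j'
      using bl(7) that bl' by (auto simp: init_ends_def corner_def add.commute)
    have coeff_x: "coeff2 (chart_x f) i' (i' + j' - m) = coeff2 f i' j'" if "m \<le> i' + j'" for i' j'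
      unfolding strict_transform_None m_def[symmetric] using that by (rule coeff2_blowx_eq)
    have coeff_y: "coeff2 (chart_y f) (i' + j' - m) j' = coeff2 f i' j'" if "m \<le> i' + j'" for i' j'
      unfolding strict_transform_Some_0 m_def[symmetric] coeff2_swap2
      using coeff2_blowx_eq[of m j' i' "swap2 f"] that by (simp add: add.commute)
    have miy: "m \<le> i + y" and mxj: "m \<le> x + j" using m_le iy xj by auto
    \<comment> \<open>If x + j > m, then x \<ge> m \<ge> a because j \<le> 1.\<close>
    have "a \<le> x"
      using xj a_min[of x j] ac mxj by (cases "x + j = m") auto
    have "l \<le> y"
      using iy l_min[of i y] bl' miy by (cases "i + y = m") auto
    \<comment> \<open>The new witnesses are (i, i + y - m) and (a, 0). Since i \<le> 1 and m \<ge>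
      2, the height falls below y, while a \<le> x.\<close>
    have IHx: "finite (singular_points (chart_x f)) \<and>
        (\<exists>K. \<forall>k\<ge>K. \<mu> (with_axes k (supp (chart_x f))) =
          2 * real (finite_delta (chart_x f)) - real (size B) + 1)"
    proof (rule less.hyps[OF _ _ bl(1-3)])
      show "a + (i + y - m) < x + y" using \<open>a \<le> x\<close> iy(2) 3 miy by simp
      show "WND (chart_x f)" using less.prems(1) by (rule WND_chart_x)
      show "coeff2 (chart_x f) i (i + y - m) \<noteq> 0" using coeff_x[OF miy] iy by simp
      show "coeff2 (chart_x f) a 0 \<noteq> 0" using coeff_x[of a c] ac by simp
    qed (use iy in auto)
    have IHy: "finite (singular_points (chart_y f)) \<and>
        (\<exists>K. \<forall>k\<ge>K. \<mu> (with_axes k (supp (chart_y f))) =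
          2 * real (finite_delta (chart_y f)) - real (size C) + 1)"
    proof (rule less.hyps[OF _ _ bl(4-6)])
      show "(x + j - m) + l < x + y" using \<open>l \<le> y\<close> xj(2) 3 mxj by simp
      show "WND (chart_y f)" using less.prems(1) by (rule WND_chart_y)
      show "coeff2 (chart_y f) 0 l \<noteq> 0" using coeff_y[of b l] bl' by simp
      show "coeff2 (chart_y f) (x + j - m) j \<noteq> 0" using coeff_y[OF mxj] xj by simp
    qed (use xj in auto)
    obtain K1 K2 where K1: "\<And>k. k \<ge> K1 \<Longrightarrow> \<mu> (with_axes k (supp (chart_x f))) =
          2 * real (finite_delta (chart_x f)) - real (size B) + 1"
      and K2: "\<And>k. k \<ge> K2 \<Longrightarrow> \<mu> (with_axes k (supp (chart_y f))) =
          2 * real (finite_delta (chart_y f)) - real (size C) + 1"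
      using IHx IHy by blast
    have 2: "2 \<le> mult_origin f" using 3 by (simp add: m_def)
    note delta = delta_blowup[OF less.prems(1) nz 2 conjunct1[OF IHx] conjunct1[OF IHy]]
    \<comment> \<open>The summand 2 m keeps the added exponents above degree m and makes k - m at
      least a and l; K1 + K2 makes k - m large enough for both induction hypotheses.\<close>
    have "\<mu> (with_axes k (supp f)) =
        2 * real (finite_delta f) - real (size A) + 1"
      if k: "k \<ge> K1 + K2 + 2 * m" for k
    proof -
      have mem: "(i', j') \<in> with_axes k (supp f) \<longleftrightarrow>
          coeff2 f i' j' \<noteq> 0 \<or> (i', j') = (k, 0) \<or> (i', j') = (0, k)" for i' j'
        by (auto simp: with_axes_def)
      have "\<mu> (with_axes k (supp f)) = real m * real m - real m +
          \<mu> (blow_x m (with_axes k (supp f))) +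
          \<mu> (blow_y m (with_axes k (supp f))) - (real b - real a) - 1"
      proof (rule newton_number_blowup)
        show "(a, m - a) \<in> with_axes k (supp f)" "(b, m - b) \<in> with_axes k (supp f)"
        proof -
          have "m - a = c" "m - b = l" using ac(2) bl'(2) by auto
          then show "(a, m - a) \<in> with_axes k (supp f)" "(b, m - b) \<in> with_axes k (supp f)"
            using ac(1) bl'(1) by (simp_all add: mem)
        qed
        show "m \<le> i' + j'" if "(i', j') \<in> with_axes k (supp f)" for i' j'
          using that m_le k by (auto simp: mem)
        show "a \<le> i'" if "(i', j') \<in> with_axes k (supp f)" "i' + j' = m" for i' j'
          using that a_min k 3 by (auto simp: mem)
        show "i' \<le> b" if "(i', j') \<in> with_axes k (supp f)" "i' + j' = m" for i' j'
        proof -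
          have "l \<le> j'" using that l_min k 3 by (auto simp: mem)
          then show ?thesis using bl' that(2) by simp
        qed
      qed (use 3 ac bl' in auto)
      also have "\<mu> (blow_x m (with_axes k (supp f))) =
          \<mu> (with_axes (k - m) (supp (chart_x f)))"
      proof -
        have "(a, 0) \<in> supp (chart_x f)" using coeff_x[of a c] ac by simp
        then show ?thesis
          unfolding supp_chart_x m_def[symmetric] using k ac(2) by (intro newton_number_with_axes_blow_x[where a = a]) auto
      qed
      also have "\<mu> (blow_y m (with_axes k (supp f))) =
          \<mu> (with_axes (k - m) (supp (chart_y f)))"
      proof -
        have "(0, l) \<in> supp (chart_y f)" using coeff_y[of b l] bl' by simp
        then show ?thesis
          unfolding supp_chart_y m_def[symmetric] using k bl'(2) by (intro newton_number_with_axes_blow_y[where b = l]) auto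
      qed
      also have "\<mu> (with_axes (k - m) (supp (chart_x f))) =
          2 * real (finite_delta (chart_x f)) - real (size B) + 1"
        using k by (intro K1) simp
      also have "\<mu> (with_axes (k - m) (supp (chart_y f))) =
          2 * real (finite_delta (chart_y f)) - real (size C) + 1"
        using k by (intro K2) simp
      finally have N: "\<mu> (with_axes k (supp f)) = real m * real m - real m +
          (2 * real (finite_delta (chart_x f)) - real (size B) + 1) +
          (2 * real (finite_delta (chart_y f)) - real (size C) + 1) -
          (real b - real a) - 1" .
      have "even (m * (m - 1))" by (cases m) auto
      then have "2 * real (m * (m - 1) div 2) = real (m * (m - 1))"
        by (metis dvd_mult_div_cancel of_nat_mult of_nat_numeral)
      also have "\<dots> = real m * real m - real m" using 3 by (simp add: of_nat_diff algebra_simps)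
      finally have mm: "2 * real (m * (m - 1) div 2) = real m * real m - real m" .
      \<comment> \<open>The edge length b - a is the number of factors lost in both charts, so it
        cancels against the change in the number of factors.\<close>
      have "real a + real (size A) = real (size B) + real (size C) + real b"
        using bl(8) by (simp only: of_nat_add[symmetric])
      then show ?thesis
        unfolding N delta(2) m_def[symmetric] of_nat_add distrib_left mm by linarith
    qed
    then show ?thesis using delta(1) by blast
  qed
qed

section \<open>Passing to the supremum\<close>

lemma with_axes_antimono:
  assumes "k \<le> k'"
  shows "newton_polyhedron (with_axes k' S) \<subseteq> newton_polyhedron (with_axes k S)"
  by (rule newton_polyhedron_mono) (use assms in \<open>auto simp: with_axes_def\<close>)

lemma newton_number_with_axes_mono:
  assumes "(0, 0) \<notin> S" "1 \<le> k" "k \<le> k'"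
  shows "\<mu> (with_axes k S) \<le> \<mu> (with_axes k' S)"
  using assms
  by (intro newton_number_mono with_axes_antimono meets_axes_with_axes) (auto simp: with_axes_def)

text \<open>A monotone, eventually constant sequence has its final value as supremum. For a
  convenient support, far axis exponents are absorbed by the polyhedron.\<close>

lemma newton_number_eventually:
  assumes "(0, 0) \<notin> supp f" "f \<noteq> 0"
    and K: "\<And>k. k \<ge> K \<Longrightarrow> \<mu> (with_axes k (supp f)) = r"
  shows "newton_number f = ereal r"
proof (cases "convenient (supp f)")
  case True
  then have S: "meets_axes (supp f)" using assms(2) convenient_iff supp_eq_empty_iff by blast
  define k where "k = K + x_intercept (supp f) + y_intercept (supp f)"
  have P: "newton_polyhedron (with_axes k (supp f)) = newton_polyhedron (supp f)"
  proof (intro equalityI newton_polyhedron_mono)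
    fix i j assume "(i, j) \<in> with_axes k (supp f)"
    then consider "(i, j) \<in> supp f" | "(i, j) = (k, 0)" | "(i, j) = (0, k)" by (auto simp: with_axes_def)
    then show "\<exists>(i', j')\<in>supp f. i' \<le> i \<and> j' \<le> j"
    proof cases
      case 2
      then show ?thesis using x_intercept_mem[OF S]
        by (intro bexI[of _ "(x_intercept (supp f), 0)"]) (auto simp: k_def)
    next
      case 3
      then show ?thesis using y_intercept_mem[OF S]
        by (intro bexI[of _ "(0, y_intercept (supp f))"]) (auto simp: k_def)
    qed auto
  next
    fix i j assume "(i, j) \<in> supp f"
    then show "\<exists>(i', j')\<in>with_axes k (supp f). i' \<le> i \<and> j' \<le> j" by (auto simp: with_axes_def)
  qed
  have "\<mu> (supp f) = r"
    using newton_number_cong[OF P] K[of k] by (simp add: k_def)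
  then show ?thesis using True by (simp add: newton_number_def)
next
  case False
  have "(SUP k\<in>{1..}. ereal (\<mu> (with_axes k (supp f)))) = ereal r"
  proof (rule SUP_eqI)
    fix k :: nat assume "k \<in> {1..}"
    then have "\<mu> (with_axes k (supp f)) \<le>
        \<mu> (with_axes (max k K) (supp f))"
      using assms(1) by (intro newton_number_with_axes_mono) auto
    then show "ereal (\<mu> (with_axes k (supp f))) \<le> ereal r" by (simp add: K)
  next
    fix z assume "\<And>k. k \<in> {1..} \<Longrightarrow> ereal (\<mu> (with_axes k (supp f))) \<le> z"
    from this[of "max 1 K"] show "ereal r \<le> z" by (simp add: K)
  qed
  then show ?thesis using False by (simp add: newton_number_def with_axes_def)
qed

text \<open>If x^2 divides f, all exponents lie above (2, 0) or (0, k), and the segment between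
  these two has Newton number k - 1.\<close>

lemma newton_number_infinite:
  assumes "(0, 0) \<notin> supp f" "f \<noteq> 0" "f \<in> fil 1 0 2 \<or> f \<in> fil 0 1 2"
  shows "newton_number f = \<infinity>"
proof -
  have not_conv: "\<not> convenient (supp f)"
  proof
    assume "convenient (supp f)"
    then have "meets_axes (supp f)" using assms(2) convenient_iff supp_eq_empty_iff by blast
    then show False using assms(3) filD[of f 1 0 2 0] filD[of f 0 1 2 _ 0] by (auto simp: meets_axes_def)
  qed
  have *: "real k - 1 \<le> \<mu> (with_axes k (supp f))" if k: "k \<ge> 2" and f: "f \<in> fil 1 0 2"
    for k and f :: "'a series2"
  proof -
    have "\<mu> {(2, 0), (0, k)} = real 2 * real k - real 2 - real k + 1"
      using k by (intro newton_number_triangle) auto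
    moreover have "\<mu> {(2, 0), (0, k)} \<le> \<mu> (with_axes k (supp f))"
    proof (intro newton_number_mono newton_polyhedron_mono)
      fix i j assume "(i, j) \<in> with_axes k (supp f)"
      then show "\<exists>(i', j')\<in>{(2, 0), (0, k)}. i' \<le> i \<and> j' \<le> j"
        using k f by (auto simp: with_axes_def fil_def)
    qed (use k in \<open>auto simp: meets_axes_def with_axes_def\<close>)
    ultimately show ?thesis by simp
  qed
  have ge: "real k - 1 \<le> \<mu> (with_axes k (supp f))" if k: "k \<ge> 2" for k
  proof (cases "f \<in> fil 1 0 2")
    case False
    then have "real k - 1 \<le> \<mu> (with_axes k (supp (swap2 f)))"
      using assms(3) k fil_swap2 by (intro *) auto
    then show ?thesis unfolding supp_swap2 swap_with_axes[symmetric] by (simp add: newton_number_swap)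
  qed (use * k in blast)
  have "(SUP k\<in>{1..}. ereal (\<mu> (with_axes k (supp f)))) = \<infinity>"
  proof (rule SUP_PInfty)
    fix n :: nat
    show "\<exists>k\<in>{1..}. ereal (real n) \<le> ereal (\<mu> (with_axes k (supp f)))"
      using ge[of "n + 2"] by (intro bexI[of _ "n + 2"]) auto
  qed
  then show ?thesis using not_conv by (simp add: newton_number_def with_axes_def)
qed

theorem theorem4p12:
  fixes f :: "'a::alg_closed_field series2"
  assumes "f \<noteq> 0" and "f \<in> max_ideal" and "WNND f"
  shows "newton_number f = 2 * ereal_of_enat (delta f) - ereal (real (num_branches f)) + 1"
proof -
  have f00: "(0, 0) \<notin> supp f"
    using assms(2) by (auto simp: max_ideal_def coeff2_var_x_mult coeff2_var_y_mult)
  have WND: "WND f" using assms(3) by (rule WNND_imp_WND)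
  show ?thesis
  proof (cases "f \<in> fil 1 0 2 \<or> f \<in> fil 0 1 2")
    case True
    then have "delta f = \<infinity>" using assms(1) delta_double_y_axis delta_double_x_axis by blast
    then show ?thesis using newton_number_infinite[OF f00 assms(1) True] by simp
  next
    case False
    \<comment> \<open>Non-divisibility by x^2 and y^2 supplies the exponents near the axes that
      start the induction.\<close>
    then obtain i y x j where iy: "coeff2 f i y \<noteq> 0" "i \<le> 1" and xj: "coeff2 f x j \<noteq> 0" "j \<le> 1"
      by (auto simp: fil_def not_le less_Suc_eq_le numeral_2_eq_2)
    \<comment> \<open>Stated for an arbitrary factorization because it is used again for the
      competitors in \<open>the_equality\<close>.\<close>
    have factorization: "finite (singular_points f) \<and> newton_number f = ereal (2 * real (finite_delta f) - real (size A) + 1)"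
      if A: "\<forall>p\<in>#A. irreducible p" "u dvd 1" "f = u * prod_mset A" for A u
    proof -
      have "toric_branch p" if p: "p \<in># A" for p
      proof (rule irreducible_imp_toric_branch)
        show "irreducible p" using A p by blast
        have "f = p * (u * prod_mset (A - {#p#}))"
        proof -
          have "prod_mset A = p * prod_mset (A - {#p#})"
            using p by (metis insert_DiffM prod_mset.add_mset)
          then show ?thesis using A(3) by (simp add: mult_ac)
        qed
        then show "WND p"
          using WND assms(1) WND_factor[of p "u * prod_mset (A - {#p#})"] by auto
      qed
      moreover have "coeff2 u 0 0 \<noteq> 0" using A(2) by (simp add: unit_series2_iff)
      ultimately have "finite (singular_points f) \<and>
          (\<exists>K. \<forall>k\<ge>K. \<mu> (with_axes k (supp f)) = 2 * real (finite_delta f) - real (size A) + 1)"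
        using newton_number_toric_product[OF WND A(3) _ _ iy xj] by blast
      then show ?thesis using newton_number_eventually[OF f00 assms(1)] by blast
    qed
    obtain A u where A: "\<forall>p\<in>#A. irreducible p" "u dvd 1" "f = u * prod_mset A"
      using irreducible_factorization_exists[OF assms(1)] by blast
    note A' = factorization[OF A]
    have "num_branches f = size A"
      unfolding num_branches_def
    proof (rule the_equality)
      fix n assume "\<exists>B v. (\<forall>p\<in>#B. irreducible p) \<and> v dvd 1 \<and> f = v * prod_mset B \<and> size B = n"
      then have "newton_number f = ereal (2 * real (finite_delta f) - real n + 1)" using factorization by blast
      then show "n = size A" using A' by simp
    qed (use A in blast)
    moreover have "delta f = enat (finite_delta f)" using A' by (intro delta_finite) simp
    ultimately show ?thesis using A' by (simp add: ereal_of_enat_def)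
  qed
qed

end
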